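(* Let $k\ge 1$ be an integer and let $X_k$ be a random variable on $(0,\infty)$ with density function $\frac{1}{x}v_k(x)$. Then $v_k(x)=\frac{1}{x}v_k\left(\frac{1}{x}\right)$ for all $x>0$. Consequently, $1/X_k$ has the size-biased distribution obtained from $X_k$, and hence $$\mathbb{E}(X_k f(X_k))=\mathbb{E}\left(f\left(\tfrac{1}{X_k}\right)\right)$$ for every measurable function $f$ on $(0,\infty)$ for which these expectations exist, and $$\mathbb{E}(X_k^s)=\left(2\xi(s)\right)^k\qquad (s\in\mathbb{C}).$$ Additionally, $\mathbb{E}(X_k)=1$ and $\mathbb{V}(X_k)=(2\xi(2))^k-1$.
   Context: $\zeta$ is the Riemann zeta function and $\xi(s):=\frac{1}{2}s(s-1)\pi^{-s/2}\Gamma\left(\frac{s}{2}\right)\zeta(s)$ is the Riemann xi function (an entire function, with removable singularities filled in). For an integer $k\ge1$, real $c>1$ and $x>0$, define $$w_k(x):=\frac{1}{2\pi i}\int_{(c)}\left(\Gamma\left(\tfrac{s}{2}\right)\zeta(s)\pi^{-s/2}\right)^k x^{-s}\,ds,$$ where $\int_{(c)}$ denotes integration along the vertical line $\Re(s)=c$. Define the differential operators $$D^{1}_x=\frac{\partial}{\partial x}\,x^2\,\frac{\partial}{\partial x},\qquad D^{k}_x=\frac{\partial}{\partial x}\,x^2\,\underbrace{\frac{\partial^2}{\partial x^2}x^2\cdots\frac{\partial^2}{\partial x^2}x^2}_{k-1\text{ blocks}}\,\frac{\partial}{\partial x},$$ (so $D^2_x=\frac{\partial}{\partial x}x^2\frac{\partial^2}{\partial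 x^2}x^2\frac{\partial}{\partial x}$), where each power $x^2$ acts as multiplication on everything to its right, and set $v_k(x):=D^k_x(w_k(x))$ for $x>0$. $\mathbb{E}$ and $\mathbb{V}$ denote expectation and variance. For a positive random variable $X$ with density $g$ and finite mean, the size-biased distribution obtained from $X$ is the distribution with density $x g(x)/\mathbb{E}(X)$. *)

theory Defs
  imports "HOL-Complex_Analysis.Complex_Analysis" "HOL-Probability.Probability"
begin

text \<open>
  The Riemann zeta function as the analytic continuation of its Dirichlet series to the plane
  punctured at the pole \<open>1\<close>. The value \<open>0\<close> at the pole is a convention that only serves to make
  the description unique.
\<close>

definition zeta :: "complex \<Rightarrow> complex" where
  "zeta = (THE f. f holomorphic_on (- {1}) \<and>
                  (\<forall>s. Re s > 1 \<longrightarrow> f s = (\<Sum>n. 1 / of_nat (Suc n) powr s)) \<and>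
                  f 1 = 0)"

text \<open>
  The defining formula has removable singularities at \<open>1\<close> and at the poles \<open>0, -2, -4, \<dots>\<close> of
  \<open>Gamma (s / 2)\<close>.
\<close>

definition xi :: "complex \<Rightarrow> complex" where
  "xi = remove_sings
     (\<lambda>s. 1 / 2 * s * (s - 1) * complex_of_real pi powr (- s / 2) * Gamma (s / 2) * zeta s)"

text \<open>
  The integral of \<open>f\<close> along the upward vertical line \<open>Re s = c\<close>, parametrised by \<open>s = c + \<i> t\<close>,
  \<open>ds = \<i> dt\<close>.
\<close>

definition vertical_line_integral :: "real \<Rightarrow> (complex \<Rightarrow> complex) \<Rightarrow> complex" where
  "vertical_line_integral c f = (LINT t|lborel. f (Complex c t) * \<i>)"

definition w :: "nat \<Rightarrow> real \<Rightarrow> real \<Rightarrow> complex" where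
  "w k c x = 1 / (2 * complex_of_real pi * \<i>) *
     vertical_line_integral c
       (\<lambda>s. (Gamma (s / 2) * zeta s * complex_of_real pi powr (- s / 2)) ^ k
             * complex_of_real x powr (- s))"

definition Dx :: "(real \<Rightarrow> 'a::real_normed_vector) \<Rightarrow> real \<Rightarrow> 'a" where
  "Dx f = (\<lambda>x. vector_derivative f (at x))"

definition mult_sq :: "(real \<Rightarrow> 'a::real_normed_vector) \<Rightarrow> real \<Rightarrow> 'a" where
  "mult_sq f = (\<lambda>x. x\<^sup>2 *\<^sub>R f x)"

definition D_op :: "nat \<Rightarrow> (real \<Rightarrow> 'a::real_normed_vector) \<Rightarrow> real \<Rightarrow> 'a" where
  "D_op k f = Dx (mult_sq (((\<lambda>g. Dx (Dx (mult_sq g))) ^^ (k - 1)) (Dx f)))"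

definition v :: "nat \<Rightarrow> real \<Rightarrow> real \<Rightarrow> complex" where
  "v k c = D_op k (w k c)"

text \<open>
  The density \<open>v\<^sub>k(x) / x\<close> on the positive half-line, extended by \<open>0\<close> to the real line. As an
  inverse Mellin integral, \<open>v\<close> has type \<open>complex\<close>; its values on the positive half-line are real.
\<close>

definition density_X :: "nat \<Rightarrow> real \<Rightarrow> real \<Rightarrow> real" where
  "density_X k c x = (if 0 < x then Re (v k c x) / x else 0)"

text \<open>
  The density of the size-biased distribution obtained from a positive random variable \<open>X\<close> on
  \<open>M\<close> with density \<open>g\<close> and finite mean.
\<close>

definition size_biased_density ::
    "'a measure \<Rightarrow> ('a \<Rightarrow> real) \<Rightarrow> (real \<Rightarrow> real) \<Rightarrow> real \<Rightarrow> real" where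
  "size_biased_density M X g x = x * g x / prob_space.expectation M X"

end

theory Submission
  imports Defs "HOL-Real_Asymp.Real_Asymp"
begin

text \<open>
  Each operator block multiplies \<open>x\<^sup>-\<^sup>s\<close> by \<open>s (s - 1)\<close>, so \<open>v\<^sub>k\<close> is the inverse Mellin transform of
  \<open>(2\<xi>(s))\<^sup>k\<close>. As \<open>\<xi>\<close> is entire and decays faster than any power on vertical strips, the line of
  integration can be moved: \<open>\<xi>(1 - s) = \<xi>(s)\<close> then becomes \<open>v\<^sub>k(x) = v\<^sub>k(1/x) / x\<close>, and Cauchy's formula on
  a strip gives \<open>\<integral> v\<^sub>k(x) x\<^sup>s\<^sup>-\<^sup>1 dx = (2\<xi>(s))\<^sup>k\<close> for all complex \<open>s\<close>. The functional equation is proved on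
  the real interval \<open>(-1, 0)\<close>, where all sums and integrals involved have nonnegative terms, and
  extended by analytic continuation.
\<close>

section \<open>Continuation of the zeta function\<close>

text \<open>\<open>zeta\<close> is known only through its unique description, so an entire candidate
  for 2 xi is built before \<open>zeta\<close> and \<open>xi\<close> are identified with it. The
  trapezoidal rule is chosen for its region: Re s > -1 contains the strip -1 < Re s < 2, which s ->
  1 - s maps to itself, so a function on this half plane and its reflection can be glued. On (-1, 0)
  the point 1 - s lies where the Dirichlet series converges, and convexity gives all trapezoidal
  errors of exponentials the same sign, which is the source of the nonnegativity. Two function
  classes are kept apart. Powers of 2 xi are entire and decay on all strips, so lines can be moved;
  the integrand of \<open>w\<close> has poles at 0 and 1 and is handled on one line only. In the
  Mellin transform the half line has to be split at 1, as the integral of x^(u-1) over all of it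
  converges for no u. Positivity of the density is not read off from the formula for
  \<open>v\<close>; it comes from X having it as a density.\<close>

definition zeta_term :: "nat \<Rightarrow> complex \<Rightarrow> complex" where
  "zeta_term n s = (s - 1) * (of_nat (n+1) powr (-s) + of_nat (n+2) powr (-s)) / 2
      + of_nat (n+2) powr (1 - s) - of_nat (n+1) powr (1 - s)"

text \<open>\<open>zeta_term n s\<close> is s - 1 times the trapezoidal rule error for x^(-s) on
  [n+1, n+2]; the factor keeps it entire at s = 1. The error is governed by the second derivative s
  (s+1) x^(-s-2), whose size is largest at the left end because Re s \<ge> -2.\<close>

lemma norm_zeta_term_le:
  assumes "Re s \<ge> -2"
  shows "norm (zeta_term n s) \<le> norm ((s - 1) * s * (s + 1)) * real (n+1) powr (- Re s - 2)"
proof -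
  define N where "N = real (n+1)"
  define S where "S = closed_segment (complex_of_real N) (of_real (N+1))"
  define B where "B = norm (s * (s+1)) * N powr (- Re s - 2)"
  \<comment> \<open>\<open>h\<close> is the same error with the right end replaced by x, and its
    derivative is (s-1)/2 times \<open>g\<close>. Both vanish at N, so two mean value estimates
    suffice.\<close>
  define g where "g = (\<lambda>x::complex. of_real N powr (-s) - x powr (-s) - s * (x - of_real N) * x powr (-s-1))"
  define h where "h = (\<lambda>x::complex. (s - 1) * (x - of_real N) * (of_real N powr (-s) + x powr (-s)) / 2
      + x powr (1 - s) - of_real N powr (1 - s))"
  have N: "N \<ge> 1" by (simp add: N_def)
  have S: "\<exists>r. x = of_real r \<and> N \<le> r \<and> r \<le> N + 1" if "x \<in> S" for x
    using that unfolding S_def closed_segment_of_real closed_segment_eq_real_ivl by auto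
  have conv: "convex S" by (simp add: S_def)
  have Nin: "of_real N \<in> S" "of_real (N+1) \<in> S" by (auto simp: S_def)
  have g: "norm (g x) \<le> B" if x: "x \<in> S" for x
  proof -
    have "norm (g x - g (of_real N)) \<le> B * norm (x - of_real N)"
    proof (rule field_differentiable_bound[OF conv])
      fix z assume "z \<in> S"
      then obtain r where r: "z = of_real r" "N \<le> r" "r \<le> N+1" using S by blast
      have zn: "z \<notin> \<real>\<^sub>\<le>\<^sub>0" using r N by (auto simp: complex_nonpos_Reals_iff)
      have z0: "z \<noteq> 0" using r N by auto
      show "(g has_field_derivative (s * (s+1) * (z - of_real N) * z powr (-s-2))) (at z within S)"
        unfolding g_def
        apply (rule derivative_eq_intros refl zn | use zn z0 in force)+
        using z0 by (simp add: field_simps powr_diff powr_minus power2_eq_square)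
      have "norm (z powr (-s-2)) = r powr (- Re s - 2)" using r N
        by (subst norm_powr_real_powr) auto
      also have "\<dots> \<le> N powr (- Re s - 2)" using r N assms by (intro powr_mono2') auto
      finally have 1: "norm (z powr (-s-2)) \<le> N powr (- Re s - 2)" .
      have 2: "norm (z - of_real N) \<le> 1" using r
        by (simp flip: of_real_diff)
      have "norm (s * (s+1)) * (norm (z - of_real N) * norm (z powr (-s-2))) \<le> norm (s * (s+1)) * (1 * N powr (- Re s - 2))"
        using 1 2 by (intro mult_left_mono mult_mono) auto
      then show "norm (s * (s+1) * (z - of_real N) * z powr (-s-2)) \<le> B"
        by (simp add: B_def norm_mult mult_ac)
    qed (use x Nin in auto)
    moreover have "g (of_real N) = 0" by (simp add: g_def)
    moreover have "norm (x - of_real N) \<le> 1" using S[OF x]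
      by (auto simp flip: of_real_diff)
    moreover have "B \<ge> 0" by (simp add: B_def)
    ultimately show ?thesis using mult_left_mono[of "norm (x - of_real N)" 1 B] by simp
  qed
  have "norm (h (of_real (N+1)) - h (of_real N)) \<le> norm (s - 1) * B * norm (complex_of_real (N+1) - of_real N)"
  proof (rule field_differentiable_bound[OF conv])
    fix z assume zS: "z \<in> S"
    then obtain r where r: "z = of_real r" "N \<le> r" "r \<le> N+1" using S by blast
    have zn: "z \<notin> \<real>\<^sub>\<le>\<^sub>0" using r N by (auto simp: complex_nonpos_Reals_iff)
    have z0: "z \<noteq> 0" using r N by auto
    show "(h has_field_derivative ((s - 1)/2 * g z)) (at z within S)"
      unfolding h_def g_def
      apply (rule derivative_eq_intros refl zn | use zn z0 in force)+
      using z0 by (simp add: field_simps powr_diff powr_minus)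
    have "norm (s - 1) * norm (g z) \<le> norm (s - 1) * B" using g[OF zS] by (intro mult_left_mono) auto
    moreover have "norm (s - 1) * B \<ge> 0" by (simp add: B_def)
    ultimately show "norm ((s - 1)/2 * g z) \<le> norm (s - 1) * B"
      by (simp add: norm_mult norm_divide)
  qed (use Nin in auto)
  moreover have "h (of_real N) = 0" by (simp add: h_def)
  moreover have "h (of_real (N+1)) = zeta_term n s"
    by (simp add: h_def zeta_term_def N_def add_ac)
  ultimately show ?thesis by (simp add: B_def N_def norm_mult mult_ac)
qed

lemma summable_powr_Suc:
  assumes "a < -1" shows "summable (\<lambda>n. real (n+1) powr a)"
  using summable_ignore_initial_segment[of "\<lambda>n. real n powr a" 1] assms
  by (simp add: summable_real_powr_iff)

lemma summable_zeta_term: "Re s > -1 \<Longrightarrow> summable (\<lambda>n. zeta_term n s)"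
  by (rule summable_comparison_test'[OF summable_mult[OF summable_powr_Suc] norm_zeta_term_le]) auto

text \<open>
  \<open>(s - 1) \<zeta>(s)\<close>, continued to \<open>Re s > -1\<close> by the trapezoidal rule for \<open>\<integral> x\<^sup>-\<^sup>s dx\<close>.
\<close>

definition Zeta :: "complex \<Rightarrow> complex" where
  "Zeta s = (s + 1) / 2 + (\<Sum>n. zeta_term n s)"

lemma holomorphic_Zeta: "Zeta holomorphic_on {s. Re s > -1}"
proof -
  have "(\<lambda>s. \<Sum>n. zeta_term n s) holomorphic_on {s. Re s > -1}"
  proof (rule holomorphic_uniform_sequence[where f = "\<lambda>n s. \<Sum>i<n. zeta_term i s"])
    show "open {s. Re s > -1}" by (rule open_halfspace_Re_gt)
    show "(\<lambda>s. \<Sum>i<n. zeta_term i s) holomorphic_on {s. Re s > -1}" for n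
      unfolding zeta_term_def by (intro holomorphic_intros) auto
    fix s :: complex assume "s \<in> {s. Re s > -1}"
    then have s: "Re s > -1" by simp
    \<comment> \<open>Half the distance to the line Re = -1: on the closed disc the real part stays
      at least \<sigma> > -1, which gives one summable majorant for the whole disc.\<close>
    define d where "d = (Re s + 1) / 2"
    define \<sigma> where "\<sigma> = Re s - d"
    have d: "d > 0" and \<sigma>: "\<sigma> > -1" using s by (auto simp: d_def \<sigma>_def field_simps)
    have re: "Re z \<ge> \<sigma>" if "z \<in> cball s d" for z
      using that abs_Re_le_cmod[of "s - z"] by (auto simp: \<sigma>_def dist_norm)
    have "bounded ((\<lambda>z. (z - 1) * z * (z + 1)) ` cball s d)"
      by (intro compact_imp_bounded compact_continuous_image continuous_intros) auto
    then obtain B where B: "\<And>z. z \<in> cball s d \<Longrightarrow> norm ((z - 1) * z * (z + 1)) \<le> B"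
      unfolding bounded_iff by fast
    have "uniform_limit (cball s d) (\<lambda>n z. \<Sum>i<n. zeta_term i z) (\<lambda>z. \<Sum>n. zeta_term n z) sequentially"
    proof (rule Weierstrass_m_test)
      show "summable (\<lambda>n. B * real (n+1) powr (-\<sigma> - 2))"
        using \<sigma> by (intro summable_mult summable_powr_Suc) auto
      fix n z assume z: "z \<in> cball s d"
      have "norm (zeta_term n z) \<le> norm ((z - 1) * z * (z + 1)) * real (n+1) powr (- Re z - 2)"
        using re[OF z] \<sigma> by (intro norm_zeta_term_le) auto
      also have "\<dots> \<le> B * real (n+1) powr (-\<sigma> - 2)"
        using re[OF z] B[OF z] by (intro mult_mono powr_mono) (auto intro: order_trans[OF norm_ge_zero])
      finally show "norm (zeta_term n z) \<le> B * real (n+1) powr (-\<sigma> - 2)" .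
    qed
    moreover have "cball s d \<subseteq> {s. Re s > -1}" using re \<sigma> by force
    ultimately show "\<exists>d>0. cball s d \<subseteq> {s. Re s > -1} \<and>
        uniform_limit (cball s d) (\<lambda>n z. \<Sum>i<n. zeta_term i z) (\<lambda>z. \<Sum>n. zeta_term n z) sequentially"
      using d by blast
  qed
  then show ?thesis unfolding Zeta_def[abs_def] by (intro holomorphic_intros) auto
qed

text \<open>The degree three comes from the factor (s-1) s (s+1) in the bound of each term; the
  remaining sum over n depends only on \<sigma>. A polynomial bound is enough because Gamma will
  decay faster than any power.\<close>

lemma norm_Zeta_le:
  assumes "\<sigma> > -1"
  obtains C where "\<And>s. Re s \<ge> \<sigma> \<Longrightarrow> norm (Zeta s) \<le> C * (1 + norm s) ^ 3"
proof
  define C where "C = (\<Sum>n. real (n+1) powr (-\<sigma> - 2))"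
  have sm: "summable (\<lambda>n. real (n+1) powr (-\<sigma> - 2))" using assms by (intro summable_powr_Suc) auto
  have C: "C \<ge> 0" unfolding C_def by (intro suminf_nonneg sm) auto
  fix s assume s: "Re s \<ge> \<sigma>"
  define b where "b = norm ((s - 1) * s * (s + 1))"
  have le: "norm (zeta_term n s) \<le> b * real (n+1) powr (-\<sigma> - 2)" for n
  proof -
    have "norm (zeta_term n s) \<le> b * real (n+1) powr (- Re s - 2)"
      unfolding b_def using s assms by (intro norm_zeta_term_le) auto
    also have "\<dots> \<le> b * real (n+1) powr (-\<sigma> - 2)"
      using s by (intro mult_left_mono powr_mono) (auto simp: b_def)
    finally show ?thesis .
  qed
  have "norm (\<Sum>n. zeta_term n s) \<le> (\<Sum>n. b * real (n+1) powr (-\<sigma> - 2))"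
    by (rule norm_suminf_le[OF le]) (intro summable_mult sm)
  also have "\<dots> = b * C" unfolding C_def by (rule suminf_mult[OF sm])
  also have "b \<le> (1 + norm s) * (1 + norm s) * (1 + norm s)"
    unfolding b_def norm_mult
    by (intro mult_mono) (auto intro: norm_triangle_le norm_triangle_le_diff)
  finally have 1: "norm (\<Sum>n. zeta_term n s) \<le> (1 + norm s) ^ 3 * C"
    using C by (auto simp: power3_eq_cube intro: mult_right_mono)
  have "norm ((s + 1) / 2) \<le> norm (s + 1)" by (simp add: norm_divide)
  also have "\<dots> \<le> 1 + norm s" using norm_triangle_ineq[of s 1] by simp
  also have "\<dots> \<le> (1 + norm s) ^ 3" using power_increasing[of 1 3 "1 + norm s"] by simp
  finally have "norm ((s + 1) / 2) \<le> (1 + norm s) ^ 3" .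
  then show "norm (Zeta s) \<le> (1 + C) * (1 + norm s) ^ 3"
    unfolding Zeta_def using 1 norm_triangle_ineq[of "(s+1)/2" "\<Sum>n. zeta_term n s"]
    by (simp add: algebra_simps)
qed

lemma summable_dirichlet:
  assumes "Re s > 1" shows "summable (\<lambda>n. 1 / of_nat (Suc n) powr s :: complex)"
proof (rule summable_comparison_test'[OF summable_powr_Suc[of "- Re s"]])
  fix n :: nat
  have "norm (of_nat (Suc n) powr s :: complex) = real (Suc n) powr Re s"
    by (subst norm_powr_real_powr) auto
  then show "norm (1 / of_nat (Suc n) powr s :: complex) \<le> real (n+1) powr (- Re s)"
    by (simp add: norm_divide powr_minus field_simps)
qed (use assms in auto)

text \<open>The averages of neighbouring terms sum to the Dirichlet series less half of its first
  term, and the differences of powers telescope to -1 because Re s > 1. The resulting correction (s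
  - 1)/2 + 1 is the (s + 1)/2 in \<open>Zeta\<close>.\<close>

lemma Zeta_eq_dirichlet:
  assumes s: "Re s > 1"
  shows "Zeta s = (s - 1) * (\<Sum>n. 1 / of_nat (Suc n) powr s)"
proof -
  define f where "f = (\<lambda>n. 1 / of_nat (Suc n) powr s :: complex)"
  have f: "f sums suminf f" unfolding f_def using summable_dirichlet[OF s] by blast
  have f': "(\<lambda>n. f (Suc n)) sums (suminf f - 1)" using f by (subst sums_Suc_iff) (simp add: f_def)
  define r where "r = (\<lambda>n. of_nat (n+1) powr (1 - s) :: complex)"
  have "r \<longlonglongrightarrow> 0"
  proof (rule tendsto_norm_zero_cancel)
    have "(\<lambda>n. real (n+1) powr (1 - Re s)) \<longlonglongrightarrow> 0"
      using s by real_asymp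
    moreover have "norm (r n) = real (n+1) powr (1 - Re s)" for n
      unfolding r_def by (subst norm_powr_real_powr) auto
    ultimately show "(\<lambda>n. norm (r n)) \<longlonglongrightarrow> 0" by simp
  qed
  then have "(\<lambda>n. r (Suc n) - r n) sums (0 - r 0)" by (rule telescope_sums)
  then have r: "(\<lambda>n. r (Suc n) - r n) sums (-1)" by (simp add: r_def)
  have "zeta_term n s = (s - 1) * ((f n + f (Suc n)) / 2) + (r (Suc n) - r n)" for n
    by (simp add: zeta_term_def f_def r_def powr_minus field_simps)
  moreover have "(\<lambda>n. (s - 1) * ((f n + f (Suc n)) / 2) + (r (Suc n) - r n)) sums
     ((s - 1) * ((suminf f + (suminf f - 1)) / 2) + (-1))"
    by (intro sums_add sums_mult sums_divide f f' r)
  ultimately have "(\<Sum>n. zeta_term n s) = (s - 1) * ((suminf f + (suminf f - 1)) / 2) + (-1)"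
    by (simp add: sums_iff)
  then show ?thesis unfolding Zeta_def f_def[symmetric] by (simp add: field_simps)
qed

section \<open>Euler integrals\<close>

text \<open>Euler's integral, rescaled by x -> c x. It is stated with values in
  \<open>ennreal\<close> so that each later exchange of integrals is an instance of Tonelli's
  theorem.\<close>

lemma nn_integral_Gamma:
  fixes a c :: real
  assumes a: "a > 0" and c: "c > 0"
  shows "(\<integral>\<^sup>+x\<in>{0<..}. ennreal (x powr (a - 1) * exp (- c * x)) \<partial>lborel) = ennreal (Gamma a * c powr (- a))"
proof -
  define f where "f = (\<lambda>x::real. ennreal (x powr (a - 1) * exp (- x)) * indicator {0<..} x)"
  have [measurable]: "f \<in> borel_measurable borel" unfolding f_def by measurable
  have "integral\<^sup>N lborel f = integral\<^sup>N lborel (\<lambda>x. ennreal (x powr (a - 1) / exp x) * indicator {0..} x)"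
    by (intro nn_integral_cong) (auto simp: f_def indicator_def exp_minus field_simps)
  also have "\<dots> = ennreal (Gamma a)"
    by (rule nn_integral_has_integral_lebesgue'[OF _ Gamma_integral_real[OF a]]) auto
  finally have f: "integral\<^sup>N lborel f = ennreal (Gamma a)" .
  have eq: "ennreal (x powr (a - 1) * exp (- c * x)) * indicator {0<..} x
      = ennreal (c powr (1 - a)) * f (0 + c * x)" for x
  proof (cases "x > 0")
    case True
    have "x powr (a - 1) = c powr (1 - a) * (c * x) powr (a - 1)"
      using True c by (simp add: powr_mult powr_diff field_simps)
    then show ?thesis using True c by (simp add: f_def ennreal_mult' mult_ac)
  qed (use c in \<open>auto simp: f_def indicator_def zero_less_mult_iff\<close>)
  have "(\<integral>\<^sup>+x\<in>{0<..}. ennreal (x powr (a - 1) * exp (- c * x)) \<partial>lborel)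
      = ennreal (c powr (1 - a)) * (\<integral>\<^sup>+x. f (0 + c * x) \<partial>lborel)"
    unfolding eq by (rule nn_integral_cmult) measurable
  also have "ennreal (c powr (1 - a)) = ennreal (c powr (- a)) * ennreal \<bar>c\<bar>"
    using c by (simp add: powr_diff powr_minus field_simps flip: ennreal_mult)
  also have "\<dots> * (\<integral>\<^sup>+x. f (0 + c * x) \<partial>lborel) = ennreal (c powr (- a)) * integral\<^sup>N lborel f"
    using c by (subst nn_integral_real_affine[of f c 0]) (auto simp: mult_ac)
  also have "\<dots> = ennreal (Gamma a * c powr (- a))"
    using a by (simp add: f ennreal_mult'' mult.commute)
  finally show ?thesis .
qed

lemma nn_integral_powr_from_0:
  fixes a c :: real
  assumes "a > -1" "c \<ge> 0"
  shows "(\<integral>\<^sup>+x\<in>{0<..c}. ennreal (x powr a) \<partial>lborel) = ennreal (c powr (a + 1) / (a + 1))"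
proof -
  have "(\<integral>\<^sup>+x\<in>{0<..c}. ennreal (x powr a) \<partial>lborel) = (\<integral>\<^sup>+x\<in>{0..c}. ennreal (x powr a) \<partial>lborel)"
    by (intro nn_integral_cong) (auto simp: indicator_def)
  also have "\<dots> = ennreal (c powr (a + 1) / (a + 1))"
    by (rule nn_integral_has_integral_lebesgue'[OF _ has_integral_powr_from_0[OF assms]]) auto
  finally show ?thesis .
qed

text \<open>(1 - exp(-c y)) / y is the integral of exp(-r y) over r in (0, c]. After exchanging, the
  integral over y is Gamma(1 - p) r^(p-1).\<close>

lemma nn_integral_one_minus_exp:
  fixes p c :: real
  assumes p: "0 < p" "p < 1" and c: "c \<ge> 0"
  shows "(\<integral>\<^sup>+y\<in>{0<..}. ennreal ((1 - exp (- c * y)) * y powr (- p - 1)) \<partial>lborel)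
     = ennreal (Gamma (1 - p) / p * c powr p)"
proof -
  let ?f = "\<lambda>y r::real. ennreal (y powr (- p) * exp (- r * y)) * indicator {0<..} y * indicator {0<..c} r"
  have 1: "ennreal ((1 - exp (- c * y)) * y powr (- p - 1)) * indicator {0<..} y = (\<integral>\<^sup>+r. ?f y r \<partial>lborel)" for y
  proof (cases "y > 0")
    case y: True
    have "(\<integral>\<^sup>+r. ?f y r \<partial>lborel) = (\<integral>\<^sup>+r. ennreal (y powr (- p) * exp (- r * y)) * indicator {0..c} r \<partial>lborel)"
      by (rule nn_integral_cong_AE) (use AE_lborel_singleton[of 0] y in \<open>auto simp: indicator_def elim!: eventually_mono\<close>)
    also have "\<dots> = ennreal ((- (y powr (- p - 1)) * exp (- c * y)) - (- (y powr (- p - 1)) * exp (- 0 * y)))"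
      using y c by (intro nn_integral_FTC_Icc) (auto intro!: derivative_eq_intros simp: powr_diff)
    finally show ?thesis using y by (simp add: algebra_simps)
  qed auto
  have "(\<integral>\<^sup>+y\<in>{0<..}. ennreal ((1 - exp (- c * y)) * y powr (- p - 1)) \<partial>lborel)
     = (\<integral>\<^sup>+y. \<integral>\<^sup>+r. ?f y r \<partial>lborel \<partial>lborel)" by (simp only: 1)
  also have "\<dots> = (\<integral>\<^sup>+r. \<integral>\<^sup>+y. ?f y r \<partial>lborel \<partial>lborel)"
    by (rule lborel_pair.Fubini'[symmetric]) measurable
  also have "\<dots> = (\<integral>\<^sup>+r. ennreal (Gamma (1 - p)) * (ennreal (r powr (p - 1)) * indicator {0<..c} r) \<partial>lborel)"
  proof (rule nn_integral_cong)
    fix r :: real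
    show "(\<integral>\<^sup>+y. ?f y r \<partial>lborel) = ennreal (Gamma (1 - p)) * (ennreal (r powr (p - 1)) * indicator {0<..c} r)"
    proof (cases "r \<in> {0<..c}")
      case True
      then have "(\<integral>\<^sup>+y. ?f y r \<partial>lborel) = (\<integral>\<^sup>+y\<in>{0<..}. ennreal (y powr ((1 - p) - 1) * exp (- r * y)) \<partial>lborel)"
        by (intro nn_integral_cong) auto
      also have "\<dots> = ennreal (Gamma (1 - p) * r powr (- (1 - p)))"
        using p True by (intro nn_integral_Gamma) auto
      finally show ?thesis using True p by (simp add: ennreal_mult)
    qed auto
  qed
  also have "\<dots> = ennreal (Gamma (1 - p)) * (\<integral>\<^sup>+r\<in>{0<..c}. ennreal (r powr (p - 1)) \<partial>lborel)"
    by (rule nn_integral_cmult) measurable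
  also have "\<dots> = ennreal (Gamma (1 - p) / p * c powr p)"
    using p c by (subst nn_integral_powr_from_0) (auto simp: ennreal_mult'[symmetric])
  finally show ?thesis .
qed

text \<open>The Gaussian is the tail integral of w exp(-w t) over t \<ge> y^2. For fixed t the
  condition reads y \<le> sqrt t, the inner integral is a power of t, and the outer one produces
  Gamma at (3-p)/2, which the recurrence brings down to (1-p)/2.\<close>

lemma nn_integral_powr_gaussian:
  fixes p w :: real
  assumes p: "0 < p" "p < 1" and w: "w > 0"
  shows "(\<integral>\<^sup>+y\<in>{0<..}. ennreal (y powr (- p) * exp (- w * y\<^sup>2)) \<partial>lborel)
     = ennreal (Gamma ((1 - p) / 2) / 2 * w powr (- (1 - p) / 2))"
proof -
  let ?f = "\<lambda>y t::real. ennreal (y powr (- p)) * ennreal (w * exp (- w * t)) * (if 0 < y \<and> y\<^sup>2 \<le> t then 1 else 0)"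
  have 1: "ennreal (y powr (- p) * exp (- w * y\<^sup>2)) * indicator {0<..} y = (\<integral>\<^sup>+t. ?f y t \<partial>lborel)" for y
  proof (cases "y > 0")
    case y: True
    have "(\<integral>\<^sup>+t. ?f y t \<partial>lborel) = (\<integral>\<^sup>+t. ennreal (y powr (- p)) * (ennreal (w * exp (- w * t)) * indicator {y\<^sup>2..} t) \<partial>lborel)"
      using y by (intro nn_integral_cong) (auto simp: indicator_def)
    also have "\<dots> = ennreal (y powr (- p)) * (\<integral>\<^sup>+t. (ennreal (w * exp (- w * t)) * indicator {y\<^sup>2..} t) \<partial>lborel)"
      by (rule nn_integral_cmult) measurable
    also have "(\<integral>\<^sup>+t. (ennreal (w * exp (- w * t)) * indicator {y\<^sup>2..} t) \<partial>lborel) = ennreal (0 - (- exp (- w * y\<^sup>2)))"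
    proof (rule nn_integral_FTC_atLeast)
      show "((\<lambda>t. - exp (- w * t)) \<longlongrightarrow> 0) at_top" using w by real_asymp
    qed (use w in \<open>auto intro!: derivative_eq_intros\<close>)
    finally show ?thesis using y by (simp add: ennreal_mult)
  qed auto
  have "(\<integral>\<^sup>+y\<in>{0<..}. ennreal (y powr (- p) * exp (- w * y\<^sup>2)) \<partial>lborel) = (\<integral>\<^sup>+y. \<integral>\<^sup>+t. ?f y t \<partial>lborel \<partial>lborel)"
    by (simp only: 1)
  also have "\<dots> = (\<integral>\<^sup>+t. \<integral>\<^sup>+y. ?f y t \<partial>lborel \<partial>lborel)"
    by (rule lborel_pair.Fubini'[symmetric]) measurable
  also have "\<dots> = (\<integral>\<^sup>+t. ennreal (w / (1 - p)) *
      (ennreal (t powr ((3 - p)/2 - 1) * exp (- w * t)) * indicator {0<..} t) \<partial>lborel)"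
  proof (rule nn_integral_cong)
    fix t :: real
    show "(\<integral>\<^sup>+y. ?f y t \<partial>lborel) = ennreal (w / (1 - p)) *
      (ennreal (t powr ((3 - p)/2 - 1) * exp (- w * t)) * indicator {0<..} t)"
    proof (cases "t > 0")
      case t: True
      have "(y\<^sup>2 \<le> t) = (y \<le> sqrt t)" if "y > 0" for y using that t
        by (metis less_eq_real_def real_sqrt_le_iff real_sqrt_unique)
      then have "(\<integral>\<^sup>+y. ?f y t \<partial>lborel) = (\<integral>\<^sup>+y. ennreal (w * exp (- w * t)) * (ennreal (y powr (- p)) * indicator {0<..sqrt t} y) \<partial>lborel)"
        by (intro nn_integral_cong) (auto simp: indicator_def mult.commute)
      also have "\<dots> = ennreal (w * exp (- w * t)) * (\<integral>\<^sup>+y\<in>{0<..sqrt t}. ennreal (y powr (- p)) \<partial>lborel)"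
        by (rule nn_integral_cmult) measurable
      also have "(\<integral>\<^sup>+y\<in>{0<..sqrt t}. ennreal (y powr (- p)) \<partial>lborel) = ennreal (sqrt t powr (- p + 1) / (- p + 1))"
        using p t by (intro nn_integral_powr_from_0) auto
      also have "sqrt t powr (- p + 1) = t powr ((3 - p)/2 - 1)"
        using t by (simp add: powr_half_sqrt[symmetric] powr_powr field_simps)
      finally show ?thesis using t p w by (simp add: ennreal_mult'[symmetric] mult_ac)
    next
      case False
      then have "\<not> y\<^sup>2 \<le> t" if "y > 0" for y
        using zero_less_power[OF that, of 2] by linarith
      then have "?f y t = 0" for y by auto
      then have "(\<integral>\<^sup>+y. ?f y t \<partial>lborel) = 0" by (simp only: nn_integral_0_iff_AE) simp
      then show ?thesis using False by simp
    qed
  qed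
  also have "\<dots> = ennreal (w / (1 - p)) *
      (\<integral>\<^sup>+t\<in>{0<..}. ennreal (t powr ((3 - p)/2 - 1) * exp (- w * t)) \<partial>lborel)"
    by (rule nn_integral_cmult) measurable
  also have "\<dots> = ennreal (w / (1 - p)) * ennreal (Gamma ((3 - p)/2) * w powr (- ((3 - p)/2)))"
    using p w by (subst nn_integral_Gamma) auto
  also have "\<dots> = ennreal (w / (1 - p) * (Gamma ((3 - p)/2) * w powr (- ((3 - p)/2))))"
    using p w by (subst ennreal_mult) auto
  also have "Gamma ((3 - p)/2) = (1 - p) / 2 * Gamma ((1 - p) / 2)"
  proof -
    have "(1 - p) / 2 \<notin> \<int>\<^sub>\<le>\<^sub>0" using p by (auto elim!: nonpos_Ints_cases)
    moreover have "(3 - p) / 2 = (1 - p) / 2 + 1" by (simp add: field_simps)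
    ultimately show ?thesis using Gamma_plus1[of "(1 - p) / 2"] by metis
  qed
  also have "w / (1 - p) * ((1 - p) / 2 * Gamma ((1 - p) / 2) * w powr (- ((3 - p)/2)))
      = Gamma ((1 - p) / 2) / 2 * w powr (- (1 - p) / 2)"
  proof -
    have "w * w powr (- ((3 - p)/2)) = w powr (1 + (- ((3 - p)/2)))" using w by (subst powr_add) simp
    also have "1 + (- ((3 - p)/2)) = - (1 - p) / 2" by (simp add: field_simps)
    finally have "w * w powr (- ((3 - p)/2)) = w powr (- (1 - p) / 2)" .
    moreover have "w / (1 - p) * ((1 - p) / 2 * X * W) = X / 2 * (w * W)" for X W
      using p by (simp add: divide_simps)
    ultimately show ?thesis by (simp only:)
  qed
  finally show ?thesis .
qed

text \<open>1 / (m^2 + y^2) is the integral of exp(-t (m^2 + y^2)) over t > 0; the y-integral is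
  then Gaussian and the t-integral again Euler's. The product of Gamma values is kept as it is,
  since one of them later cancels through the duplication formula.\<close>

lemma nn_integral_powr_cauchy:
  fixes p m :: real
  assumes p: "0 < p" "p < 1" and m: "m > 0"
  shows "(\<integral>\<^sup>+y\<in>{0<..}. ennreal (y powr (- p) / (m\<^sup>2 + y\<^sup>2)) \<partial>lborel)
     = ennreal (Gamma ((1 - p) / 2) * Gamma ((1 + p) / 2) / 2 * m powr (- p - 1))"
proof -
  let ?f = "\<lambda>y t::real. ennreal (y powr (- p) * exp (- t * y\<^sup>2)) * ennreal (exp (- m\<^sup>2 * t)) * indicator {0<..} y * indicator {0<..} t"
  have 1: "ennreal (y powr (- p) / (m\<^sup>2 + y\<^sup>2)) * indicator {0<..} y = (\<integral>\<^sup>+t. ?f y t \<partial>lborel)" for y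
  proof (cases "y > 0")
    case y: True
    then have my: "m\<^sup>2 + y\<^sup>2 > 0" using m by (intro add_pos_pos) auto
    have "(\<integral>\<^sup>+t. ?f y t \<partial>lborel) = (\<integral>\<^sup>+t. ennreal (y powr (- p)) * (ennreal (t powr (1 - 1) * exp (- (m\<^sup>2 + y\<^sup>2) * t)) * indicator {0<..} t) \<partial>lborel)"
      using y by (intro nn_integral_cong) (auto simp: indicator_def ennreal_mult'[symmetric] algebra_simps exp_diff exp_minus exp_add divide_inverse)
    also have "\<dots> = ennreal (y powr (- p)) * (\<integral>\<^sup>+t\<in>{0<..}. ennreal (t powr (1 - 1) * exp (- (m\<^sup>2 + y\<^sup>2) * t)) \<partial>lborel)"
      by (rule nn_integral_cmult) measurable
    also have "\<dots> = ennreal (y powr (- p)) * ennreal (Gamma 1 * (m\<^sup>2 + y\<^sup>2) powr (- 1))"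
      using my by (subst nn_integral_Gamma) auto
    finally show ?thesis using y my by (simp add: ennreal_mult'[symmetric] powr_minus field_simps)
  qed auto
  have "(\<integral>\<^sup>+y\<in>{0<..}. ennreal (y powr (- p) / (m\<^sup>2 + y\<^sup>2)) \<partial>lborel) = (\<integral>\<^sup>+y. \<integral>\<^sup>+t. ?f y t \<partial>lborel \<partial>lborel)"
    by (simp only: 1)
  also have "\<dots> = (\<integral>\<^sup>+t. \<integral>\<^sup>+y. ?f y t \<partial>lborel \<partial>lborel)"
    by (rule lborel_pair.Fubini'[symmetric]) measurable
  also have "\<dots> = (\<integral>\<^sup>+t. ennreal (Gamma ((1 - p) / 2) / 2) *
      (ennreal (t powr ((1 + p) / 2 - 1) * exp (- m\<^sup>2 * t)) * indicator {0<..} t) \<partial>lborel)"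
  proof (rule nn_integral_cong)
    fix t :: real
    show "(\<integral>\<^sup>+y. ?f y t \<partial>lborel) = ennreal (Gamma ((1 - p) / 2) / 2) *
      (ennreal (t powr ((1 + p) / 2 - 1) * exp (- m\<^sup>2 * t)) * indicator {0<..} t)"
    proof (cases "t > 0")
      case t: True
      then have "(\<integral>\<^sup>+y. ?f y t \<partial>lborel) = (\<integral>\<^sup>+y. ennreal (exp (- m\<^sup>2 * t)) * (ennreal (y powr (- p) * exp (- t * y\<^sup>2)) * indicator {0<..} y) \<partial>lborel)"
        by (intro nn_integral_cong) (auto simp: indicator_def mult_ac)
      also have "\<dots> = ennreal (exp (- m\<^sup>2 * t)) * (\<integral>\<^sup>+y\<in>{0<..}. ennreal (y powr (- p) * exp (- t * y\<^sup>2)) \<partial>lborel)"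
        by (rule nn_integral_cmult) measurable
      also have "\<dots> = ennreal (exp (- m\<^sup>2 * t)) * ennreal (Gamma ((1 - p) / 2) / 2 * t powr (- (1 - p) / 2))"
        using p t by (subst nn_integral_powr_gaussian) auto
      also have "- (1 - p) / 2 = (1 + p) / 2 - 1" by (simp add: field_simps)
      finally show ?thesis using t p by (simp add: ennreal_mult'[symmetric] mult_ac)
    qed auto
  qed
  also have "\<dots> = ennreal (Gamma ((1 - p) / 2) / 2) *
      (\<integral>\<^sup>+t\<in>{0<..}. ennreal (t powr ((1 + p) / 2 - 1) * exp (- m\<^sup>2 * t)) \<partial>lborel)"
    by (rule nn_integral_cmult) measurable
  also have "\<dots> = ennreal (Gamma ((1 - p) / 2) / 2) * ennreal (Gamma ((1 + p) / 2) * m\<^sup>2 powr (- ((1 + p) / 2)))"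
    using p m by (subst nn_integral_Gamma) auto
  also have "m\<^sup>2 powr (- ((1 + p) / 2)) = m powr (- p - 1)"
  proof -
    have "m\<^sup>2 powr (- ((1 + p) / 2)) = m powr (2 * (- ((1 + p) / 2)))"
      using m by (simp only: powr_powr flip: powr_numeral)
    also have "2 * (- ((1 + p) / 2)) = - p - 1" by (simp add: field_simps)
    finally show ?thesis .
  qed
  finally show ?thesis using p by (simp add: ennreal_mult'[symmetric] mult_ac)
qed

section \<open>Partial fractions of the hyperbolic cotangent\<close>

text \<open>Euler's product for the sine at i y, where the minus signs in the factors become plus
  signs. The logarithm turns the product into a series that can be differentiated termwise.\<close>

lemma sums_ln_sinh_quotient:
  assumes y: "y > (0::real)"
  shows "(\<lambda>n. ln (1 + y\<^sup>2 / (real (n+1))\<^sup>2)) sums (ln (sinh (pi * y)) - ln (pi * y))"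
proof -
  define P where "P = (\<lambda>n. \<Prod>k=1..n. 1 + y\<^sup>2 / (real k)\<^sup>2)"
  have "(\<lambda>n. of_real pi * (\<i> * of_real y) * (\<Prod>k=1..n. 1 - (\<i> * of_real y)\<^sup>2 / of_nat k ^ 2)) \<longlonglongrightarrow> sin (of_real pi * (\<i> * of_real y))"
    by (rule sin_product_formula_complex)
  moreover have "(\<Prod>k=1..n. 1 - (\<i> * complex_of_real y)\<^sup>2 / of_nat k ^ 2) = of_real (P n)" for n
    by (simp add: P_def power_mult_distrib)
  moreover have "sin (of_real pi * (\<i> * complex_of_real y)) = \<i> * of_real (sinh (pi * y))"
  proof -
    have "sin (of_real pi * (\<i> * complex_of_real y)) = - \<i> * sinh (\<i> * (of_real pi * (\<i> * complex_of_real y)))"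
      by (rule sin_conv_sinh)
    also have "\<i> * (of_real pi * (\<i> * complex_of_real y)) = - of_real (pi * y)"
      by (simp add: algebra_simps)
    also have "sinh (- complex_of_real (pi * y)) = - of_real (sinh (pi * y))"
      by (simp add: sinh_field_def field_simps flip: exp_of_real)
    finally show ?thesis by simp
  qed
  ultimately have "(\<lambda>n. \<i> * of_real (pi * y * P n)) \<longlonglongrightarrow> \<i> * of_real (sinh (pi * y))"
    by (simp add: mult_ac)
  then have "(\<lambda>n. Im (\<i> * of_real (pi * y * P n))) \<longlonglongrightarrow> Im (\<i> * of_real (sinh (pi * y)))"
    by (rule tendsto_Im)
  then have "(\<lambda>n. pi * y * P n) \<longlonglongrightarrow> sinh (pi * y)" by simp
  then have "(\<lambda>n. ln (pi * y * P n)) \<longlonglongrightarrow> ln (sinh (pi * y))"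
    using y by (intro tendsto_ln) auto
  moreover have "ln (pi * y * P n) = ln (pi * y) + (\<Sum>k<n. ln (1 + y\<^sup>2 / (real (k+1))\<^sup>2))" for n
  proof -
    have pos: "1 + y\<^sup>2 / (real k)\<^sup>2 > 0" for k by (intro add_pos_nonneg) auto
    then have pos': "1 + y\<^sup>2 / (real k)\<^sup>2 \<noteq> 0" for k by (metis less_irrefl)
    have "P n = (\<Prod>k<n. 1 + y\<^sup>2 / (real (k+1))\<^sup>2)" unfolding P_def
      by (rule prod.reindex_bij_witness[of _ "\<lambda>k. k + 1" "\<lambda>k. k - 1"]) auto
    moreover have "ln (\<Prod>k<n. 1 + y\<^sup>2 / (real (k+1))\<^sup>2) = (\<Sum>k<n. ln (1 + y\<^sup>2 / (real (k+1))\<^sup>2))"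
      by (rule ln_prod) (use pos' in blast)+
    moreover have "(\<Prod>k<n. 1 + y\<^sup>2 / (real (k+1))\<^sup>2) > 0" by (rule prod_pos) (use pos in blast)
    ultimately show ?thesis using y by (simp add: ln_mult_pos)
  qed
  ultimately have "(\<lambda>n. ln (pi * y) + (\<Sum>k<n. ln (1 + y\<^sup>2 / (real (k+1))\<^sup>2))) \<longlonglongrightarrow> ln (sinh (pi * y))"
    by simp
  from tendsto_diff[OF this tendsto_const[of "ln (pi * y)"]] show ?thesis
    unfolding sums_def by simp
qed

text \<open>Logarithmic derivative of the product for sinh. The sum is (coth(pi y) - 1/(pi y)) / 2,
  written through exp(-2 pi y) so that it matches the geometric series in
  \<open>sums_exp_defect\<close>.\<close>

lemma coth_partial_fractions:
  assumes y: "y > (0::real)"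
  shows "(\<lambda>n. y / (pi * ((real (n+1))\<^sup>2 + y\<^sup>2))) sums
     ((1 + exp (- 2 * pi * y)) / (2 * (1 - exp (- 2 * pi * y))) - 1 / (2 * pi * y))"
proof -
  define f where "f = (\<lambda>n x::real. ln (1 + x\<^sup>2 / (real (n+1))\<^sup>2))"
  define f' where "f' = (\<lambda>n x::real. 2 * x / ((real (n+1))\<^sup>2 + x\<^sup>2))"
  \<comment> \<open>Bounded, so that the numerator of \<open>f'\<close> is at most 2 (y + 1) and the
    derivatives are dominated by a multiple of (n+1)^(-2).\<close>
  define S where "S = {0<..<y+1}"
  have pos: "(real (n+1))\<^sup>2 + x\<^sup>2 > 0" for n and x :: real by (intro add_pos_nonneg) auto
  have unif: "uniform_limit S (\<lambda>n x. \<Sum>i<n. f' i x) (\<lambda>x. \<Sum>i. f' i x) sequentially"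
  proof (rule Weierstrass_m_test)
    show "summable (\<lambda>n. 2 * (y + 1) * real (n+1) powr (-2))"
      by (intro summable_mult summable_powr_Suc) auto
    fix n x assume x: "x \<in> S"
    have "2 * x / ((real (n+1))\<^sup>2 + x\<^sup>2) \<le> 2 * (y + 1) / ((real (n+1))\<^sup>2 + 0)"
      using x by (intro frac_le) (auto simp: S_def)
    then show "norm (f' n x) \<le> 2 * (y + 1) * real (n+1) powr (-2)"
      using x pos[of n x] by (simp add: f'_def S_def powr_minus powr_numeral field_simps)
  qed
  have yS: "y \<in> interior S" using y by (simp add: S_def)
  have "((\<lambda>x. \<Sum>n. f n x) has_field_derivative (\<Sum>n. f' n y)) (at y)"
  proof (rule has_field_derivative_series'(2)[where x0 = y])
    fix n x assume x: "x \<in> S"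
    define N where "N = (real (n+1))\<^sup>2"
    have N: "N > 0" by (simp add: N_def)
    have "1 + x\<^sup>2 / N > 0" using N by (intro add_pos_nonneg) auto
    then have "((\<lambda>x. ln (1 + x\<^sup>2 / N)) has_field_derivative (2 * x / N / (1 + x\<^sup>2 / N))) (at x within S)"
      using N by (auto intro!: derivative_eq_intros)
    also have "2 * x / N / (1 + x\<^sup>2 / N) = 2 * x / (N + x\<^sup>2)"
      using N by (simp add: field_simps)
    finally show "(f n has_field_derivative f' n x) (at x within S)"
      unfolding f_def f'_def N_def .
  next
    show "summable (\<lambda>n. f n y)" using sums_ln_sinh_quotient[OF y] by (auto simp: f_def sums_iff)
  qed (use yS y unif in \<open>auto simp: S_def uniformly_convergent_on_def\<close>)
  moreover have "(\<Sum>n. f n x) = ln (sinh (pi * x)) - ln (pi * x)" if "x \<in> {0<..}" for x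
    using sums_ln_sinh_quotient[of x] that by (simp add: f_def sums_iff)
  ultimately have "((\<lambda>x. ln (sinh (pi * x)) - ln (pi * x)) has_field_derivative (\<Sum>n. f' n y)) (at y)"
    using y by (elim has_field_derivative_transform_within_open[of _ _ _ "{0<..}"]) auto
  moreover have "((\<lambda>x. ln (sinh (pi * x)) - ln (pi * x)) has_field_derivative (pi * cosh (pi * y) / sinh (pi * y) - 1 / y)) (at y)"
    using y by (auto intro!: derivative_eq_intros simp: field_simps)
  ultimately have "(\<Sum>n. f' n y) = pi * cosh (pi * y) / sinh (pi * y) - 1 / y"
    by (rule DERIV_unique)
  moreover have "summable (\<lambda>n. f' n y)"
    using tendsto_uniform_limitI[OF unif, of y] y by (auto simp: S_def sums_def intro: sums_summable)
  ultimately have "(\<lambda>n. f' n y) sums (pi * cosh (pi * y) / sinh (pi * y) - 1 / y)"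
    by (simp add: sums_iff)
  then have "(\<lambda>n. f' n y / (2 * pi)) sums ((pi * cosh (pi * y) / sinh (pi * y) - 1 / y) / (2 * pi))"
    by (rule sums_divide)
  moreover have "f' n y / (2 * pi) = y / (pi * ((real (n+1))\<^sup>2 + y\<^sup>2))" for n
    by (simp add: f'_def)
  moreover have "(pi * cosh (pi * y) / sinh (pi * y) - 1 / y) / (2 * pi)
     = (1 + exp (- 2 * pi * y)) / (2 * (1 - exp (- 2 * pi * y))) - 1 / (2 * pi * y)"
  proof -
    define e where "e = exp (pi * y)"
    have e: "e > 1" using y by (simp add: e_def)
    have ee: "e * e > 1" using e by (simp add: less_1_mult)
    have E: "exp (- 2 * pi * y) = 1 / (e * e)"
      by (simp add: e_def exp_minus field_simps flip: exp_add)
    have S: "sinh (pi * y) = (e * e - 1) / (2 * e)" "cosh (pi * y) = (e * e + 1) / (2 * e)"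
      using e by (auto simp: sinh_field_def cosh_field_def e_def[symmetric] exp_minus field_simps)
    have 1: "pi * ((e * e + 1) / (2 * e)) / ((e * e - 1) / (2 * e)) = pi * ((e * e + 1) / (e * e - 1))"
      using e ee by simp
    have 2: "(1 + 1 / (e * e)) / (2 * (1 - 1 / (e * e))) = (e * e + 1) / (e * e - 1) / 2"
      using e ee by (simp add: divide_simps)
    have 3: "(pi * t - 1 / y) / (2 * pi) = t / 2 - 1 / (2 * pi * y)" for t
      using y by (simp add: field_simps)
    show ?thesis by (simp only: E S 1 2 3)
  qed
  ultimately show ?thesis by simp
qed

text \<open>The trapezoidal rule error for u^p on [n, n+1], now counted from n = 0.\<close>

definition trapezoid_defect :: "real \<Rightarrow> nat \<Rightarrow> real" where
  "trapezoid_defect p n = (real n powr p + real (n+1) powr p) / 2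
     - (real (n+1) powr (1 + p) - real n powr (1 + p)) / (1 + p)"

text \<open>The trapezoidal rule error for u -> exp(-2 pi u y) on [n, n+1]. As u^p is a constant
  times the integral of (1 - exp(-2 pi u y)) y^(-p-1) over y, and the rule is exact for constants,
  errors for powers are integrals of errors for exponentials.\<close>

definition exp_defect :: "nat \<Rightarrow> real \<Rightarrow> real" where
  "exp_defect n y = exp (- 2 * pi * y) ^ n * ((1 + exp (- 2 * pi * y)) / 2
     - (1 - exp (- 2 * pi * y)) / (2 * pi * y))"

text \<open>Exponentials are convex, so the trapezoidal rule overestimates. With x = 2 pi y this is
  \<open>h x \<ge> 0\<close>, where \<open>h 0 = 0\<close> and the derivative of \<open>h\<close> is
  1 - (1 + t) exp(-t).\<close>

lemma exp_defect_nonneg: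
  assumes y: "y > 0" shows "exp_defect n y \<ge> 0"
proof -
  define h where "h = (\<lambda>x::real. x * (1 + exp (- x)) - 2 * (1 - exp (- x)))"
  define x where "x = 2 * pi * y"
  have x: "x > 0" using y by (simp add: x_def)
  have "h 0 \<le> h x"
  proof (rule DERIV_nonneg_imp_nondecreasing[of 0 x h])
    fix t :: real assume t: "0 \<le> t" "t \<le> x"
    have "(h has_real_derivative (1 - (1 + t) * exp (- t))) (at t)"
      unfolding h_def by (auto intro!: derivative_eq_intros simp: algebra_simps)
    moreover have "(1 + t) * exp (- t) \<le> exp t * exp (- t)"
      using exp_ge_add_one_self[of t] by (intro mult_right_mono) auto
    ultimately show "\<exists>y. (h has_real_derivative y) (at t) \<and> 0 \<le> y"
      by (intro exI[of _ "1 - (1 + t) * exp (- t)"]) (auto simp flip: exp_add)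
  qed (use x in auto)
  then have "(1 + exp (- x)) / 2 - (1 - exp (- x)) / x \<ge> 0"
    using x by (simp add: h_def field_simps)
  then show ?thesis by (simp add: exp_defect_def x_def)
qed

text \<open>Errors on consecutive intervals differ by the factor exp(-2 pi y), which makes the
  series geometric. The sum is the function expanded in \<open>coth_partial_fractions\<close>; here
  the two expansions meet.\<close>

lemma sums_exp_defect:
  assumes y: "y > 0"
  shows "(\<lambda>n. exp_defect n y) sums
     ((1 + exp (- 2 * pi * y)) / (2 * (1 - exp (- 2 * pi * y))) - 1 / (2 * pi * y))"
proof -
  define E where "E = exp (- 2 * pi * y)"
  have E: "E > 0" "E < 1" using y by (auto simp: E_def)
  have "(\<lambda>n. E ^ n * ((1 + E) / 2 - (1 - E) / (2 * pi * y))) sums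
     (1 / (1 - E) * ((1 + E) / 2 - (1 - E) / (2 * pi * y)))"
    using E by (intro sums_mult2 geometric_sums) auto
  moreover have "1 / (1 - E) * ((1 + E) / 2 - (1 - E) / (2 * pi * y)) = (1 + E) / (2 * (1 - E)) - 1 / (2 * pi * y)"
    using E y by (simp add: field_simps)
  ultimately show ?thesis by (simp add: exp_defect_def E_def)
qed

text \<open>The trapezoidal rule in u is applied under the integral over y. K is the constant for
  which K u^p is the integral of (1 - exp(-2 pi u y)) y^(-p-1), and the sign changes because the
  exponential enters with a minus.\<close>

lemma nn_integral_exp_defect:
  fixes p :: real
  assumes p: "0 < p" "p < 1"
  defines "K \<equiv> Gamma (1 - p) / p * (2 * pi) powr p"
  shows "(\<integral>\<^sup>+y\<in>{0<..}. ennreal (exp_defect n y * y powr (- p - 1)) \<partial>lborel) = ennreal (- K * trapezoid_defect p n)"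
    and "- K * trapezoid_defect p n \<ge> 0"
proof -
  have K: "K > 0" using p by (simp add: K_def)
  define D where "D = (\<lambda>u y::real. (1 - exp (- (2 * pi * u) * y)) * y powr (- p - 1))"
  define A where "A = (\<integral>\<^sup>+y\<in>{0<..}. ennreal (exp_defect n y * y powr (- p - 1)) \<partial>lborel)"
  define B where "B = K / 2 * (real n powr p + real (n+1) powr p)"
  define C where "C = K * ((real (n+1) powr (1 + p) - real n powr (1 + p)) / (1 + p))"
  have [measurable]: "(\<lambda>y. exp_defect n y) \<in> borel_measurable borel"
    unfolding exp_defect_def by measurable
  have [measurable]: "(\<lambda>y. D u y) \<in> borel_measurable borel" for u unfolding D_def by measurable
  have D: "(\<integral>\<^sup>+y\<in>{0<..}. ennreal (D u y) \<partial>lborel) = ennreal (K * u powr p)" if "u \<ge> 0" for u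
    unfolding D_def K_def using that
    by (subst nn_integral_one_minus_exp[OF p]) (auto simp: powr_mult mult_ac)
  have D0: "D u y \<ge> 0" if "u \<ge> 0" "y > 0" for u y
    using that by (auto simp: D_def)
  have half: "ennreal a + (ennreal h * ennreal b + ennreal h * ennreal c) = ennreal (a + (h * b + h * c))"
    if "a \<ge> 0" "b \<ge> 0" "c \<ge> 0" "h \<ge> 0" for a b c h
    using that by (simp add: ennreal_mult)
  \<comment> \<open>Subtraction in \<open>ennreal\<close> is truncated, so the identity is stated as
    error + average of the end values = integral, with all terms nonnegative.\<close>
  have pw: "ennreal (exp_defect n y * y powr (- p - 1)) * indicator {0<..} y +
      (ennreal (1/2) * (ennreal (D (real n) y) * indicator {0<..} y) + ennreal (1/2) * (ennreal (D (real (n+1)) y) * indicator {0<..} y))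
    = (\<integral>\<^sup>+u. ennreal (D u y) * indicator {real n..real (n+1)} u * indicator {0<..} y \<partial>lborel)" for y
  proof (cases "y > 0")
    case y: True
    define F where "F = (\<lambda>u. y powr (- p - 1) * (u + exp (- (2 * pi * u) * y) / (2 * pi * y)))"
    have "(\<integral>\<^sup>+u. ennreal (D u y) * indicator {real n..real (n+1)} u * indicator {0<..} y \<partial>lborel)
       = (\<integral>\<^sup>+u. ennreal (D u y) * indicator {real n..real (n+1)} u \<partial>lborel)" using y by simp
    also have "\<dots> = ennreal (F (real (n+1)) - F (real n))"
    proof (rule nn_integral_FTC_Icc)
      show "(\<lambda>u. D u y) \<in> borel_measurable borel" unfolding D_def by measurable
      fix u assume "u \<in> {real n..real (n+1)}"
      then show "D u y \<ge> 0" using y by (intro D0) auto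
      show "(F has_real_derivative D u y) (at u)"
        unfolding F_def D_def using y
        by (auto intro!: derivative_eq_intros simp: field_simps)
    qed auto
    also have "F (real (n+1)) - F (real n) = exp_defect n y * y powr (- p - 1) + (1/2 * D (real n) y + 1/2 * D (real (n+1)) y)"
    proof -
      define a where "a = exp (- (2 * pi * real n) * y)"
      define E where "E = exp (- 2 * pi * y)"
      have a: "E ^ n = a" "exp (- (2 * pi * (real (n+1))) * y) = a * E"
        by (auto simp: a_def E_def exp_of_nat_mult[symmetric] exp_add[symmetric] algebra_simps)
      show ?thesis unfolding F_def D_def exp_defect_def E_def[symmetric] a a_def[symmetric]
        using y by (simp add: field_simps)
    qed
    also have "ennreal \<dots> = ennreal (exp_defect n y * y powr (- p - 1)) +
        (ennreal (1/2) * ennreal (D (real n) y) + ennreal (1/2) * ennreal (D (real (n+1)) y))"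
      using y by (intro half[symmetric]) (auto intro!: D0 mult_nonneg_nonneg exp_defect_nonneg)
    moreover have "indicator {0<..} y = (1 :: ennreal)" using y by simp
    ultimately show ?thesis by (simp only: mult_1_right)
  qed auto
  have "A + ennreal B = A + (ennreal (1/2) * ennreal (K * real n powr p) + ennreal (1/2) * ennreal (K * real (n+1) powr p))"
    using K half[of 0 "K * real n powr p" "K * real (n+1) powr p" "1/2"]
    by (simp add: B_def distrib_left del: of_nat_add)
  also have "\<dots> = (\<integral>\<^sup>+y. (\<integral>\<^sup>+u. ennreal (D u y) * indicator {real n..real (n+1)} u * indicator {0<..} y \<partial>lborel) \<partial>lborel)"
    unfolding A_def pw[symmetric]
    by (subst nn_integral_add, measurable, subst nn_integral_add, measurable, subst nn_integral_cmult, measurable,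
        subst nn_integral_cmult, measurable, subst D, simp, subst D, simp_all)
  also have "\<dots> = (\<integral>\<^sup>+u. (\<integral>\<^sup>+y. ennreal (D u y) * indicator {real n..real (n+1)} u * indicator {0<..} y \<partial>lborel) \<partial>lborel)"
    unfolding D_def by (rule lborel_pair.Fubini'[symmetric]) measurable
  also have "\<dots> = (\<integral>\<^sup>+u. ennreal K * (ennreal (u powr p) * indicator {real n..real (n+1)} u) \<partial>lborel)"
  proof (rule nn_integral_cong)
    fix u :: real
    show "(\<integral>\<^sup>+y. ennreal (D u y) * indicator {real n..real (n+1)} u * indicator {0<..} y \<partial>lborel)
       = ennreal K * (ennreal (u powr p) * indicator {real n..real (n+1)} u)"
    proof (cases "u \<in> {real n..real (n+1)}")
      case True
      then have "u \<ge> 0" by auto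
      then show ?thesis using True D[of u] K by (simp add: ennreal_mult)
    qed auto
  qed
  also have "\<dots> = ennreal K * (\<integral>\<^sup>+u. ennreal (u powr p) * indicator {real n..real (n+1)} u \<partial>lborel)"
    by (rule nn_integral_cmult) measurable
  also have "(\<integral>\<^sup>+u. ennreal (u powr p) * indicator {real n..real (n+1)} u \<partial>lborel)
      = ennreal (real (n+1) powr (1 + p) / (1 + p) - real n powr (1 + p) / (1 + p))"
  proof (rule nn_integral_has_integral_lebesgue')
    show "((\<lambda>u. u powr p) has_integral (real (n+1) powr (1 + p) / (1 + p) - real n powr (1 + p) / (1 + p))) {real n..real (n+1)}"
    proof (rule fundamental_theorem_of_calculus_interior)
      show "continuous_on {real n..real (n+1)} (\<lambda>u. u powr (1 + p) / (1 + p))"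
        by (intro continuous_on_divide continuous_on_powr' continuous_on_id continuous_on_const) (use p in auto)
      fix u assume "u \<in> {real n<..<real (n+1)}"
      then have "u > 0" by auto
      then have "((\<lambda>u. u powr (1 + p) / (1 + p)) has_real_derivative u powr p) (at u)"
        using p by (auto intro!: derivative_eq_intros)
      then show "((\<lambda>u. u powr (1 + p) / (1 + p)) has_vector_derivative u powr p) (at u)"
        by (simp add: has_real_derivative_iff_has_vector_derivative)
    qed auto
  qed auto
  also have "ennreal K * \<dots> = ennreal C"
    using K by (simp add: C_def ennreal_mult'[symmetric] diff_divide_distrib)
  finally have AB: "A + ennreal B = ennreal C" .
  have BC: "B \<ge> 0" using K by (simp add: B_def)
  have C0: "C \<ge> 0" using K p unfolding C_def
    by (intro mult_nonneg_nonneg divide_nonneg_nonneg diff_ge_0_iff_ge[THEN iffD2] powr_mono2) auto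
  \<comment> \<open>Nonnegativity of A yields the sign of the defect and makes the later subtraction
    C - B legitimate.\<close>
  have "ennreal B \<le> ennreal C" unfolding AB[symmetric] by simp
  then have le: "B \<le> C"
    using C0 by (simp only: ennreal_le_iff)
  have eq: "C - B = - K * trapezoid_defect p n"
    by (simp add: B_def C_def trapezoid_defect_def algebra_simps add_divide_distrib diff_divide_distrib)
  then show "- K * trapezoid_defect p n \<ge> 0" using le by simp
  have "A = ennreal C - ennreal B" unfolding AB[symmetric] by simp
  then show "(\<integral>\<^sup>+y\<in>{0<..}. ennreal (exp_defect n y * y powr (- p - 1)) \<partial>lborel) = ennreal (- K * trapezoid_defect p n)"
    unfolding A_def eq[symmetric] using BC by (simp add: ennreal_minus)
qed

section \<open>The functional equation\<close>

text \<open>At s = -p, \<open>zeta_term n\<close> is -(p+1) times the defect on [n+1, n+2]. The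
  remaining interval [0, 1] has defect 1/2 - 1/(1+p), and -(p+1) times that is (1-p)/2, exactly the
  constant (s+1)/2 in \<open>Zeta\<close>.\<close>

lemma Zeta_minus:
  fixes p :: real
  assumes p: "0 < p" "p < 1"
  shows "summable (trapezoid_defect p)"
    and "Zeta (- of_real p) = of_real (- (p + 1) * (\<Sum>n. trapezoid_defect p n))"
proof -
  have term_eq: "zeta_term n (- of_real p) = of_real (- (p + 1) * trapezoid_defect p (Suc n))" for n
  proof -
    have 1: "of_nat m powr (of_real a) = complex_of_real (real m powr a)" for m a
      using powr_of_real[of "real m" a] by simp
    have 2: "- (- of_real p) = complex_of_real p" "1 - (- of_real p) = complex_of_real (1 + p)"
      "(- of_real p) - 1 = complex_of_real (- (p + 1))" by auto
    have "zeta_term n (- of_real p) = of_real (- (p + 1) * (real (n+1) powr p + real (n+2) powr p) / 2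
        + real (n+2) powr (1 + p) - real (n+1) powr (1 + p))"
      unfolding zeta_term_def 2 1 by simp
    also have "- (p + 1) * (real (n+1) powr p + real (n+2) powr p) / 2
        + real (n+2) powr (1 + p) - real (n+1) powr (1 + p) = - (p + 1) * trapezoid_defect p (Suc n)"
    proof -
      have gen: "- (p + 1) * X / 2 + a - b = - (p + 1) * (X / 2 - (a - b) / (1 + p))" for X a b
        using p by (simp add: field_simps)
      show ?thesis unfolding trapezoid_defect_def gen by (simp add: add_ac)
    qed
    finally show ?thesis .
  qed
  have "summable (\<lambda>n. zeta_term n (- of_real p))"
    using p by (intro summable_zeta_term) auto
  then have "summable (\<lambda>n. - (p + 1) * trapezoid_defect p (Suc n))"
    unfolding term_eq summable_complex_of_real .
  then have "summable (\<lambda>n. trapezoid_defect p (Suc n))"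
    using p by (subst (asm) summable_cmult_iff) auto
  then show sm: "summable (trapezoid_defect p)" by (simp add: summable_Suc_iff)
  have "(\<Sum>n. zeta_term n (- of_real p)) = of_real (\<Sum>n. - (p + 1) * trapezoid_defect p (Suc n))"
    unfolding term_eq by (rule suminf_of_real[symmetric]) fact
  also have "(\<Sum>n. - (p + 1) * trapezoid_defect p (Suc n)) = - (p + 1) * (\<Sum>n. trapezoid_defect p (Suc n))"
    by (rule suminf_mult) fact
  also have "(\<Sum>n. trapezoid_defect p (Suc n)) = (\<Sum>n. trapezoid_defect p n) - trapezoid_defect p 0"
    by (rule suminf_split_head[OF sm])
  also have "- (p + 1) * ((\<Sum>n. trapezoid_defect p n) - trapezoid_defect p 0)
      = - (p + 1) * (\<Sum>n. trapezoid_defect p n) + (p - 1) / 2"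
    using p by (simp add: trapezoid_defect_def field_simps)
  finally show "Zeta (- of_real p) = of_real (- (p + 1) * (\<Sum>n. trapezoid_defect p n))"
    unfolding Zeta_def by (simp add: field_simps)
qed

lemma Zeta_one_plus:
  fixes p :: real
  assumes p: "p > 0"
  shows "Zeta (1 + of_real p) = of_real (p * (\<Sum>n. real (n+1) powr (- p - 1)))"
proof -
  have eq: "1 / of_nat (Suc n) powr (1 + of_real p) = complex_of_real (real (n+1) powr (- p - 1))" for n
  proof -
    have "of_nat (Suc n) powr (1 + of_real p) = complex_of_real (real (Suc n) powr (1 + p))"
      using powr_of_real[of "real (Suc n)" "1 + p"] by simp
    moreover have "real (n+1) powr (- p - 1) = 1 / (real (Suc n) powr (1 + p))"
    proof -
      have "- p - 1 = - (1 + p)" by simp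
      then show ?thesis by (simp only: powr_minus_divide Suc_eq_plus1)
    qed
    ultimately show ?thesis by simp
  qed
  have "Zeta (1 + of_real p) = of_real p * (\<Sum>n. of_real (real (n+1) powr (- p - 1)))"
    using p by (subst Zeta_eq_dirichlet) (auto simp only: eq, simp_all)
  also have "(\<Sum>n. complex_of_real (real (n+1) powr (- p - 1))) = of_real (\<Sum>n. real (n+1) powr (- p - 1))"
    using p by (intro suminf_of_real[symmetric] summable_powr_Suc) auto
  finally show ?thesis by simp
qed

text \<open>
  Both sides are \<open>\<integral>\<^sub>0\<^sup>\<infinity> (1/(e\<^bsup>2\<pi>y\<^esup> - 1) + 1/2 - 1/(2\<pi>y)) y\<^sup>-\<^sup>p\<^sup>-\<^sup>1 dy\<close>, expanded once as a
  geometric series and once in partial fractions.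
\<close>

lemma trapezoid_defect_reflection:
  fixes p :: real
  assumes p: "0 < p" "p < 1"
  shows "Gamma (1 - p) / p * (2 * pi) powr p * (- (\<Sum>n. trapezoid_defect p n))
    = Gamma ((1 - p) / 2) * Gamma ((1 + p) / 2) / (2 * pi) * (\<Sum>n. real (n+1) powr (- p - 1))"
proof -
  define K where "K = Gamma (1 - p) / p * (2 * pi) powr p"
  define J where "J = Gamma ((1 - p) / 2) * Gamma ((1 + p) / 2) / (2 * pi)"
  have J: "J > 0" using p by (simp add: J_def)
  \<comment> \<open>Pointwise both series have the sum L; since all terms are nonnegative, the
    equality can be integrated term by term.\<close>
  have eq: "(\<Sum>n. ennreal (exp_defect n y * y powr (- p - 1)) * indicator {0<..} y)
    = (\<Sum>n. ennreal (1 / pi) * (ennreal (y powr (- p) / ((real (n+1))\<^sup>2 + y\<^sup>2)) * indicator {0<..} y))" for y :: real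
  proof (cases "y > 0")
    case y: True
    define L where "L = ((1 + exp (- 2 * pi * y)) / (2 * (1 - exp (- 2 * pi * y))) - 1 / (2 * pi * y)) * y powr (- p - 1)"
    have "(\<Sum>n. ennreal (exp_defect n y * y powr (- p - 1))) = ennreal L"
      unfolding L_def using y
      by (intro suminf_ennreal_eq mult_nonneg_nonneg exp_defect_nonneg sums_mult2 sums_exp_defect) auto
    moreover have "(\<Sum>n. ennreal (y / (pi * ((real (n+1))\<^sup>2 + y\<^sup>2)) * y powr (- p - 1))) = ennreal L"
      unfolding L_def using y
      by (intro suminf_ennreal_eq sums_mult2 coth_partial_fractions) auto
    moreover have "ennreal (y / (pi * ((real (n+1))\<^sup>2 + y\<^sup>2)) * y powr (- p - 1))
       = ennreal (1 / pi) * (ennreal (y powr (- p) / ((real (n+1))\<^sup>2 + y\<^sup>2)))" for n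
      using y by (subst ennreal_mult[symmetric]) (auto simp: powr_diff)
    ultimately show ?thesis using y by simp
  qed auto
  have "(\<Sum>n. ennreal (- K * trapezoid_defect p n))
      = (\<Sum>n. \<integral>\<^sup>+y\<in>{0<..}. ennreal (exp_defect n y * y powr (- p - 1)) \<partial>lborel)"
    unfolding K_def using nn_integral_exp_defect(1)[OF p] by simp
  also have "\<dots> = (\<integral>\<^sup>+y. (\<Sum>n. ennreal (exp_defect n y * y powr (- p - 1)) * indicator {0<..} y) \<partial>lborel)"
    by (rule nn_integral_suminf[symmetric]) (simp add: exp_defect_def)
  also have "\<dots> = (\<integral>\<^sup>+y. (\<Sum>n. ennreal (1 / pi) * (ennreal (y powr (- p) / ((real (n+1))\<^sup>2 + y\<^sup>2)) * indicator {0<..} y)) \<partial>lborel)"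
    by (simp only: eq)
  also have "\<dots> = (\<Sum>n. \<integral>\<^sup>+y. ennreal (1 / pi) * (ennreal (y powr (- p) / ((real (n+1))\<^sup>2 + y\<^sup>2)) * indicator {0<..} y) \<partial>lborel)"
    by (rule nn_integral_suminf) measurable
  also have "\<dots> = (\<Sum>n. ennreal (J * real (n+1) powr (- p - 1)))"
  proof (rule suminf_cong)
    fix n
    have "(\<integral>\<^sup>+y. ennreal (1 / pi) * (ennreal (y powr (- p) / ((real (n+1))\<^sup>2 + y\<^sup>2)) * indicator {0<..} y) \<partial>lborel)
      = ennreal (1 / pi) * (\<integral>\<^sup>+y\<in>{0<..}. ennreal (y powr (- p) / ((real (n+1))\<^sup>2 + y\<^sup>2)) \<partial>lborel)"
      by (rule nn_integral_cmult) measurable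
    also have "\<dots> = ennreal (1 / pi) * ennreal (Gamma ((1 - p) / 2) * Gamma ((1 + p) / 2) / 2 * real (n+1) powr (- p - 1))"
      by (subst nn_integral_powr_cauchy[OF p]) auto
    also have "\<dots> = ennreal (J * real (n+1) powr (- p - 1))"
      using p by (subst ennreal_mult[symmetric]) (auto simp: J_def)
    finally show "(\<integral>\<^sup>+y. ennreal (1 / pi) * (ennreal (y powr (- p) / ((real (n+1))\<^sup>2 + y\<^sup>2)) * indicator {0<..} y) \<partial>lborel)
      = ennreal (J * real (n+1) powr (- p - 1))" .
  qed
  finally have "(\<Sum>n. ennreal (- K * trapezoid_defect p n)) = (\<Sum>n. ennreal (J * real (n+1) powr (- p - 1)))" .
  moreover have "(\<Sum>n. ennreal (- K * trapezoid_defect p n)) = ennreal (- K * (\<Sum>n. trapezoid_defect p n))"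
    using nn_integral_exp_defect(2)[OF p] Zeta_minus(1)[OF p]
    by (intro suminf_ennreal_eq sums_mult) (auto simp: K_def)
  moreover have "(\<Sum>n. ennreal (J * real (n+1) powr (- p - 1))) = ennreal (J * (\<Sum>n. real (n+1) powr (- p - 1)))"
    using J p by (intro suminf_ennreal_eq sums_mult summable_sums summable_powr_Suc) auto
  ultimately have "ennreal (- K * (\<Sum>n. trapezoid_defect p n)) = ennreal (J * (\<Sum>n. real (n+1) powr (- p - 1)))"
    by simp
  \<comment> \<open>\<open>ennreal\<close> is injective only on nonnegative reals, so the signs of
    both sides are recorded before the coercion is dropped.\<close>
  moreover have "J * (\<Sum>n. real (n+1) powr (- p - 1)) \<ge> 0"
    using J p by (intro mult_nonneg_nonneg suminf_nonneg summable_powr_Suc) auto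
  moreover have "(\<Sum>n. - K * trapezoid_defect p n) \<ge> 0"
    using nn_integral_exp_defect(2)[OF p] Zeta_minus(1)[OF p]
    by (intro suminf_nonneg summable_mult) (auto simp: K_def)
  then have "- K * (\<Sum>n. trapezoid_defect p n) \<ge> 0"
    by (subst (asm) suminf_mult[OF Zeta_minus(1)[OF p]])
  ultimately have "- K * (\<Sum>n. trapezoid_defect p n) = J * (\<Sum>n. real (n+1) powr (- p - 1))"
    by (simp only: ennreal_inj)
  then show ?thesis by (simp add: K_def J_def)
qed

text \<open>This is 2 xi(s): Gamma(1 + s/2) = (s/2) Gamma(s/2) absorbs the factor s and the pole at
  0, and \<open>Zeta\<close> contains the factor s - 1. Hence it is holomorphic on all of Re s >
  -1.\<close>

definition xi_right :: "complex \<Rightarrow> complex" where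
  "xi_right s = 2 * of_real pi powr (- s / 2) * Gamma (1 + s / 2) * Zeta s"

text \<open>\<open>trapezoid_defect_reflection\<close> is the functional equation in its asymmetric
  form with Gamma(1-p). Legendre's duplication formula splits that factor, and the common factor
  Gamma((1-p)/2) cancels, leaving the symmetric form.\<close>

lemma xi_right_reflection_real:
  fixes p :: real
  assumes p: "0 < p" "p < 1"
  shows "xi_right (1 - (- of_real p)) = xi_right (- of_real p)"
proof -
  define W where "W = - (\<Sum>n. trapezoid_defect p n)"
  define Z where "Z = (\<Sum>n. real (n+1) powr (- p - 1))"
  define A where "A = Gamma ((1 - p) / 2)"
  define B where "B = Gamma ((1 + p) / 2)"
  define C where "C = Gamma (1 - p / 2)"
  have A: "A > 0" using p by (simp add: A_def)
  have rel: "Gamma (1 - p) / p * (2 * pi) powr p * W = A * B / (2 * pi) * Z"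
    unfolding W_def A_def B_def Z_def by (rule trapezoid_defect_reflection[OF p])
  have dup: "A * C = 2 powr p * sqrt pi * Gamma (1 - p)"
  proof -
    have np: "complex_of_real x \<notin> \<int>\<^sub>\<le>\<^sub>0" if "x > 0" for x
      using that unfolding of_real_in_nonpos_Ints_iff by (auto elim!: nonpos_Ints_cases)
    have e: "complex_of_real ((1 - p) / 2) + 1 / 2 = of_real (1 - p / 2)"
      by (simp add: field_simps)
    have "Gamma (complex_of_real ((1 - p) / 2)) * Gamma (complex_of_real ((1 - p) / 2) + 1 / 2)
      = exp ((1 - 2 * complex_of_real ((1 - p) / 2)) * of_real (ln 2)) * of_real (sqrt pi) * Gamma (2 * complex_of_real ((1 - p) / 2))"
    proof (rule Gamma_legendre_duplication)
      show "complex_of_real ((1 - p) / 2) \<notin> \<int>\<^sub>\<le>\<^sub>0" using p by (intro np) auto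
      show "complex_of_real ((1 - p) / 2) + 1 / 2 \<notin> \<int>\<^sub>\<le>\<^sub>0" unfolding e using p by (intro np) auto
    qed
    moreover have "exp ((1 - 2 * complex_of_real ((1 - p) / 2)) * of_real (ln 2)) = of_real (exp (p * ln 2))"
    proof -
      have "1 - 2 * complex_of_real ((1 - p) / 2) = of_real p" by (simp add: field_simps)
      then show ?thesis by (simp only: exp_of_real flip: of_real_mult)
    qed
    moreover have "2 * complex_of_real ((1 - p) / 2) = of_real (1 - p)" by simp
    ultimately have "complex_of_real (A * C) = of_real (exp (p * ln 2) * sqrt pi * Gamma (1 - p))"
      unfolding e A_def C_def by (simp only: Gamma_complex_of_real of_real_mult)
    then have "A * C = exp (p * ln 2) * sqrt pi * Gamma (1 - p)"
      by (simp only: of_real_eq_iff)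
    then show ?thesis by (simp add: powr_def)
  qed
  have B': "Gamma ((3 + p) / 2) = (1 + p) / 2 * B"
  proof -
    have "(1 + p) / 2 \<notin> \<int>\<^sub>\<le>\<^sub>0" using p by (auto elim!: nonpos_Ints_cases)
    moreover have "(3 + p) / 2 = (1 + p) / 2 + 1" by (simp add: field_simps)
    ultimately show ?thesis using Gamma_plus1[of "(1 + p) / 2"] unfolding B_def by metis
  qed
  \<comment> \<open>Multiplying by A forms the product A C to which \<open>dup\<close> applies; the
    powers of pi that remain are those of \<open>xi_right\<close> at -p and at 1 + p.\<close>
  have main: "C * pi powr (p / 2) * W = p * B * Z / 2 * pi powr (- (1 + p) / 2)"
  proof -
    have "A * (C * pi powr (p / 2) * W) * pi powr (p / 2) / (sqrt pi * p)
       = (A * C) * (pi powr (p / 2) * pi powr (p / 2)) * W / (sqrt pi * p)" by (simp add: mult_ac)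
    also have "\<dots> = Gamma (1 - p) / p * (2 powr p * pi powr p) * W"
      unfolding dup by (simp flip: powr_add)
    also have "2 powr p * pi powr p = (2 * pi) powr p" by (simp add: powr_mult)
    also note rel
    finally have 1: "A * (C * pi powr (p / 2) * W) * pi powr (p / 2) / (sqrt pi * p) = A * B / (2 * pi) * Z" .
    have 2: "X = p * B * Z / 2 * (sqrt pi / (P * pi))" if "A * X * P / (sqrt pi * p) = A * B / (2 * pi) * Z" "P > 0" for X P
      using that A p by (simp add: field_simps)
    have 3: "sqrt pi / (pi powr (p / 2) * pi) = pi powr (- (1 + p) / 2)"
    proof -
      have "sqrt pi = pi powr (1 / 2)" by (simp add: powr_half_sqrt)
      moreover have "pi powr (p / 2) * pi = pi powr (p / 2 + 1)" by (simp add: powr_add)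
      ultimately have "sqrt pi / (pi powr (p / 2) * pi) = pi powr (1 / 2 - (p / 2 + 1))" by (simp only: powr_diff)
      also have "1 / 2 - (p / 2 + 1) = - (1 + p) / 2" by (simp add: field_simps)
      finally show ?thesis .
    qed
    show ?thesis using 2[OF 1] unfolding 3 by simp
  qed
  have P: "complex_of_real pi powr of_real x = of_real (pi powr x)" for x
    by (rule powr_of_real) auto
  have "xi_right (- of_real p) = of_real (2 * (C * pi powr (p / 2) * W) * (p + 1))"
  proof -
    have e: "- (- complex_of_real p) / 2 = of_real (p / 2)" "1 + (- complex_of_real p) / 2 = of_real (1 - p / 2)"
      by auto
    show ?thesis unfolding xi_right_def Zeta_minus(2)[OF p] e P Gamma_complex_of_real
      by (simp add: W_def C_def algebra_simps)
  qed
  also have "\<dots> = of_real (2 * (p * B * Z / 2 * pi powr (- (1 + p) / 2)) * (p + 1))"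
    unfolding main ..
  also have "\<dots> = xi_right (1 + of_real p)"
  proof -
    have e: "- (1 + complex_of_real p) / 2 = of_real (- (1 + p) / 2)" "1 + (1 + complex_of_real p) / 2 = of_real ((3 + p) / 2)"
      by (auto simp: field_simps)
    show ?thesis unfolding xi_right_def Zeta_one_plus[OF p(1)] e P Gamma_complex_of_real B'
      by (simp add: Z_def)
  qed
  finally show ?thesis by simp
qed

lemma holomorphic_xi_right: "xi_right holomorphic_on {s. Re s > -1}"
proof -
  have "1 + s / 2 \<notin> \<int>\<^sub>\<le>\<^sub>0" if "Re s > -1" for s :: complex
  proof
    assume "1 + s / 2 \<in> \<int>\<^sub>\<le>\<^sub>0"
    then obtain n where n: "1 + s / 2 = of_int n" "n \<le> 0" by (auto elim: nonpos_Ints_cases)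
    then have "Re (1 + s / 2) \<le> 0" by simp
    then show False using that by simp
  qed
  then show ?thesis unfolding xi_right_def[abs_def]
    by (intro holomorphic_intros holomorphic_Zeta) auto
qed

text \<open>The strip is invariant under s -> 1 - s, so both sides are holomorphic on it; they agree
  on the real interval (-1, 0), which has the limit point -1/2.\<close>

lemma xi_right_reflection:
  assumes "-1 < Re s" "Re s < 2"
  shows "xi_right (1 - s) = xi_right s"
proof -
  define S where "S = {s. -1 < Re s} \<inter> {s. Re s < 2}"
  define f where "f = (\<lambda>s. xi_right (1 - s) - xi_right s)"
  have "f s = 0"
  proof (rule analytic_continuation[of f S "of_real ` {-1<..<0}" "of_real (- 1 / 2)"])
    have "xi_right \<circ> (\<lambda>s. 1 - s) holomorphic_on S"
      by (rule holomorphic_on_compose_gen[OF _ holomorphic_xi_right]) (auto simp: S_def intro!: holomorphic_intros)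
    then show "f holomorphic_on S"
      unfolding f_def by (intro holomorphic_on_diff holomorphic_on_subset[OF holomorphic_xi_right]) (auto simp: S_def o_def)
    show "s \<in> S" using assms by (simp add: S_def)
    show "open S" unfolding S_def by (intro open_Int open_halfspace_Re_gt open_halfspace_Re_lt)
    show "connected S" unfolding S_def
      by (intro convex_connected convex_Int convex_halfspace_Re_gt convex_halfspace_Re_lt)
    show "complex_of_real ` {-1<..<0} \<subseteq> S" by (auto simp: S_def)
    show "complex_of_real (- 1 / 2) \<in> S" by (simp add: S_def)
    have "(- 1 / 2 :: real) islimpt {-1<..<0}" by (simp add: islimpt_greaterThanLessThan1 open_imp_islimpt)
    moreover have "\<forall>\<^sub>F y in at (- 1 / 2). complex_of_real y \<noteq> of_real (- 1 / 2)"
      unfolding of_real_eq_iff by (rule eventually_neq_at_within)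
    moreover have "isCont complex_of_real (- 1 / 2)" by simp
    ultimately show "complex_of_real (- 1 / 2) islimpt complex_of_real ` {-1<..<0}"
      by (metis islimpt_isCont_image)
    fix z assume "z \<in> complex_of_real ` {-1<..<0}"
    then obtain r where "z = of_real r" "-1 < r" "r < 0" by auto
    then show "f z = 0" using xi_right_reflection_real[of "- r"] by (simp add: f_def)
  qed
  then show ?thesis by (simp add: f_def)
qed

text \<open>For Re s \<le> -1 the reflected point has real part at least 2. The two branches agree
  on -1 < Re s < 2, so there is no seam and the function is entire.\<close>

definition two_xi :: "complex \<Rightarrow> complex" where
  "two_xi s = (if Re s > -1 then xi_right s else xi_right (1 - s))"

lemma two_xi_reflection: "two_xi (1 - s) = two_xi s"
  using xi_right_reflection[of s] by (auto simp: two_xi_def)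

lemma holomorphic_two_xi: "two_xi holomorphic_on A"
proof -
  have 1: "two_xi holomorphic_on {s. Re s > -1}"
    by (rule holomorphic_transform[OF holomorphic_xi_right]) (auto simp: two_xi_def)
  have "two_xi \<circ> (\<lambda>s. 1 - s) holomorphic_on {s. Re s < 2}"
    by (rule holomorphic_on_compose_gen[OF _ 1]) (auto intro!: holomorphic_intros)
  then have 2: "two_xi holomorphic_on {s. Re s < 2}"
    by (simp add: o_def two_xi_reflection)
  have "two_xi holomorphic_on ({s. Re s > -1} \<union> {s. Re s < 2})"
    by (rule holomorphic_on_Un[OF 1 2 open_halfspace_Re_gt open_halfspace_Re_lt])
  then show ?thesis by (rule holomorphic_on_subset) auto
qed

section \<open>Decay of \<open>\<xi>\<close> on vertical strips\<close>

lemma norm_Gamma_le: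
  assumes z: "Re z > 0"
  shows "norm (Gamma z) \<le> Gamma (Re z)"
proof -
  note 1 = Gamma_integral_complex[OF z] and 2 = Gamma_integral_real[OF z]
  have "norm (integral {0..} (\<lambda>t. of_real t powr (z - 1) / of_real (exp t)))
      \<le> integral {0..} (\<lambda>t. t powr (Re z - 1) / exp t)"
    by (rule integral_norm_bound_integral[OF has_integral_integrable[OF 1] has_integral_integrable[OF 2]])
       (auto simp: norm_divide norm_powr_real_powr)
  then show ?thesis using 1 2 by (simp add: integral_unique)
qed

text \<open>Gamma(z + n) = z (z+1) ... (z+n-1) Gamma(z), and each of the n factors has modulus at
  least |Im z|. The left side is bounded by Gamma(Re z + n), which stays bounded on a compact range
  of Re z.\<close>

lemma norm_Gamma_decay:
  assumes a: "a > 0"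
  obtains C where "\<And>z. a \<le> Re z \<Longrightarrow> Re z \<le> b \<Longrightarrow> norm (Gamma z) * \<bar>Im z\<bar> ^ n \<le> C"
proof -
  have "compact ((\<lambda>x. Gamma (x + real n)) ` {a..b})"
  proof (intro compact_continuous_image compact_Icc)
    have "{0<..} \<inter> \<int>\<^sub>\<le>\<^sub>0 = ({} :: real set)" by (auto elim!: nonpos_Ints_cases)
    then have "continuous_on {0<..} (Gamma :: real \<Rightarrow> real)" by (rule continuous_on_Gamma)
    then show "continuous_on {a..b} (\<lambda>x. Gamma (x + real n))"
      by (rule continuous_on_compose2) (use a in \<open>auto intro!: continuous_intros\<close>)
  qed
  then obtain C where C: "\<And>x. x \<in> {a..b} \<Longrightarrow> norm (Gamma (x + real n)) \<le> C"
    by (meson bounded_iff compact_imp_bounded imageI)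
  show ?thesis
  proof (rule that[of C])
    fix z assume z: "a \<le> Re z" "Re z \<le> b"
    have nz: "z \<notin> \<int>\<^sub>\<le>\<^sub>0" using z a by (auto elim!: nonpos_Ints_cases)
    have "\<bar>Im z\<bar> ^ n \<le> norm (pochhammer z n)"
    proof -
      have "(\<Prod>i<n. \<bar>Im z\<bar>) \<le> (\<Prod>i<n. norm (z + of_nat i))"
        using abs_Im_le_cmod[of "z + of_nat _"] by (intro prod_mono) auto
      then show ?thesis by (simp add: pochhammer_prod prod_norm atLeast0LessThan)
    qed
    then have "norm (Gamma z) * \<bar>Im z\<bar> ^ n \<le> norm (Gamma z) * norm (pochhammer z n)"
      by (intro mult_left_mono) auto
    also have "\<dots> = norm (Gamma (z + of_nat n))"
      using nz by (simp add: pochhammer_Gamma Gamma_eq_zero_iff flip: norm_mult)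
    also have "\<dots> \<le> Gamma (Re z + real n)"
      using norm_Gamma_le[of "z + of_nat n"] z a by simp
    also have "\<dots> \<le> C" using C[of "Re z"] z by auto
    finally show "norm (Gamma z) * \<bar>Im z\<bar> ^ n \<le> C" .
  qed
qed

text \<open>Gamma(1 + s/2) decays with the powers n and n + 3 alike; the three extra ones pay for
  the cubic bound of \<open>Zeta\<close>. The bounds are in |Im s|/2, the imaginary part of the
  argument of Gamma, which costs the factor 2^n.\<close>

lemma norm_two_xi_right_le:
  obtains C where "\<And>s. 1/2 \<le> Re s \<Longrightarrow> Re s \<le> b \<Longrightarrow> norm (two_xi s) * \<bar>Im s\<bar> ^ n \<le> C"
proof -
  obtain Z where Z: "\<And>s. Re s \<ge> 0 \<Longrightarrow> norm (Zeta s) \<le> Z * (1 + norm s) ^ 3"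
    using norm_Zeta_le[of 0] by auto
  obtain C0 where C0: "\<And>z. 1 \<le> Re z \<Longrightarrow> Re z \<le> 1 + b / 2 \<Longrightarrow> norm (Gamma z) * \<bar>Im z\<bar> ^ n \<le> C0"
    using norm_Gamma_decay[of 1 "1 + b / 2" n] by auto
  obtain C1 where C1: "\<And>z. 1 \<le> Re z \<Longrightarrow> Re z \<le> 1 + b / 2 \<Longrightarrow> norm (Gamma z) * \<bar>Im z\<bar> ^ (n + 3) \<le> C1"
    using norm_Gamma_decay[of 1 "1 + b / 2" "n + 3"] by auto
  show ?thesis
  proof (rule that[of "2 ^ n * 2 * \<bar>Z\<bar> * (((1 + b + 2) ^ 3) * (C0 + C1))"])
    fix s assume s: "1/2 \<le> Re s" "Re s \<le> b"
    define t where "t = \<bar>Im s\<bar>"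
    define g where "g = norm (Gamma (1 + s / 2))"
    have t: "t \<ge> 0" and g: "g \<ge> 0" by (auto simp: t_def g_def)
    have b: "b \<ge> 0" using s by linarith
    have "norm s \<le> Re s + t" using cmod_le[of s] s by (simp add: t_def)
    \<comment> \<open>With m = max 1 (t/2), the sum 1 + b + t is at most (1 + b + 2) m, as 1 \<le>
      m, b \<le> b m and t \<le> 2 m.\<close>
    then have "1 + norm s \<le> (1 + b + 2) * max 1 (t / 2)"
    proof -
      define m where "m = max 1 (t / 2)"
      have m: "m \<ge> 1" "t \<le> 2 * m" by (auto simp: m_def)
      have "b * 1 \<le> b * m" using b m by (intro mult_left_mono) auto
      then show ?thesis using s m \<open>norm s \<le> Re s + t\<close> unfolding m_def[symmetric] distrib_right by linarith
    qed
    then have "(1 + norm s) ^ 3 \<le> ((1 + b + 2) * max 1 (t / 2)) ^ 3" by (rule power_mono) auto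
    also have "\<dots> \<le> (1 + b + 2) ^ 3 * (1 + (t / 2) ^ 3)"
      unfolding power_mult_distrib using b t by (intro mult_left_mono) (auto simp: max_def)
    finally have ns: "(1 + norm s) ^ 3 \<le> (1 + b + 2) ^ 3 * (1 + (t / 2) ^ 3)" .
    have "norm (complex_of_real pi powr (- s / 2)) = pi powr (- Re s / 2)"
      by (subst norm_powr_real_powr) auto
    also have "\<dots> \<le> pi powr 0" using s pi_gt3 by (intro powr_mono) auto
    finally have np: "norm (complex_of_real pi powr (- s / 2)) \<le> 1" by simp
    have "norm (two_xi s) = 2 * norm (complex_of_real pi powr (- s / 2)) * g * norm (Zeta s)"
      using s by (simp add: two_xi_def xi_right_def norm_mult g_def)
    also have "\<dots> \<le> 2 * 1 * g * (\<bar>Z\<bar> * (1 + norm s) ^ 3)"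
    proof (intro mult_mono np)
      show "norm (Zeta s) \<le> \<bar>Z\<bar> * (1 + norm s) ^ 3"
        using s by (intro order_trans[OF Z]) (auto intro!: mult_right_mono)
    qed (use g in auto)
    also have "\<dots> \<le> 2 * 1 * g * (\<bar>Z\<bar> * ((1 + b + 2) ^ 3 * (1 + (t / 2) ^ 3)))"
      using ns g by (intro mult_left_mono) auto
    finally have "norm (two_xi s) * t ^ n \<le> 2 * 1 * g * (\<bar>Z\<bar> * ((1 + b + 2) ^ 3 * (1 + (t / 2) ^ 3))) * t ^ n"
      using t by (intro mult_right_mono) auto
    also have "t ^ n = 2 ^ n * (t / 2) ^ n" by (simp add: power_divide)
    also have "2 * 1 * g * (\<bar>Z\<bar> * ((1 + b + 2) ^ 3 * (1 + (t / 2) ^ 3))) * (2 ^ n * (t / 2) ^ n)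
      = 2 ^ n * 2 * \<bar>Z\<bar> * ((1 + b + 2) ^ 3 * (g * (t / 2) ^ n + g * (t / 2) ^ (n + 3)))"
      by (simp add: power_add algebra_simps)
    also have "\<dots> \<le> 2 ^ n * 2 * \<bar>Z\<bar> * ((1 + b + 2) ^ 3 * (C0 + C1))"
    proof -
      have "\<bar>Im (1 + s / 2)\<bar> = t / 2" by (simp add: t_def)
      then have "g * (t / 2) ^ n \<le> C0" "g * (t / 2) ^ (n + 3) \<le> C1"
        using C0[of "1 + s / 2"] C1[of "1 + s / 2"] s by (auto simp: g_def)
      then show ?thesis using b by (intro mult_left_mono add_mono) auto
    qed
    finally show "norm (two_xi s) * \<bar>Im s\<bar> ^ n \<le> 2 ^ n * 2 * \<bar>Z\<bar> * (((1 + b + 2) ^ 3) * (C0 + C1))"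
      by (simp only: t_def flip: power_mult_distrib) simp
  qed
qed

text \<open>The reflection s -> 1 - s moves the part left of Re s = 1/2 to the right and preserves
  |Im s|. The bound R covers Re s as well as Re (1 - s).\<close>

lemma norm_two_xi_strip_le:
  obtains C where "\<And>s. a \<le> Re s \<Longrightarrow> Re s \<le> b \<Longrightarrow> norm (two_xi s) * (1 + \<bar>Im s\<bar>) ^ n \<le> C"
proof -
  define R where "R = max b (1 - a)"
  obtain C0 where C0: "\<And>s. 1/2 \<le> Re s \<Longrightarrow> Re s \<le> R \<Longrightarrow> norm (two_xi s) * \<bar>Im s\<bar> ^ 0 \<le> C0"
    using norm_two_xi_right_le by metis
  obtain C1 where C1: "\<And>s. 1/2 \<le> Re s \<Longrightarrow> Re s \<le> R \<Longrightarrow> norm (two_xi s) * \<bar>Im s\<bar> ^ n \<le> C1"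
    using norm_two_xi_right_le by metis
  have *: "norm (two_xi s) * (1 + \<bar>Im s\<bar>) ^ n \<le> 2 ^ n * (C0 + C1)" if s: "1/2 \<le> Re s" "Re s \<le> R" for s
  proof -
    have "(1 + \<bar>Im s\<bar>) ^ n \<le> (2 * max 1 \<bar>Im s\<bar>) ^ n" by (intro power_mono) auto
    also have "\<dots> \<le> 2 ^ n * (1 + \<bar>Im s\<bar> ^ n)"
      unfolding power_mult_distrib by (intro mult_left_mono) (auto simp: max_def)
    finally have "norm (two_xi s) * (1 + \<bar>Im s\<bar>) ^ n \<le> norm (two_xi s) * (2 ^ n * (1 + \<bar>Im s\<bar> ^ n))"
      by (intro mult_left_mono) auto
    also have "\<dots> = 2 ^ n * (norm (two_xi s) * \<bar>Im s\<bar> ^ 0 + norm (two_xi s) * \<bar>Im s\<bar> ^ n)"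
      by (simp add: algebra_simps)
    also have "\<dots> \<le> 2 ^ n * (C0 + C1)" using C0[OF s] C1[OF s] by (intro mult_left_mono add_mono) auto
    finally show ?thesis .
  qed
  show ?thesis
  proof (rule that[of "2 ^ n * (C0 + C1)"])
    fix s assume s: "a \<le> Re s" "Re s \<le> b"
    show "norm (two_xi s) * (1 + \<bar>Im s\<bar>) ^ n \<le> 2 ^ n * (C0 + C1)"
    proof (cases "Re s \<ge> 1/2")
      case True
      then show ?thesis using s by (intro *) (auto simp: R_def)
    next
      case False
      then show ?thesis using s *[of "1 - s"] by (simp add: R_def two_xi_reflection)
    qed
  qed
qed

text \<open>The trapezoidal rule is exact for the constant x^0, so all terms vanish at s = 0 and
  \<open>Zeta 0 = 1 / 2\<close>, that is zeta(0) = -1/2. The two values become the total mass and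
  the mean of the distribution.\<close>

lemma two_xi_0: "two_xi 0 = 1" and two_xi_1: "two_xi 1 = 1"
proof -
  have "zeta_term n 0 = 0" for n
  proof -
    have "of_nat (n+1) \<noteq> (0::complex)" "of_nat (n+2) \<noteq> (0::complex)" unfolding of_nat_eq_0_iff by auto
    then show ?thesis by (simp add: zeta_term_def)
  qed
  then have Zeta_0: "Zeta 0 = 1 / 2" by (simp add: Zeta_def)
  show "two_xi 0 = 1" by (simp add: two_xi_def xi_right_def Zeta_0)
  then show "two_xi 1 = 1" using two_xi_reflection[of 0] by simp
qed

section \<open>Conjugation symmetry and identification with \<open>zeta\<close> and
  \<open>xi\<close>\<close>

lemma cnj_two_xi: "cnj (two_xi s) = two_xi (cnj s)"
proof -
  have "cnj (zeta_term n s) = zeta_term n (cnj s)" for n s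
    by (simp add: zeta_term_def cnj_powr)
  then have "cnj (Zeta s) = Zeta (cnj s)" if "Re s > -1" for s
    using sums_cnj[THEN iffD2, OF summable_sums[OF summable_zeta_term[OF that]]]
    by (simp add: Zeta_def sums_iff)
  then have "cnj (xi_right s) = xi_right (cnj s)" if "Re s > -1" for s
    using that by (simp add: xi_right_def cnj_powr cnj_Gamma)
  then show ?thesis by (simp add: two_xi_def)
qed

text \<open>The formula for 2 xi, solved for zeta. The reciprocal Gamma function is entire, so s = 1
  is the only singularity and the formula qualifies as the described continuation; uniqueness is the
  identity theorem on the connected punctured plane.\<close>

lemma zeta_eq:
  "zeta = (\<lambda>s. if s = 1 then 0 else two_xi s * of_real pi powr (s / 2) * rGamma (1 + s / 2) / (2 * (s - 1)))"
    (is "_ = ?f")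
proof -
  define f where "f = ?f"
  define P where "P = (\<lambda>f. f holomorphic_on (- {1}) \<and>
                  (\<forall>s. Re s > 1 \<longrightarrow> f s = (\<Sum>n. 1 / of_nat (Suc n) powr s)) \<and>
                  f (1::complex) = (0::complex))"
  have "(\<lambda>s. two_xi s * of_real pi powr (s / 2) * rGamma (1 + s / 2) / (2 * (s - 1))) holomorphic_on (- {1})"
    by (intro holomorphic_intros holomorphic_two_xi) auto
  then have 1: "f holomorphic_on (- {1})"
    by (rule holomorphic_transform) (auto simp: f_def)
  have 2: "f s = (\<Sum>n. 1 / of_nat (Suc n) powr s)" if s: "Re s > 1" for s
  proof -
    have G: "Gamma (1 + s / 2) \<noteq> 0" "rGamma (1 + s / 2) = 1 / Gamma (1 + s / 2)"
    proof -
      have "1 + s / 2 \<notin> \<int>\<^sub>\<le>\<^sub>0"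
      proof
        assume "1 + s / 2 \<in> \<int>\<^sub>\<le>\<^sub>0"
        then obtain n where n: "1 + s / 2 = of_int n" "n \<le> 0" by (auto elim: nonpos_Ints_cases)
        then have "Re (1 + s / 2) \<le> 0" by simp
        then show False using s by simp
      qed
      then show "Gamma (1 + s / 2) \<noteq> 0" by (simp add: Gamma_eq_zero_iff)
      show "rGamma (1 + s / 2) = 1 / Gamma (1 + s / 2)" by (simp add: rGamma_inverse_Gamma field_simps)
    qed
    have pi: "complex_of_real pi powr (- s / 2) * of_real pi powr (s / 2) = 1"
      by (simp flip: powr_add)
    have "s \<noteq> 1" using s by auto
    then have "f s = (of_real pi powr (- s / 2) * of_real pi powr (s / 2)) * (Gamma (1 + s / 2) * rGamma (1 + s / 2)) * (Zeta s / (s - 1))"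
    proof -
      have gen: "2 * p * g * z * q * r / (2 * d) = (p * q) * (g * r) * (z / d)" for p g z q r d :: complex
        by simp
      have c: "(s = 1) = False" "(Re s > -1) = True" using s \<open>s \<noteq> 1\<close> by auto
      show ?thesis unfolding f_def two_xi_def xi_right_def c if_False if_True by (rule gen)
    qed
    also have "\<dots> = Zeta s / (s - 1)" unfolding pi using G by simp
    also have "\<dots> = (\<Sum>n. 1 / of_nat (Suc n) powr s)"
      using \<open>s \<noteq> 1\<close> by (simp add: Zeta_eq_dirichlet[OF s])
    finally show ?thesis .
  qed
  have Pf: "P f" using 1 2 by (simp add: P_def f_def)
  have "g = f" if "P g" for g
  proof
    fix s
    define h where "h = (\<lambda>s. g s - f s)"
    show "g s = f s"
    proof (cases "s = 1")
      case False
      have "h s = 0"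
      proof (rule analytic_continuation_open[of "{s. Re s > 1}" "- {1}" h "\<lambda>_. 0"])
        show "connected (- {1 :: complex})" by (intro connected_punctured_universe) simp
        show "{s. Re s > 1} \<noteq> {}" by (auto intro: exI[of _ 2])
        show "h holomorphic_on - {1}" using that Pf unfolding h_def P_def by (intro holomorphic_intros) auto
      qed (use False that Pf in \<open>auto simp: open_halfspace_Re_gt h_def P_def\<close>)
      then show ?thesis by (simp add: h_def)
    qed (use that Pf in \<open>simp add: P_def\<close>)
  qed
  with Pf have "The P = f" by (rule the_equality)
  then have "zeta = f" unfolding zeta_def P_def .
  then show ?thesis by (simp add: f_def)
qed

text \<open>The recurrence (s/2) Gamma(s/2) = Gamma(1 + s/2) undoes the reciprocal Gamma in
  \<open>zeta_eq\<close>. At the excluded points, the poles of Gamma(s/2) and of zeta, the product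
  on the left has only a conventional value.\<close>

lemma completed_zeta_eq:
  assumes "s \<noteq> 1" "s / 2 \<notin> \<int>\<^sub>\<le>\<^sub>0"
  shows "s * (s - 1) * (Gamma (s / 2) * zeta s * of_real pi powr (- s / 2)) = two_xi s"
proof -
  have pi: "complex_of_real pi powr (s / 2) * of_real pi powr (- s / 2) = 1"
    by (simp flip: powr_add)
  have "s \<noteq> 0" using assms by auto
  have "Gamma (s / 2 + 1) = s / 2 * Gamma (s / 2)" using assms by (intro Gamma_plus1) auto
  moreover have "s / 2 + 1 \<notin> \<int>\<^sub>\<le>\<^sub>0"
    using assms \<open>s \<noteq> 0\<close> by (metis Gamma_eq_zero_iff calculation divide_eq_0_iff mult_eq_0_iff zero_neq_numeral)
  then have "Gamma (1 + s / 2) * rGamma (1 + s / 2) = 1"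
    by (simp add: rGamma_inverse_Gamma Gamma_eq_zero_iff add.commute)
  ultimately have G: "s / 2 * Gamma (s / 2) * rGamma (1 + s / 2) = 1" by (metis add.commute)
  have "s * (s - 1) * (Gamma (s / 2) * zeta s * of_real pi powr (- s / 2))
     = two_xi s * (of_real pi powr (s / 2) * of_real pi powr (- s / 2)) * (s / 2 * Gamma (s / 2) * rGamma (1 + s / 2))"
  proof -
    have "s * d * (g * (x * p * r / (2 * d)) * q) = x * (p * q) * (s / 2 * g * r)" if "d \<noteq> 0" for d g x p r q
      using that by simp
    then show ?thesis using assms(1) unfolding zeta_eq if_not_P[OF assms(1)] by (metis eq_iff_diff_eq_0)
  qed
  then show ?thesis unfolding pi G by simp
qed

lemma xi_eq: "xi s = two_xi s / 2"
  unfolding xi_def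
proof (rule remove_sings_eqI)
  \<comment> \<open>A finite set containing every possible exceptional point within distance 1 of s,
    namely 1 and the even integers 2 n with n close to Re s / 2. Off this set
    \<open>completed_zeta_eq\<close> applies, which gives the limit of the defining formula at
    s.\<close>
  define A where "A = (\<lambda>n. 2 * of_int n :: complex) ` {\<lfloor>Re s / 2\<rfloor> - 2..\<lfloor>Re s / 2\<rfloor> + 2} \<union> {1}"
  have "open (ball s 1 - (A - {s}))" by (intro open_Diff finite_imp_closed) (auto simp: A_def)
  then have "eventually (\<lambda>w. w \<in> (ball s 1 - (A - {s})) - {s}) (at s)"
    by (rule eventually_at_in_open) auto
  then have ev: "eventually (\<lambda>w. two_xi w / 2 = 1 / 2 * w * (w - 1) * complex_of_real pi powr (- w / 2) * Gamma (w / 2) * zeta w) (at s)"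
  proof eventually_elim
    case (elim w)
    then have w: "w \<notin> A" "dist s w < 1" by auto
    have "w / 2 \<notin> \<int>\<^sub>\<le>\<^sub>0"
    proof
      assume "w / 2 \<in> \<int>\<^sub>\<le>\<^sub>0"
      then obtain n where n: "w / 2 = of_int n" by (auto elim: nonpos_Ints_cases)
      have "\<bar>Re s - Re w\<bar> < 1" using w abs_Re_le_cmod[of "s - w"] by (simp add: dist_norm)
      moreover have "Re w = 2 * of_int n" using n by (simp add: field_simps)
      ultimately have "n \<in> {\<lfloor>Re s / 2\<rfloor> - 2..\<lfloor>Re s / 2\<rfloor> + 2}" by (simp add: abs_less_iff) linarith
      moreover have "w = 2 * of_int n" using n by (simp add: field_simps)
      ultimately show False using w by (auto simp: A_def)
    qed
    moreover have "w \<noteq> 1" using w by (auto simp: A_def)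
    ultimately show ?case using completed_zeta_eq[of w] by (simp add: mult_ac)
  qed
  have "isCont two_xi s"
    using holomorphic_on_imp_continuous_on[OF holomorphic_two_xi[of UNIV]] by (simp add: continuous_on_eq_continuous_at)
  then have "((\<lambda>w. two_xi w / 2) \<longlongrightarrow> two_xi s / 2) (at s)"
    by (intro tendsto_divide tendsto_const) (simp_all add: isCont_def)
  then show "((\<lambda>s. 1 / 2 * s * (s - 1) * complex_of_real pi powr (- s / 2) * Gamma (s / 2) * zeta s) \<longlongrightarrow> two_xi s / 2) (at s)"
    by (rule Lim_transform_eventually[OF _ ev])
qed

section \<open>Contour shifts\<close>

text \<open>The class on which lines of integration can be moved. Uniformity over each strip makes
  the horizontal sides of a rectangle vanish; asking for all powers n lets polynomially bounded
  factors be multiplied in.\<close>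

definition rapid_decay :: "(complex \<Rightarrow> complex) \<Rightarrow> bool" where
  "rapid_decay f \<longleftrightarrow> f holomorphic_on UNIV \<and>
     (\<forall>a b n. \<exists>C. \<forall>s. a \<le> Re s \<and> Re s \<le> b \<longrightarrow> norm (f s) * (1 + \<bar>Im s\<bar>) ^ n \<le> C)"

lemma rapid_decay_mult:
  assumes f: "rapid_decay f" and g: "g holomorphic_on UNIV"
    and bnd: "\<And>a b. \<exists>C n. \<forall>s. a \<le> Re s \<and> Re s \<le> b \<longrightarrow> norm (g s) \<le> C * (1 + \<bar>Im s\<bar>) ^ n"
  shows "rapid_decay (\<lambda>s. f s * g s)"
  unfolding rapid_decay_def
proof (intro conjI allI)
  show "(\<lambda>s. f s * g s) holomorphic_on UNIV"
    using f g by (intro holomorphic_intros) (auto simp: rapid_decay_def)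
  fix a b :: real and n :: nat
  obtain C m where C: "\<And>s. a \<le> Re s \<Longrightarrow> Re s \<le> b \<Longrightarrow> norm (g s) \<le> C * (1 + \<bar>Im s\<bar>) ^ m"
    using bnd by blast
  obtain D where D: "\<And>s. a \<le> Re s \<Longrightarrow> Re s \<le> b \<Longrightarrow> norm (f s) * (1 + \<bar>Im s\<bar>) ^ (m + n) \<le> D"
    using f unfolding rapid_decay_def by meson
  show "\<exists>C. \<forall>s. a \<le> Re s \<and> Re s \<le> b \<longrightarrow> norm (f s * g s) * (1 + \<bar>Im s\<bar>) ^ n \<le> C"
  proof (intro exI[of _ "\<bar>C\<bar> * D"] allI impI, elim conjE)
    fix s assume s: "a \<le> Re s" "Re s \<le> b"
    have "norm (g s) \<le> \<bar>C\<bar> * (1 + \<bar>Im s\<bar>) ^ m"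
      by (rule order_trans[OF C[OF s]]) (auto intro!: mult_right_mono)
    then have "norm (f s * g s) * (1 + \<bar>Im s\<bar>) ^ n \<le> norm (f s) * (\<bar>C\<bar> * (1 + \<bar>Im s\<bar>) ^ m) * (1 + \<bar>Im s\<bar>) ^ n"
      unfolding norm_mult by (intro mult_right_mono mult_left_mono) auto
    also have "\<dots> = \<bar>C\<bar> * (norm (f s) * (1 + \<bar>Im s\<bar>) ^ (m + n))" by (simp add: power_add mult_ac)
    also have "\<dots> \<le> \<bar>C\<bar> * D" using D[OF s] by (intro mult_left_mono) auto
    finally show "norm (f s * g s) * (1 + \<bar>Im s\<bar>) ^ n \<le> \<bar>C\<bar> * D" .
  qed
qed

lemma rapid_decay_two_xi: "rapid_decay two_xi"
  unfolding rapid_decay_def using norm_two_xi_strip_le holomorphic_two_xi by metis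

lemma rapid_decay_two_xi_power:
  assumes "k \<ge> 1" shows "rapid_decay (\<lambda>s. two_xi s ^ k)"
  using assms
proof (induction k rule: dec_induct)
  case base
  then show ?case using rapid_decay_two_xi by simp
next
  case (step k)
  have "rapid_decay (\<lambda>s. two_xi s ^ k * two_xi s)"
  proof (rule rapid_decay_mult[OF step.IH holomorphic_two_xi])
    fix a b
    obtain C where "\<And>s. a \<le> Re s \<Longrightarrow> Re s \<le> b \<Longrightarrow> norm (two_xi s) * (1 + \<bar>Im s\<bar>) ^ 0 \<le> C"
      using norm_two_xi_strip_le by metis
    then show "\<exists>C n. \<forall>s. a \<le> Re s \<and> Re s \<le> b \<longrightarrow> norm (two_xi s) \<le> C * (1 + \<bar>Im s\<bar>) ^ n"
      by (intro exI[of _ C] exI[of _ 0]) auto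
  qed
  then show ?case by (simp add: mult.commute)
qed

lemma rapid_decay_strip_bound:
  assumes "rapid_decay f"
  obtains C where "C \<ge> 0" "\<And>s. a \<le> Re s \<Longrightarrow> Re s \<le> b \<Longrightarrow> norm (f s) \<le> C * inverse (1 + (Im s)\<^sup>2)"
proof -
  obtain C where C: "\<And>s. a \<le> Re s \<Longrightarrow> Re s \<le> b \<Longrightarrow> norm (f s) * (1 + \<bar>Im s\<bar>) ^ 2 \<le> C"
    using assms unfolding rapid_decay_def by meson
  show ?thesis
  proof (rule that[of "\<bar>C\<bar>"])
    fix s assume s: "a \<le> Re s" "Re s \<le> b"
    have "norm (f s) * (1 + (Im s)\<^sup>2) \<le> norm (f s) * (1 + \<bar>Im s\<bar>) ^ 2"
      by (intro mult_left_mono) (auto simp: power2_sum)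
    also have "\<dots> \<le> \<bar>C\<bar>" using C[OF s] by simp
    finally have "norm (f s) * (1 + (Im s)\<^sup>2) \<le> \<bar>C\<bar>" .
    moreover have "1 + (Im s)\<^sup>2 > 0" by (intro add_pos_nonneg) auto
    ultimately show "norm (f s) \<le> \<bar>C\<bar> * inverse (1 + (Im s)\<^sup>2)"
      by (simp add: field_simps)
  qed auto
qed

lemma integrable_inverse_1_plus_sq: "integrable lborel (\<lambda>t::real. inverse (1 + t\<^sup>2))"
  using integrable_inverse_1_plus_square by (simp add: set_integrable_def)

lemma borel_measurable_Complex [measurable]: "Complex \<sigma> \<in> borel_measurable borel"
  unfolding Complex_eq[abs_def] by measurable

lemma rapid_decay_continuous: "rapid_decay f \<Longrightarrow> continuous_on UNIV f"
  unfolding rapid_decay_def by (blast intro: holomorphic_on_imp_continuous_on)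

lemma rapid_decay_measurable: "rapid_decay f \<Longrightarrow> f \<in> borel_measurable borel"
  by (intro borel_measurable_continuous_onI rapid_decay_continuous)

lemma rapid_decay_integrable_mult:
  assumes f: "rapid_decay f" and [measurable]: "g \<in> borel_measurable borel"
    and g: "\<And>t. norm (g t) \<le> B"
  shows "integrable lborel (\<lambda>t. f (Complex \<sigma> t) * g t)"
proof -
  note [measurable] = rapid_decay_measurable[OF f]
  obtain C where C: "C \<ge> 0" "\<And>s. \<sigma> \<le> Re s \<Longrightarrow> Re s \<le> \<sigma> \<Longrightarrow> norm (f s) \<le> C * inverse (1 + (Im s)\<^sup>2)"
    using rapid_decay_strip_bound[OF f] by metis
  have B: "B \<ge> 0" using g[of 0] norm_ge_zero order_trans by blast
  show ?thesis
  proof (rule Bochner_Integration.integrable_bound)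
    show "integrable lborel (\<lambda>t::real. C * B * inverse (1 + t\<^sup>2))"
      by (intro integrable_mult_right integrable_inverse_1_plus_sq)
    have "norm (f (Complex \<sigma> t) * g t) \<le> norm (C * B * inverse (1 + t\<^sup>2))" for t
    proof -
      have "norm (f (Complex \<sigma> t) * g t) \<le> (C * inverse (1 + t\<^sup>2)) * B"
        unfolding norm_mult using C(2)[of "Complex \<sigma> t"] g C(1) by (intro mult_mono) auto
      then show ?thesis using C(1) B by (simp add: mult_ac)
    qed
    then show "AE t in lborel. norm (f (Complex \<sigma> t) * g t) \<le> norm (C * B * inverse (1 + t\<^sup>2))" by simp
  qed measurable
qed

lemma rapid_decay_integrable_pole:
  assumes f: "rapid_decay f" and \<sigma>: "\<sigma> \<noteq> Re z"
  shows "integrable lborel (\<lambda>t. f (Complex \<sigma> t) / (Complex \<sigma> t - z))"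
proof -
  have "norm (1 / (Complex \<sigma> t - z)) \<le> 1 / \<bar>\<sigma> - Re z\<bar>" for t
    using abs_Re_le_cmod[of "Complex \<sigma> t - z"] \<sigma> by (auto simp: norm_divide intro!: divide_left_mono mult_pos_pos)
  then have "integrable lborel (\<lambda>t. f (Complex \<sigma> t) * (1 / (Complex \<sigma> t - z)))"
    by (intro rapid_decay_integrable_mult[OF f]) auto
  then show ?thesis by simp
qed

text \<open>Contour integrals along vertical segments are gauge integrals over [-n, n]; dominated
  convergence links their limit to the Lebesgue integral over the line.\<close>

lemma symmetric_integral_tendsto:
  fixes g :: "real \<Rightarrow> complex"
  assumes g: "integrable lborel g"
  shows "(\<lambda>n. integral {- real n..real n} g) \<longlonglongrightarrow> integral\<^sup>L lborel g"
proof -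
  have "(\<lambda>n. LINT t:{- real n..real n}|lborel. g t) \<longlonglongrightarrow> integral\<^sup>L lborel g"
    unfolding set_lebesgue_integral_def
  proof (rule integral_dominated_convergence[where w = "\<lambda>t. norm (g t)"])
    show "AE t in lborel. (\<lambda>n. indicat_real {- real n..real n} t *\<^sub>R g t) \<longlonglongrightarrow> g t"
    proof (rule AE_I2)
      fix t :: real
      have "eventually (\<lambda>n. indicat_real {- real n..real n} t *\<^sub>R g t = g t) sequentially"
        using eventually_ge_at_top[of "nat \<lceil>\<bar>t\<bar>\<rceil>"]
      proof eventually_elim
        case (elim n)
        then have "\<bar>t\<bar> \<le> real n" by linarith
        then show ?case by (auto simp: indicator_def)
      qed
      then show "(\<lambda>n. indicat_real {- real n..real n} t *\<^sub>R g t) \<longlonglongrightarrow> g t"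
        by (rule tendsto_eventually)
    qed
  qed (use g in \<open>auto simp: indicator_def\<close>)
  moreover have "(LINT t:{- real n..real n}|lborel. g t) = integral {- real n..real n} g" for n
    by (rule set_borel_integral_eq_integral(2))
       (unfold set_integrable_def, rule integrable_mult_indicator[OF _ g], simp)
  ultimately show ?thesis by simp
qed

text \<open>Cauchy's formula on the rectangle with real parts a, b and imaginary parts -n, n. As n
  grows the horizontal sides vanish and the vertical ones become the line integrals. The factor i of
  ds = i dt cancels that of 2 pi i.\<close>

lemma rapid_decay_Cauchy:
  assumes f: "rapid_decay f" and z: "a < Re z" "Re z < b"
  shows "(\<integral>t. f (Complex b t) / (Complex b t - z) \<partial>lborel) - (\<integral>t. f (Complex a t) / (Complex a t - z) \<partial>lborel)
     = 2 * of_real pi * f z"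
proof -
  define g where "g = (\<lambda>w. f w / (w - z))"
  define I where "I = (\<lambda>\<sigma> n. integral {- real n..real n} (\<lambda>t. g (Complex \<sigma> t)))"
  define H where "H = (\<lambda>y. contour_integral (linepath (Complex a y) (Complex b y)) g)"
  obtain C where C: "C \<ge> 0" "\<And>s. a \<le> Re s \<Longrightarrow> Re s \<le> b \<Longrightarrow> norm (f s) \<le> C * inverse (1 + (Im s)\<^sup>2)"
    using rapid_decay_strip_bound[OF f] by metis
  have I: "I \<sigma> \<longlonglongrightarrow> (\<integral>t. g (Complex \<sigma> t) \<partial>lborel)" if "\<sigma> \<noteq> Re z" for \<sigma>
    unfolding I_def g_def using that by (intro symmetric_integral_tendsto rapid_decay_integrable_pole f)
  have cont: "continuous_on S g" if "z \<notin> S" for S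
    unfolding g_def using that
    by (intro continuous_intros continuous_on_subset[OF rapid_decay_continuous[OF f]]) auto
  \<comment> \<open>The sign \<sigma> = 1 or -1 treats the top and the bottom side at once.\<close>
  have H: "(\<lambda>n. H (\<sigma> * real n)) \<longlonglongrightarrow> 0" if \<sigma>: "\<bar>\<sigma>\<bar> = 1" for \<sigma>
  proof (rule Lim_null_comparison)
    show "(\<lambda>n. C * inverse (1 + (real n)\<^sup>2) * (b - a)) \<longlonglongrightarrow> 0" by real_asymp
    show "\<forall>\<^sub>F n in sequentially. norm (H (\<sigma> * real n)) \<le> C * inverse (1 + (real n)\<^sup>2) * (b - a)"
      \<comment> \<open>From this height on the horizontal sides are at distance at least 1 from z,
        so dividing by x - z does not enlarge the integrand.\<close>
      using eventually_ge_at_top[of "nat \<lceil>\<bar>Im z\<bar> + 1\<rceil>"]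
    proof eventually_elim
      case (elim n)
      have far: "norm (x - z) \<ge> 1" if "Im x = \<sigma> * real n" for x
      proof -
        have "real n \<ge> \<bar>Im z\<bar> + 1" using elim by linarith
        moreover have "\<bar>\<sigma> * real n\<bar> = real n" using \<sigma> by (simp add: abs_mult)
        ultimately have "\<bar>Im (x - z)\<bar> \<ge> 1" using that by simp
        then show ?thesis using abs_Im_le_cmod order_trans by blast
      qed
      have seg: "Im x = \<sigma> * real n \<and> a \<le> Re x \<and> Re x \<le> b"
        if "x \<in> closed_segment (Complex a (\<sigma> * real n)) (Complex b (\<sigma> * real n))" for x
        using that z by (auto simp: closed_segment_same_Im closed_segment_eq_real_ivl)
      have "norm (H (\<sigma> * real n)) \<le> C * inverse (1 + (real n)\<^sup>2) * norm (Complex b (\<sigma> * real n) - Complex a (\<sigma> * real n))"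
        unfolding H_def
      proof (rule contour_integral_bound_linepath)
        show "g contour_integrable_on linepath (Complex a (\<sigma> * real n)) (Complex b (\<sigma> * real n))"
          using seg[of z] far[of z] by (intro contour_integrable_continuous_linepath cont) auto
        fix x assume "x \<in> closed_segment (Complex a (\<sigma> * real n)) (Complex b (\<sigma> * real n))"
        note x = seg[OF this]
        have "norm (g x) = norm (f x) / norm (x - z)" by (simp add: g_def norm_divide)
        also have "\<dots> \<le> norm (f x) / 1" using far[of x] x by (intro divide_left_mono) auto
        also have "\<dots> \<le> C * inverse (1 + (Im x)\<^sup>2)" using C(2)[of x] x by simp
        also have "(Im x)\<^sup>2 = (real n)\<^sup>2" using x \<sigma> by (simp add: power_mult_distrib abs_square_eq_1)
        finally show "norm (g x) \<le> C * inverse (1 + (real n)\<^sup>2)" .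
      qed (use C in auto)
      also have "norm (Complex b (\<sigma> * real n) - Complex a (\<sigma> * real n)) = b - a"
      proof -
        have "Complex b (\<sigma> * real n) - Complex a (\<sigma> * real n) = of_real (b - a)"
          by (simp add: complex_eq_iff)
        then show ?thesis using z by (simp only: norm_of_real abs_of_pos diff_gt_0_iff_gt less_trans)
      qed
      finally show ?case .
    qed
  qed
  have "\<forall>\<^sub>F n in sequentially. H ((-1) * real n) + \<i> * I b n - H (1 * real n) - \<i> * I a n = 2 * of_real pi * \<i> * f z"
    using eventually_ge_at_top[of "nat \<lceil>\<bar>Im z\<bar> + 1\<rceil>"]
  proof eventually_elim
    case (elim n)
    then have n: "real n > \<bar>Im z\<bar>" "n > 0" by linarith+
    define p1 p2 p3 p4 where "p1 = Complex a (- real n)" and "p2 = Complex b (- real n)"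
      and "p3 = Complex b (real n)" and "p4 = Complex a (real n)"
    note p = p1_def p2_def p3_def p4_def
    have rp: "rectpath p1 p3 = linepath p1 p2 +++ linepath p2 p3 +++ linepath p3 p4 +++ linepath p4 p1"
      by (simp add: rectpath_def Let_def p)
    have zbox: "z \<in> box p1 p3" using z n by (auto simp: p in_box_complex_iff)
    have zimg: "z \<notin> path_image (rectpath p1 p3)"
      using zbox z by (subst path_image_rectpath_cbox_minus_box) (auto simp: p)
    have seg: "z \<notin> closed_segment p1 p2" "z \<notin> closed_segment p2 p3" "z \<notin> closed_segment p3 p4" "z \<notin> closed_segment p4 p1"
      using zimg unfolding rp by (auto simp: path_image_join)
    have ci: "g contour_integrable_on linepath p1 p2" "g contour_integrable_on linepath p2 p3"
        "g contour_integrable_on linepath p3 p4" "g contour_integrable_on linepath p4 p1"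
      using seg by (auto intro!: contour_integrable_continuous_linepath cont)
    have "((\<lambda>w. f w / (w - z)) has_contour_integral (2 * pi * \<i> * winding_number (rectpath p1 p3) z * f z)) (rectpath p1 p3)"
      using f zimg by (intro Cauchy_integral_formula_convex_simple[of UNIV]) (auto simp: rapid_decay_def)
    then have "contour_integral (rectpath p1 p3) g = 2 * of_real pi * \<i> * f z"
      using winding_number_rectpath[OF zbox] unfolding g_def by (simp add: contour_integral_unique)
    moreover have "contour_integral (rectpath p1 p3) g = contour_integral (linepath p1 p2) g
       + (contour_integral (linepath p2 p3) g + (contour_integral (linepath p3 p4) g + contour_integral (linepath p4 p1) g))"
      unfolding rp using ci by (simp add: contour_integrable_join)
    moreover have "contour_integral (linepath p2 p3) g = \<i> * I b n"
      unfolding I_def using n by (intro contour_integral_linepath_same_Re) (auto simp: p)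
    moreover have "contour_integral (linepath p4 p1) g = - contour_integral (linepath p1 p4) g"
      using seg by (intro contour_integral_reverse_linepath cont) auto
    moreover have "contour_integral (linepath p1 p4) g = \<i> * I a n"
      unfolding I_def using n by (intro contour_integral_linepath_same_Re) (auto simp: p)
    moreover have "contour_integral (linepath p3 p4) g = - contour_integral (linepath p4 p3) g"
      using seg by (intro contour_integral_reverse_linepath cont) auto
    ultimately show ?case by (simp add: H_def p)
  qed
  then have "(\<lambda>n. H ((-1) * real n) + \<i> * I b n - H (1 * real n) - \<i> * I a n) \<longlonglongrightarrow> 2 * of_real pi * \<i> * f z"
    by (rule tendsto_eventually)
  moreover have "(\<lambda>n. H ((-1) * real n) + \<i> * I b n - H (1 * real n) - \<i> * I a n) \<longlonglongrightarrow>
      0 + \<i> * (\<integral>t. g (Complex b t) \<partial>lborel) - 0 - \<i> * (\<integral>t. g (Complex a t) \<partial>lborel)"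
    using z by (intro tendsto_intros H I) auto
  ultimately have "2 * of_real pi * \<i> * f z = 0 + \<i> * (\<integral>t. g (Complex b t) \<partial>lborel) - 0 - \<i> * (\<integral>t. g (Complex a t) \<partial>lborel)"
    by (rule LIMSEQ_unique)
  then have "\<i> * (2 * of_real pi * f z) = \<i> * ((\<integral>t. g (Complex b t) \<partial>lborel) - (\<integral>t. g (Complex a t) \<partial>lborel))"
    by (simp add: algebra_simps)
  then show ?thesis unfolding g_def mult_cancel_left by simp
qed

text \<open>Cauchy's formula for f(s) (s - z) with z midway between the lines: the value at z is 0,
  and the quotient by s - z is f itself.\<close>

lemma rapid_decay_shift:
  assumes f: "rapid_decay f"
  shows "(\<integral>t. f (Complex a t) \<partial>lborel) = (\<integral>t. f (Complex b t) \<partial>lborel)"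
proof -
  have *: "(\<integral>t. f (Complex a t) \<partial>lborel) = (\<integral>t. f (Complex b t) \<partial>lborel)" if "a < b" for a b
  proof -
    define z where "z = complex_of_real ((a + b) / 2)"
    have z: "a < Re z" "Re z < b" using that by (auto simp: z_def)
    have "rapid_decay (\<lambda>s. f s * (s - z))"
    proof (rule rapid_decay_mult[OF f])
      fix p q :: real
      define K where "K = \<bar>p\<bar> + \<bar>q\<bar> + norm z"
      have K: "K \<ge> 0" by (simp add: K_def)
      have "norm (s - z) \<le> (1 + K) * (1 + \<bar>Im s\<bar>) ^ 1" if "p \<le> Re s" "Re s \<le> q" for s
      proof -
        have "norm (s - z) \<le> norm s + norm z" by (rule norm_triangle_ineq4)
        also have "norm s \<le> \<bar>Re s\<bar> + \<bar>Im s\<bar>" by (rule cmod_le)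
        also have "\<bar>Re s\<bar> \<le> \<bar>p\<bar> + \<bar>q\<bar>" using that by linarith
        finally have "norm (s - z) \<le> K + \<bar>Im s\<bar>" by (simp add: K_def)
        moreover have "K * \<bar>Im s\<bar> \<ge> 0" using K by simp
        ultimately show ?thesis by (simp add: distrib_left distrib_right)
      qed
      then show "\<exists>C n. \<forall>s. p \<le> Re s \<and> Re s \<le> q \<longrightarrow> norm (s - z) \<le> C * (1 + \<bar>Im s\<bar>) ^ n"
        by (intro exI[of _ "1 + K"] exI[of _ 1]) simp
    qed (auto intro!: holomorphic_intros)
    from rapid_decay_Cauchy[OF this z]
    have "(\<integral>t. f (Complex b t) * (Complex b t - z) / (Complex b t - z) \<partial>lborel)
        = (\<integral>t. f (Complex a t) * (Complex a t - z) / (Complex a t - z) \<partial>lborel)"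
      by (simp only: diff_self mult_zero_right right_minus_eq)
    moreover have "f (Complex b t) * (Complex b t - z) / (Complex b t - z) = f (Complex b t)"
       "f (Complex a t) * (Complex a t - z) / (Complex a t - z) = f (Complex a t)" for t
      using z by (auto simp: complex_eq_iff)
    ultimately show ?thesis by (simp only:)
  qed
  show ?thesis using *[of a b] *[of b a, symmetric] by (metis linorder_less_linear)
qed

section \<open>Mellin inversion\<close>

lemma of_real_powr_eq_exp:
  "x > 0 \<Longrightarrow> complex_of_real x powr s = exp (s * of_real (ln x))"
  by (simp add: powr_def Ln_of_real)

lemma norm_of_real_powr: "x > 0 \<Longrightarrow> norm (complex_of_real x powr s) = x powr Re s"
  by (subst norm_powr_real_powr) auto

text \<open>The primitive x^u / u tends to 0 at 0 because Re u > 0. With u = z - s the value 1 / u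
  becomes the Cauchy kernel on a line to the left of z.\<close>

lemma mellin_integral_left:
  assumes u: "Re u > 0"
  shows "set_integrable lborel {0<..<1} (\<lambda>x. x powr (Re u - 1))"
    and "(LINT x:{0<..<1}|lborel. complex_of_real x powr (u - 1)) = 1 / u"
proof -
  have u0: "u \<noteq> 0" using u by auto
  have ei: "einterval 0 1 = {0<..<1}" by (auto simp: einterval_def zero_ereal_def one_ereal_def)
  have lim0: "((\<lambda>x. x powr Re u) \<longlongrightarrow> 0) (at_right 0)"
    using u by (intro tendsto_eq_intros tendsto_zero_powrI[of _ _ _ "Re u"] tendsto_ident_at tendsto_const)
       (auto intro: eventually_mono[OF eventually_at_right_less])
  have "set_integrable lborel (einterval 0 1) (\<lambda>x. x powr (Re u - 1))"
  proof (rule interval_integral_FTC_nonneg(1)[where F = "\<lambda>x. x powr Re u / Re u" and A = 0 and B = "1 / Re u"])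
    fix x assume "0 < ereal x"
    then have x: "x > 0" by simp
    show "((\<lambda>x. x powr Re u / Re u) has_real_derivative x powr (Re u - 1)) (at x)"
      using x u by (auto intro!: derivative_eq_intros)
    show "isCont (\<lambda>x. x powr (Re u - 1)) x" using x by (intro continuous_intros) auto
  next
    show "(((\<lambda>x. x powr Re u / Re u) \<circ> real_of_ereal) \<longlongrightarrow> 0) (at_right 0)"
      unfolding zero_ereal_def ereal_tendsto_simps using tendsto_divide[OF lim0 tendsto_const[of "Re u"]] u by simp
    have "isCont (\<lambda>x. x powr Re u / Re u) 1" using u by (intro continuous_intros) auto
    then show "(((\<lambda>x. x powr Re u / Re u) \<circ> real_of_ereal) \<longlongrightarrow> 1 / Re u) (at_left 1)"
      unfolding one_ereal_def ereal_tendsto_simps by (auto simp: isCont_def intro: filterlim_mono at_le)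
  qed auto
  then show 1: "set_integrable lborel {0<..<1} (\<lambda>x. x powr (Re u - 1))" by (simp add: ei)
  have "(LBINT x=0..1. complex_of_real x powr (u - 1)) = 1 / u - 0"
  proof (rule interval_integral_FTC_integrable[where F = "\<lambda>x. complex_of_real x powr u / u"])
    fix x assume "0 < ereal x"
    then have x: "x > 0" by simp
    then have x': "complex_of_real x \<notin> \<real>\<^sub>\<le>\<^sub>0" by (auto simp: complex_nonpos_Reals_iff)
    have "((\<lambda>z. z powr u / u) has_field_derivative complex_of_real x powr (u - 1)) (at (of_real x))"
      using x' u0 by (auto intro!: derivative_eq_intros)
    then show "((\<lambda>x. complex_of_real x powr u / u) has_vector_derivative complex_of_real x powr (u - 1)) (at x)"
      by (rule has_vector_derivative_real_field)
    show "isCont (\<lambda>x. complex_of_real x powr (u - 1)) x"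
      using x' by (intro continuous_intros) auto
  next
    \<comment> \<open>Measurability is read off from the exponential of the logarithm, which agrees
      with \<open>powr\<close> on the support of the indicator.\<close>
    have "(\<lambda>x. indicat_real {0<..<1} x *\<^sub>R exp ((u - 1) * complex_of_real (ln x))) = (\<lambda>x. indicat_real {0<..<1} x *\<^sub>R complex_of_real x powr (u - 1))"
      by (auto simp: fun_eq_iff indicator_def of_real_powr_eq_exp)
    moreover have "(\<lambda>x. indicat_real {0<..<1} x *\<^sub>R exp ((u - 1) * complex_of_real (ln x))) \<in> borel_measurable lborel" by measurable
    ultimately have meas: "(\<lambda>x. indicat_real {0<..<1} x *\<^sub>R complex_of_real x powr (u - 1)) \<in> borel_measurable lborel" by simp
    show "set_integrable lborel (einterval 0 1) (\<lambda>x. complex_of_real x powr (u - 1))"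
      unfolding ei set_integrable_def
      by (rule Bochner_Integration.integrable_bound[OF 1[unfolded set_integrable_def] meas])
         (auto simp: indicator_def norm_of_real_powr)
    have "((\<lambda>x. complex_of_real x powr u) \<longlongrightarrow> 0) (at_right 0)"
    proof (rule tendsto_norm_zero_cancel)
      have "eventually (\<lambda>x. x powr Re u = norm (complex_of_real x powr u)) (at_right 0)"
        using eventually_at_right_less[of 0] by eventually_elim (simp add: norm_of_real_powr)
      then show "((\<lambda>x. norm (complex_of_real x powr u)) \<longlongrightarrow> 0) (at_right 0)"
        by (rule Lim_transform_eventually[OF lim0])
    qed
    from tendsto_divide[OF this tendsto_const[of u]]
    show "(((\<lambda>x. complex_of_real x powr u / u) \<circ> real_of_ereal) \<longlongrightarrow> 0) (at_right 0)"
      unfolding zero_ereal_def ereal_tendsto_simps using u0 by simp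
    have "isCont (\<lambda>x. complex_of_real x powr u / u) 1" using u0 by (intro continuous_intros) auto
    then show "(((\<lambda>x. complex_of_real x powr u / u) \<circ> real_of_ereal) \<longlongrightarrow> 1 / u) (at_left 1)"
      unfolding one_ereal_def ereal_tendsto_simps by (auto simp: isCont_def intro: filterlim_mono at_le)
  qed auto
  then show "(LINT x:{0<..<1}|lborel. complex_of_real x powr (u - 1)) = 1 / u"
    by (simp add: interval_lebesgue_integral_def ei)
qed

text \<open>Mirror case: the primitive now vanishes at infinity, and its value at 1 enters with a
  minus sign.\<close>

lemma mellin_integral_right:
  assumes u: "Re u < 0"
  shows "set_integrable lborel {1<..} (\<lambda>x. x powr (Re u - 1))"
    and "(LINT x:{1<..}|lborel. complex_of_real x powr (u - 1)) = - 1 / u"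
proof -
  have u0: "u \<noteq> 0" using u by auto
  have ei: "einterval 1 \<infinity> = {1<..}" by (auto simp: einterval_def one_ereal_def)
  have limI: "((\<lambda>x::real. x powr Re u) \<longlongrightarrow> 0) at_top"
    using u by (rule tendsto_neg_powr) (rule filterlim_ident)
  have "set_integrable lborel (einterval 1 \<infinity>) (\<lambda>x. x powr (Re u - 1))"
  proof (rule interval_integral_FTC_nonneg(1)[where F = "\<lambda>x. x powr Re u / Re u" and B = 0 and A = "1 / Re u"])
    fix x assume "1 < ereal x"
    then have x: "x > 1" by simp
    show "((\<lambda>x. x powr Re u / Re u) has_real_derivative x powr (Re u - 1)) (at x)"
      using x u by (auto intro!: derivative_eq_intros)
    show "isCont (\<lambda>x. x powr (Re u - 1)) x" using x by (intro continuous_intros) auto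
  next
    show "(((\<lambda>x. x powr Re u / Re u) \<circ> real_of_ereal) \<longlongrightarrow> 0) (at_left \<infinity>)"
      unfolding ereal_tendsto_simps using tendsto_divide[OF limI tendsto_const[of "Re u"]] u by simp
    have "isCont (\<lambda>x. x powr Re u / Re u) 1" using u by (intro continuous_intros) auto
    then show "(((\<lambda>x. x powr Re u / Re u) \<circ> real_of_ereal) \<longlongrightarrow> 1 / Re u) (at_right 1)"
      unfolding one_ereal_def ereal_tendsto_simps by (auto simp: isCont_def intro: filterlim_mono at_le)
  qed auto
  then show 1: "set_integrable lborel {1<..} (\<lambda>x. x powr (Re u - 1))" by (simp add: ei)
  have "(LBINT x=1..\<infinity>. complex_of_real x powr (u - 1)) = 0 - 1 / u"
  proof (rule interval_integral_FTC_integrable[where F = "\<lambda>x. complex_of_real x powr u / u"])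
    fix x assume "1 < ereal x"
    then have x: "x > 1" by simp
    then have x': "complex_of_real x \<notin> \<real>\<^sub>\<le>\<^sub>0" by (auto simp: complex_nonpos_Reals_iff)
    have "((\<lambda>z. z powr u / u) has_field_derivative complex_of_real x powr (u - 1)) (at (of_real x))"
      using x' u0 by (auto intro!: derivative_eq_intros)
    then show "((\<lambda>x. complex_of_real x powr u / u) has_vector_derivative complex_of_real x powr (u - 1)) (at x)"
      by (rule has_vector_derivative_real_field)
    show "isCont (\<lambda>x. complex_of_real x powr (u - 1)) x"
      using x' by (intro continuous_intros) auto
  next
    have "(\<lambda>x. indicat_real {1<..} x *\<^sub>R exp ((u - 1) * complex_of_real (ln x))) = (\<lambda>x. indicat_real {1<..} x *\<^sub>R complex_of_real x powr (u - 1))"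
      by (auto simp: fun_eq_iff indicator_def of_real_powr_eq_exp)
    moreover have "(\<lambda>x. indicat_real {1<..} x *\<^sub>R exp ((u - 1) * complex_of_real (ln x))) \<in> borel_measurable lborel" by measurable
    ultimately have meas: "(\<lambda>x. indicat_real {1<..} x *\<^sub>R complex_of_real x powr (u - 1)) \<in> borel_measurable lborel" by simp
    show "set_integrable lborel (einterval 1 \<infinity>) (\<lambda>x. complex_of_real x powr (u - 1))"
      unfolding ei set_integrable_def
      by (rule Bochner_Integration.integrable_bound[OF 1[unfolded set_integrable_def] meas])
         (auto simp: indicator_def norm_of_real_powr)
    have "((\<lambda>x. complex_of_real x powr u) \<longlongrightarrow> 0) at_top"
    proof (rule tendsto_norm_zero_cancel)
      have "eventually (\<lambda>x. x powr Re u = norm (complex_of_real x powr u)) at_top"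
        using eventually_gt_at_top[of 0] by eventually_elim (simp add: norm_of_real_powr)
      then show "((\<lambda>x. norm (complex_of_real x powr u)) \<longlongrightarrow> 0) at_top"
        by (rule Lim_transform_eventually[OF limI])
    qed
    from tendsto_divide[OF this tendsto_const[of u]]
    show "(((\<lambda>x. complex_of_real x powr u / u) \<circ> real_of_ereal) \<longlongrightarrow> 0) (at_left \<infinity>)"
      unfolding ereal_tendsto_simps using u0 by simp
    have "isCont (\<lambda>x. complex_of_real x powr u / u) 1" using u0 by (intro continuous_intros) auto
    then show "(((\<lambda>x. complex_of_real x powr u / u) \<circ> real_of_ereal) \<longlongrightarrow> 1 / u) (at_right 1)"
      unfolding one_ereal_def ereal_tendsto_simps by (auto simp: isCont_def intro: filterlim_mono at_le)
  qed auto
  then show "(LINT x:{1<..}|lborel. complex_of_real x powr (u - 1)) = - 1 / u"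
    by (simp add: interval_lebesgue_integral_def ei)
qed

text \<open>The prefactor is 1/(2 pi) rather than 1/(2 pi i), since ds = i dt has already been
  substituted.\<close>

definition inverse_mellin :: "real \<Rightarrow> (complex \<Rightarrow> complex) \<Rightarrow> real \<Rightarrow> complex" where
  "inverse_mellin \<sigma> f x = 1 / (2 * of_real pi) *
     (\<integral>t. f (Complex \<sigma> t) * complex_of_real x powr (- Complex \<sigma> t) \<partial>lborel)"

lemma rapid_decay_mult_powr:
  assumes f: "rapid_decay f" and x: "x > 0"
  shows "rapid_decay (\<lambda>s. f s * complex_of_real x powr (- s))"
proof (rule rapid_decay_mult[OF f])
  show "(\<lambda>s. complex_of_real x powr (- s)) holomorphic_on UNIV"
    using x by (intro holomorphic_intros) auto
  fix a b :: real
  have "norm (complex_of_real x powr (- s)) \<le> (x powr (- a) + x powr (- b)) * (1 + \<bar>Im s\<bar>) ^ 0"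
    if "a \<le> Re s" "Re s \<le> b" for s
  proof -
    have "norm (complex_of_real x powr (- s)) = x powr (- Re s)" using x by (simp add: norm_of_real_powr)
    also have "\<dots> \<le> x powr (- a) + x powr (- b)"
    proof (cases "x \<ge> 1")
      case True
      then have "x powr (- Re s) \<le> x powr (- a)" using that by (intro powr_mono) auto
      then show ?thesis by (simp add: add_increasing2)
    next
      case False
      then have "x powr (- Re s) \<le> x powr (- b)" using that x by (intro powr_mono') auto
      then show ?thesis by (simp add: add_increasing)
    qed
    finally show ?thesis by simp
  qed
  then show "\<exists>C n. \<forall>s. a \<le> Re s \<and> Re s \<le> b \<longrightarrow> norm (complex_of_real x powr (- s)) \<le> C * (1 + \<bar>Im s\<bar>) ^ n"
    by (intro exI[of _ "x powr (- a) + x powr (- b)"] exI[of _ 0]) simp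
qed

lemma inverse_mellin_shift:
  assumes "rapid_decay f" "x > 0"
  shows "inverse_mellin a f x = inverse_mellin b f x"
  unfolding inverse_mellin_def using rapid_decay_shift[OF rapid_decay_mult_powr[OF assms]] by metis

text \<open>Fubini for x in A and s on the line. The modulus of the kernel splits as |f(s)| times
  x^(Re z - \<sigma> - 1), because |x^(-s)| depends only on Re s, so integrability can be checked
  for each factor separately. \<open>J\<close> is supplied by \<open>mellin_integral_left\<close> or
  \<open>mellin_integral_right\<close>.\<close>

lemma mellin_inverse_mellin_region:
  assumes f: "rapid_decay f" and A [measurable]: "A \<in> sets borel" and pos: "\<And>x. x \<in> A \<Longrightarrow> x > 0"
    and int: "set_integrable lborel A (\<lambda>x. x powr (Re z - \<sigma> - 1))"
    and J: "\<And>t. (LINT x:A|lborel. complex_of_real x powr (z - Complex \<sigma> t - 1)) = J t"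
  shows "set_integrable lborel A (\<lambda>x. inverse_mellin \<sigma> f x * complex_of_real x powr (z - 1))"
    and "(LINT x:A|lborel. inverse_mellin \<sigma> f x * complex_of_real x powr (z - 1))
       = 1 / (2 * of_real pi) * (\<integral>t. f (Complex \<sigma> t) * J t \<partial>lborel)"
proof -
  note [measurable] = rapid_decay_measurable[OF f]
  \<comment> \<open>Written with \<open>exp\<close> and \<open>ln\<close> to be jointly measurable;
    on A, where x > 0, this is the power.\<close>
  define K where "K = (\<lambda>(x, t). indicat_real A x *\<^sub>R (f (Complex \<sigma> t) * exp ((z - Complex \<sigma> t - 1) * of_real (ln x))))"
  have K_eq: "K (x, t) = indicat_real A x *\<^sub>R (f (Complex \<sigma> t) * complex_of_real x powr (z - Complex \<sigma> t - 1))" for x t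
    using pos by (auto simp: K_def indicator_def of_real_powr_eq_exp)
  have K_eq': "K (x, t) = f (Complex \<sigma> t) * (indicat_real A x *\<^sub>R complex_of_real x powr (z - Complex \<sigma> t - 1))" for x t
    unfolding K_eq by simp
  have norm_K: "norm (K (x, t)) = norm (f (Complex \<sigma> t)) * (indicat_real A x * x powr (Re z - \<sigma> - 1))" for x t
    using pos by (auto simp: K_eq norm_mult norm_of_real_powr indicator_def)
  have K_int: "integrable (lborel \<Otimes>\<^sub>M lborel) K"
  proof (rule lborel_pair.Fubini_integrable)
    show "K \<in> borel_measurable (lborel \<Otimes>\<^sub>M lborel)" unfolding K_def by measurable
    have "integrable lborel (\<lambda>x. (\<integral>t. norm (f (Complex \<sigma> t)) \<partial>lborel) * (indicat_real A x * x powr (Re z - \<sigma> - 1)))"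
      using int unfolding set_integrable_def by (intro integrable_mult_right) simp
    then show "integrable lborel (\<lambda>x. \<integral>t. norm (K (x, t)) \<partial>lborel)"
      by (simp add: norm_K)
    have "integrable lborel (\<lambda>t. K (x, t))" for x
    proof (cases "x \<in> A")
      case True
      have "integrable lborel (\<lambda>t. f (Complex \<sigma> t) * exp ((z - Complex \<sigma> t - 1) * of_real (ln x)))"
      proof (rule rapid_decay_integrable_mult[OF f])
        show "norm (exp ((z - Complex \<sigma> t - 1) * of_real (ln x))) \<le> x powr (Re z - \<sigma> - 1)" for t
          using pos[OF True] by (simp add: norm_of_real_powr flip: of_real_powr_eq_exp)
      qed measurable
      then show ?thesis using True by (simp add: K_def)
    qed (simp add: K_def)
    then show "AE x in lborel. integrable lborel (\<lambda>t. K (x, t))" by simp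
  qed
  have inner: "(\<integral>t. K (x, t) \<partial>lborel) = 2 * of_real pi * (indicat_real A x *\<^sub>R (inverse_mellin \<sigma> f x * complex_of_real x powr (z - 1)))" for x
  proof (cases "x \<in> A")
    case True
    then have x: "x > 0" by (rule pos)
    have "complex_of_real x powr (z - Complex \<sigma> t - 1) = complex_of_real x powr (- Complex \<sigma> t) * complex_of_real x powr (z - 1)" for t
      by (simp flip: powr_add add: algebra_simps)
    then have "(\<integral>t. K (x, t) \<partial>lborel) = (\<integral>t. (f (Complex \<sigma> t) * complex_of_real x powr (- Complex \<sigma> t)) * complex_of_real x powr (z - 1) \<partial>lborel)"
      using True by (simp add: K_eq mult.assoc)
    also have "\<dots> = (\<integral>t. (f (Complex \<sigma> t) * complex_of_real x powr (- Complex \<sigma> t)) \<partial>lborel) * complex_of_real x powr (z - 1)"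
      by (rule integral_mult_left_zero)
    finally show ?thesis using True by (simp add: inverse_mellin_def)
  qed (simp add: K_def)
  have "integrable lborel (\<lambda>x. \<integral>t. K (x, t) \<partial>lborel)"
    by (rule lborel_pair.integrable_fst'[OF K_int])
  then have "integrable lborel (\<lambda>x. 1 / (2 * of_real pi) * (\<integral>t. K (x, t) \<partial>lborel))"
    by (rule integrable_mult_right)
  then show "set_integrable lborel A (\<lambda>x. inverse_mellin \<sigma> f x * complex_of_real x powr (z - 1))"
    unfolding inner set_integrable_def by simp
  have "(\<integral>x. (\<integral>t. K (x, t) \<partial>lborel) \<partial>lborel) = (\<integral>t. (\<integral>x. K (x, t) \<partial>lborel) \<partial>lborel)"
    using lborel_pair.Fubini_integral[of "\<lambda>x t. K (x, t)"] K_int by simp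
  also have "(\<lambda>t. \<integral>x. K (x, t) \<partial>lborel) = (\<lambda>t. f (Complex \<sigma> t) * J t)"
    unfolding K_eq' integral_mult_right_zero J[symmetric] set_lebesgue_integral_def ..
  finally have "2 * of_real pi * (LINT x:A|lborel. inverse_mellin \<sigma> f x * complex_of_real x powr (z - 1))
    = (\<integral>t. f (Complex \<sigma> t) * J t \<partial>lborel)"
    unfolding inner set_lebesgue_integral_def integral_mult_right_zero .
  then show "(LINT x:A|lborel. inverse_mellin \<sigma> f x * complex_of_real x powr (z - 1))
       = 1 / (2 * of_real pi) * (\<integral>t. f (Complex \<sigma> t) * J t \<partial>lborel)"
    by (simp add: field_simps)
qed

text \<open>
  The integral over \<open>(0, 1)\<close> is computed on a line to the left of \<open>z\<close> and the one over \<open>(1, \<infinity>)\<close>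
  on a line to the right of \<open>z\<close>; Cauchy's formula for the strip between them gives \<open>f z\<close>.
\<close>

lemma mellin_inverse_mellin:
  assumes f: "rapid_decay f"
  shows "set_integrable lborel {0<..} (\<lambda>x. inverse_mellin c f x * complex_of_real x powr (z - 1))"
    and "(LINT x:{0<..}|lborel. inverse_mellin c f x * complex_of_real x powr (z - 1)) = f z"
proof -
  \<comment> \<open>Distance 1 on either side of z makes the real part of z - s equal to 1 on the
    left line and -1 on the right one.\<close>
  define a b where "a = Re z - 1" and "b = Re z + 1"
  define g where "g = (\<lambda>x. inverse_mellin c f x * complex_of_real x powr (z - 1))"
  \<comment> \<open>Independence of the line allows the two pieces of one integral to use different
    abscissae.\<close>
  have ga: "g x = inverse_mellin \<sigma> f x * complex_of_real x powr (z - 1)" if "x > 0" for x \<sigma>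
    unfolding g_def using inverse_mellin_shift[OF f that] by metis
  have L: "set_integrable lborel {0<..<1} (\<lambda>x. inverse_mellin a f x * complex_of_real x powr (z - 1))"
     "(LINT x:{0<..<1}|lborel. inverse_mellin a f x * complex_of_real x powr (z - 1))
       = 1 / (2 * of_real pi) * (\<integral>t. f (Complex a t) * (1 / (z - Complex a t)) \<partial>lborel)"
    using mellin_integral_left(1)[of "z - Complex a 0"]
    by (intro mellin_inverse_mellin_region f mellin_integral_left(2); simp add: a_def)+
  have R: "set_integrable lborel {1<..} (\<lambda>x. inverse_mellin b f x * complex_of_real x powr (z - 1))"
     "(LINT x:{1<..}|lborel. inverse_mellin b f x * complex_of_real x powr (z - 1))
       = 1 / (2 * of_real pi) * (\<integral>t. f (Complex b t) * (- 1 / (z - Complex b t)) \<partial>lborel)"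
    using mellin_integral_right(1)[of "z - Complex b 0"]
    by (intro mellin_inverse_mellin_region f mellin_integral_right(2); simp add: b_def)+
  have gL: "(\<lambda>x. indicat_real {0<..<1} x *\<^sub>R g x) = (\<lambda>x. indicat_real {0<..<1} x *\<^sub>R (inverse_mellin a f x * complex_of_real x powr (z - 1)))"
    by (auto simp: indicator_def ga[of _ a] fun_eq_iff)
  have L': "set_integrable lborel {0<..<1} g" "(LINT x:{0<..<1}|lborel. g x)
      = 1 / (2 * of_real pi) * (\<integral>t. f (Complex a t) * (1 / (z - Complex a t)) \<partial>lborel)"
    using L unfolding set_integrable_def set_lebesgue_integral_def gL .
  have gR: "(\<lambda>x. indicat_real {1<..} x *\<^sub>R g x) = (\<lambda>x. indicat_real {1<..} x *\<^sub>R (inverse_mellin b f x * complex_of_real x powr (z - 1)))"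
    by (auto simp: indicator_def ga[of _ b] fun_eq_iff)
  have R': "set_integrable lborel {1<..} g" "(LINT x:{1<..}|lborel. g x)
      = 1 / (2 * of_real pi) * (\<integral>t. f (Complex b t) * (- 1 / (z - Complex b t)) \<partial>lborel)"
    using R unfolding set_integrable_def set_lebesgue_integral_def gR .
  have M: "set_integrable lborel {1} g" "(LINT x:{1}|lborel. g x) = 0"
  proof -
    have eq: "(\<lambda>x. indicat_real {1} x *\<^sub>R g x) = (\<lambda>x. indicat_real {1} x *\<^sub>R g 1)"
      by (auto simp: indicator_def)
    show "set_integrable lborel {1} g" unfolding set_integrable_def eq
      by (intro integrable_scaleR_left integrable_real_indicator) auto
    show "(LINT x:{1}|lborel. g x) = 0" unfolding set_lebesgue_integral_def eq by simp
  qed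
  have U: "{0<..} = ({0<..<1} \<union> {1}) \<union> {1::real<..}" by auto
  have LM: "set_integrable lborel ({0<..<1} \<union> {1}) g"
    using L'(1) M(1) by (rule set_integrable_Un) auto
  have "set_integrable lborel {0<..} g"
    unfolding U using LM R'(1) by (rule set_integrable_Un) auto
  then show "set_integrable lborel {0<..} (\<lambda>x. inverse_mellin c f x * complex_of_real x powr (z - 1))"
    unfolding g_def .
  have "(LINT x:{0<..}|lborel. g x) = (LINT x:{0<..<1} \<union> {1}|lborel. g x) + (LINT x:{1<..}|lborel. g x)"
    unfolding U by (rule set_integral_Un[OF _ LM R'(1)]) auto
  also have "(LINT x:{0<..<1} \<union> {1}|lborel. g x) = (LINT x:{0<..<1}|lborel. g x) + (LINT x:{1}|lborel. g x)"
    by (rule set_integral_Un[OF _ L'(1) M(1)]) auto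
  also have "\<dots> + (LINT x:{1<..}|lborel. g x)
     = 1 / (2 * of_real pi) * ((\<integral>t. f (Complex b t) / (Complex b t - z) \<partial>lborel) - (\<integral>t. f (Complex a t) / (Complex a t - z) \<partial>lborel))"
  proof -
    have 1: "f (Complex a t) * (1 / (z - Complex a t)) = - (f (Complex a t) / (Complex a t - z))"
      "f (Complex b t) * (- 1 / (z - Complex b t)) = f (Complex b t) / (Complex b t - z)" for t
      by (metis (no_types, lifting) divide_minus_right minus_diff_eq mult.right_neutral times_divide_eq_right,
          metis (no_types, lifting) minus_divide_divide minus_diff_eq minus_minus mult.right_neutral times_divide_eq_right)
    show ?thesis unfolding L'(2) R'(2) M(2) 1 by (simp add: algebra_simps)
  qed
  also have "\<dots> = f z"
    by (subst rapid_decay_Cauchy[OF f]) (auto simp: a_def b_def)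
  finally show "(LINT x:{0<..}|lborel. inverse_mellin c f x * complex_of_real x powr (z - 1)) = f z"
    unfolding g_def .
qed

section \<open>Differentiation under the integral sign\<close>

text \<open>The integrand of \<open>w\<close> carries a power of
  \<open>two_xi s / (s * (s - 1))\<close>, which has poles at 0 and 1 and so is not
  \<open>rapid_decay\<close>. Differentiating in x requires control on the line Re s = \<sigma>
  alone.\<close>

definition line_decay :: "real \<Rightarrow> (complex \<Rightarrow> complex) \<Rightarrow> bool" where
  "line_decay \<sigma> f \<longleftrightarrow> (\<lambda>t. f (Complex \<sigma> t)) \<in> borel_measurable borel \<and>
     (\<forall>n. \<exists>C. \<forall>t. norm (f (Complex \<sigma> t)) * (1 + \<bar>t\<bar>) ^ n \<le> C)"

lemma line_decay_mult_linear:
  assumes f: "line_decay \<sigma> f"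
  shows "line_decay \<sigma> (\<lambda>s. (of_real a - s) * f s)"
  unfolding line_decay_def
proof (intro conjI allI)
  have [measurable]: "(\<lambda>t. f (Complex \<sigma> t)) \<in> borel_measurable borel" using f by (simp add: line_decay_def)
  show "(\<lambda>t. (of_real a - Complex \<sigma> t) * f (Complex \<sigma> t)) \<in> borel_measurable borel" by measurable
  fix n
  obtain C where C: "\<And>t. norm (f (Complex \<sigma> t)) * (1 + \<bar>t\<bar>) ^ (Suc n) \<le> C"
    using f unfolding line_decay_def by blast
  define K where "K = 1 + \<bar>a\<bar> + \<bar>\<sigma>\<bar>"
  have K: "K \<ge> 1" by (simp add: K_def)
  have "norm ((of_real a - Complex \<sigma> t) * f (Complex \<sigma> t)) * (1 + \<bar>t\<bar>) ^ n \<le> K * C" for t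
  proof -
    have "norm (of_real a - Complex \<sigma> t) \<le> \<bar>a - \<sigma>\<bar> + \<bar>t\<bar>"
      using cmod_le[of "of_real a - Complex \<sigma> t"] by simp
    also have "\<dots> \<le> K * (1 + \<bar>t\<bar>)"
    proof -
      have "\<bar>a - \<sigma>\<bar> \<le> K" by (simp add: K_def)
      moreover have "1 * \<bar>t\<bar> \<le> K * \<bar>t\<bar>" using K by (intro mult_right_mono) auto
      ultimately show ?thesis by (simp add: distrib_left)
    qed
    finally have "norm ((of_real a - Complex \<sigma> t) * f (Complex \<sigma> t)) * (1 + \<bar>t\<bar>) ^ n
       \<le> (K * (1 + \<bar>t\<bar>)) * norm (f (Complex \<sigma> t)) * (1 + \<bar>t\<bar>) ^ n"
      unfolding norm_mult by (intro mult_right_mono) auto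
    also have "\<dots> = K * (norm (f (Complex \<sigma> t)) * (1 + \<bar>t\<bar>) ^ Suc n)" by simp
    also have "\<dots> \<le> K * C" using C[of t] K by (intro mult_left_mono) auto
    finally show ?thesis .
  qed
  then show "\<exists>C. \<forall>t. norm ((of_real a - Complex \<sigma> t) * f (Complex \<sigma> t)) * (1 + \<bar>t\<bar>) ^ n \<le> C" by blast
qed

lemma line_decay_integrable:
  assumes f: "line_decay \<sigma> f"
  shows "integrable lborel (\<lambda>t. f (Complex \<sigma> t))"
proof -
  have [measurable]: "(\<lambda>t. f (Complex \<sigma> t)) \<in> borel_measurable borel" using f by (simp add: line_decay_def)
  obtain C where C: "\<And>t. norm (f (Complex \<sigma> t)) * (1 + \<bar>t\<bar>) ^ 2 \<le> C"
    using f unfolding line_decay_def by blast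
  show ?thesis
  proof (rule Bochner_Integration.integrable_bound)
    show "integrable lborel (\<lambda>t::real. C * inverse (1 + t\<^sup>2))"
      by (intro integrable_mult_right integrable_inverse_1_plus_sq)
    have "norm (f (Complex \<sigma> t)) \<le> norm (C * inverse (1 + t\<^sup>2))" for t
    proof -
      have "norm (f (Complex \<sigma> t)) * (1 + t\<^sup>2) \<le> norm (f (Complex \<sigma> t)) * (1 + \<bar>t\<bar>) ^ 2"
        by (intro mult_left_mono) (auto simp: power2_sum)
      also have "\<dots> \<le> \<bar>C\<bar>" using C[of t] by simp
      finally have "norm (f (Complex \<sigma> t)) * (1 + t\<^sup>2) \<le> \<bar>C\<bar>" .
      moreover have p: "1 + t\<^sup>2 > 0" by (intro add_pos_nonneg) auto
      ultimately have "norm (f (Complex \<sigma> t)) \<le> \<bar>C\<bar> * inverse (1 + t\<^sup>2)" by (simp add: field_simps)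
      then show ?thesis using p by (simp add: abs_mult)
    qed
    then show "AE t in lborel. norm (f (Complex \<sigma> t)) \<le> norm (C * inverse (1 + t\<^sup>2))" by simp
  qed measurable
qed

text \<open>The offset a records the power of x: a derivative lowers it by 1 and puts the factor a -
  s into f, multiplication by x^2 raises it by 2.\<close>

definition line_transform :: "real \<Rightarrow> real \<Rightarrow> (complex \<Rightarrow> complex) \<Rightarrow> real \<Rightarrow> complex" where
  "line_transform \<sigma> a f x =
     (\<integral>t. f (Complex \<sigma> t) * complex_of_real x powr (of_real a - Complex \<sigma> t) \<partial>lborel)"

lemma line_decay_integrable_powr:
  assumes f: "line_decay \<sigma> f" and x: "x > 0"
  shows "integrable lborel (\<lambda>t. f (Complex \<sigma> t) * complex_of_real x powr (of_real a - Complex \<sigma> t))"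
proof -
  have [measurable]: "(\<lambda>t. f (Complex \<sigma> t)) \<in> borel_measurable borel" using f by (simp add: line_decay_def)
  show ?thesis
  proof (rule Bochner_Integration.integrable_bound)
    show "integrable lborel (\<lambda>t. x powr (a - \<sigma>) * norm (f (Complex \<sigma> t)))"
      by (intro integrable_mult_right integrable_norm line_decay_integrable f)
    show "(\<lambda>t. f (Complex \<sigma> t) * complex_of_real x powr (of_real a - Complex \<sigma> t)) \<in> borel_measurable lborel"
      unfolding of_real_powr_eq_exp[OF x] by measurable
  qed (use x in \<open>auto simp: norm_mult norm_of_real_powr\<close>)
qed

text \<open>Taylor expansion to second order on the segment from x/2 to 2 x. M adds the end values
  of r^(Re \<alpha> - 2), which bounds the power for either sign of the exponent. It involves only
  Re \<alpha>, so it is constant along a vertical line.\<close>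

lemma powr_Taylor_bound:
  fixes x y :: real and \<alpha> :: complex
  assumes x: "x > 0" and y: "x / 2 \<le> y" "y \<le> 2 * x"
  defines "M \<equiv> (x / 2) powr (Re \<alpha> - 2) + (2 * x) powr (Re \<alpha> - 2)"
  shows "norm (of_real y powr \<alpha> - of_real x powr \<alpha> - of_real (y - x) * (\<alpha> * of_real x powr (\<alpha> - 1)))
     \<le> norm (\<alpha> * (\<alpha> - 1)) * M * (y - x)\<^sup>2"
proof -
  define S where "S = complex_of_real ` {x / 2..2 * x}"
  define F where "F = (\<lambda>i::nat. if i = 0 then (\<lambda>z. z powr \<alpha>) else if i = 1 then (\<lambda>z. \<alpha> * z powr (\<alpha> - 1))
     else (\<lambda>z. \<alpha> * (\<alpha> - 1) * z powr (\<alpha> - 2)))"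
  have S: "z \<notin> \<real>\<^sub>\<le>\<^sub>0" if "z \<in> S" for z
    using that x by (auto simp: S_def complex_nonpos_Reals_iff)
  have "norm (F 0 (of_real y) - (\<Sum>i\<le>1. F i (of_real x) * (of_real y - of_real x) ^ i / fact i))
     \<le> norm (\<alpha> * (\<alpha> - 1)) * M * norm (complex_of_real y - of_real x) ^ Suc 1 / fact 1"
  proof (rule complex_Taylor[of S])
    show "convex S" unfolding S_def
      by (intro convex_linear_image bounded_linear.linear bounded_linear_of_real) simp
    fix i z assume i: "i \<le> (1::nat)" and z: "z \<in> S"
    have "((\<lambda>z. z powr \<alpha>) has_field_derivative (\<alpha> * z powr (\<alpha> - 1))) (at z within S)"
      "((\<lambda>z. \<alpha> * z powr (\<alpha> - 1)) has_field_derivative (\<alpha> * (\<alpha> - 1) * z powr (\<alpha> - 2))) (at z within S)"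
      using S[OF z] by (auto intro!: derivative_eq_intros)
    then show "(F i has_field_derivative F (Suc i) z) (at z within S)"
      using i by (cases i) (auto simp: F_def)
  next
    fix z assume "z \<in> S"
    then obtain r where r: "z = of_real r" "x / 2 \<le> r" "r \<le> 2 * x" by (auto simp: S_def)
    have "r powr (Re \<alpha> - 2) \<le> M"
    proof (cases "Re \<alpha> - 2 \<ge> 0")
      case True
      then have "r powr (Re \<alpha> - 2) \<le> (2 * x) powr (Re \<alpha> - 2)" using r x by (intro powr_mono2) auto
      then show ?thesis by (simp add: M_def add_increasing)
    next
      case False
      then have "r powr (Re \<alpha> - 2) \<le> (x / 2) powr (Re \<alpha> - 2)" using r x by (intro powr_mono2') auto
      then show ?thesis by (simp add: M_def add_increasing2)
    qed
    then have "norm (\<alpha> * (\<alpha> - 1)) * norm (z powr (\<alpha> - 2)) \<le> norm (\<alpha> * (\<alpha> - 1)) * M"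
      using r x by (intro mult_left_mono) (auto simp: norm_of_real_powr)
    then show "norm (F (Suc 1) z) \<le> norm (\<alpha> * (\<alpha> - 1)) * M" by (simp add: F_def norm_mult)
  qed (use x y in \<open>auto simp: S_def\<close>)
  moreover have "F 0 (of_real y) - (\<Sum>i\<le>1. F i (of_real x) * (of_real y - of_real x) ^ i / fact i)
     = of_real y powr \<alpha> - of_real x powr \<alpha> - of_real (y - x) * (\<alpha> * of_real x powr (\<alpha> - 1))"
    by (simp add: F_def algebra_simps)
  moreover have "norm (complex_of_real y - of_real x) ^ Suc 1 = (y - x)\<^sup>2"
    by (simp flip: of_real_diff add: power2_eq_square)
  ultimately show ?thesis by simp
qed

text \<open>The Taylor remainder grows like |\<alpha> (\<alpha> - 1)| along the line, which the
  decay of f absorbs. Integrating it bounds the error of the linear approximation by N M (y -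
  x)^2.\<close>

lemma line_transform_has_vector_derivative:
  assumes f: "line_decay \<sigma> f" and x: "x > 0"
  shows "(line_transform \<sigma> a f has_vector_derivative
           line_transform \<sigma> (a - 1) (\<lambda>s. (of_real a - s) * f s) x) (at x)"
proof -
  define D where "D = line_transform \<sigma> (a - 1) (\<lambda>s. (of_real a - s) * f s) x"
  define M where "M = (x / 2) powr (a - \<sigma> - 2) + (2 * x) powr (a - \<sigma> - 2)"
  define N where "N = (\<integral>t. norm ((of_real (a - 1) - Complex \<sigma> t) * ((of_real a - Complex \<sigma> t) * f (Complex \<sigma> t))) \<partial>lborel)"
  note f1 = line_decay_mult_linear[OF f, of a]
  note f2 = line_decay_mult_linear[OF f1, of "a - 1"]
  have bound: "norm (line_transform \<sigma> a f y - line_transform \<sigma> a f x - (y - x) *\<^sub>R D) \<le> N * M * (y - x)\<^sup>2"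
    if y: "x / 2 \<le> y" "y \<le> 2 * x" for y
  proof -
    have y0: "y > 0" using x y by linarith
    define \<phi> where "\<phi> = (\<lambda>t. let \<alpha> = of_real a - Complex \<sigma> t in
       of_real y powr \<alpha> - of_real x powr \<alpha> - of_real (y - x) * (\<alpha> * of_real x powr (\<alpha> - 1)))"
    have eq: "f (Complex \<sigma> t) * \<phi> t = f (Complex \<sigma> t) * of_real y powr (of_real a - Complex \<sigma> t)
       - f (Complex \<sigma> t) * of_real x powr (of_real a - Complex \<sigma> t)
       - (y - x) *\<^sub>R ((of_real a - Complex \<sigma> t) * f (Complex \<sigma> t) * of_real x powr (of_real (a - 1) - Complex \<sigma> t))" for t
      by (simp add: \<phi>_def Let_def scaleR_conv_of_real algebra_simps)
    note int = line_decay_integrable_powr[OF f y0, of a] line_decay_integrable_powr[OF f x, of a]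
       line_decay_integrable_powr[OF f1 x, of "a - 1"]
    have "line_transform \<sigma> a f y - line_transform \<sigma> a f x - (y - x) *\<^sub>R D = (\<integral>t. f (Complex \<sigma> t) * \<phi> t \<partial>lborel)"
      unfolding line_transform_def D_def eq
      using int by (subst Bochner_Integration.integral_diff Bochner_Integration.integral_scaleR_right; simp)+
    also have "norm \<dots> \<le> (\<integral>t. norm ((of_real (a - 1) - Complex \<sigma> t) * ((of_real a - Complex \<sigma> t) * f (Complex \<sigma> t))) * (M * (y - x)\<^sup>2) \<partial>lborel)"
    proof (rule order_trans[OF integral_norm_bound integral_mono])
      show "integrable lborel (\<lambda>t. norm (f (Complex \<sigma> t) * \<phi> t))"
        unfolding eq using int by (intro integrable_norm Bochner_Integration.integrable_diff integrable_scaleR_right) auto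
      show "integrable lborel (\<lambda>t. norm ((of_real (a - 1) - Complex \<sigma> t) * ((of_real a - Complex \<sigma> t) * f (Complex \<sigma> t))) * (M * (y - x)\<^sup>2))"
        using line_decay_integrable[OF f2] by (intro integrable_mult_left integrable_norm) simp
      fix t
      define \<alpha> where "\<alpha> = of_real a - Complex \<sigma> t"
      have "norm (\<phi> t) \<le> norm (\<alpha> * (\<alpha> - 1)) * M * (y - x)\<^sup>2"
        using powr_Taylor_bound[OF x y, of \<alpha>] by (simp add: \<phi>_def Let_def M_def \<alpha>_def)
      then have "norm (f (Complex \<sigma> t)) * norm (\<phi> t) \<le> norm (f (Complex \<sigma> t)) * (norm (\<alpha> * (\<alpha> - 1)) * M * (y - x)\<^sup>2)"
        by (intro mult_left_mono) auto
      also have "\<dots> = norm ((\<alpha> - 1) * (\<alpha> * f (Complex \<sigma> t))) * (M * (y - x)\<^sup>2)"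
        by (simp add: norm_mult mult_ac)
      also have "\<alpha> - 1 = of_real (a - 1) - Complex \<sigma> t" by (simp add: \<alpha>_def)
      finally show "norm (f (Complex \<sigma> t) * \<phi> t) \<le> norm ((of_real (a - 1) - Complex \<sigma> t) * ((of_real a - Complex \<sigma> t) * f (Complex \<sigma> t))) * (M * (y - x)\<^sup>2)"
        by (simp add: norm_mult \<alpha>_def)
    qed
    also have "\<dots> = N * M * (y - x)\<^sup>2" unfolding N_def by simp
    finally show ?thesis .
  qed
  have "(line_transform \<sigma> a f has_derivative (\<lambda>h. h *\<^sub>R D)) (at x)"
  proof (rule has_derivativeI_sandwich[where e = "x / 2" and H = "\<lambda>y. N * M * \<bar>y - x\<bar>"])
    fix y assume y: "y \<noteq> x" "dist y x < x / 2"
    then have "\<bar>y - x\<bar> < x / 2" by (simp add: dist_real_def)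
    then have "x / 2 \<le> y" "y \<le> 2 * x" using x by linarith+
    then have "norm (line_transform \<sigma> a f y - line_transform \<sigma> a f x - (y - x) *\<^sub>R D) \<le> N * M * (y - x)\<^sup>2"
      by (rule bound)
    also have "\<dots> = N * M * \<bar>y - x\<bar> * \<bar>y - x\<bar>" by (simp add: power2_eq_square)
    finally show "norm (line_transform \<sigma> a f y - line_transform \<sigma> a f x - (y - x) *\<^sub>R D) / norm (y - x) \<le> N * M * \<bar>y - x\<bar>"
      using y by (simp add: divide_le_eq)
  next
    have "((\<lambda>y. N * M * \<bar>y - x\<bar>) \<longlongrightarrow> N * M * \<bar>x - x\<bar>) (at x)" by (intro tendsto_intros)
    then show "((\<lambda>y. N * M * \<bar>y - x\<bar>) \<longlongrightarrow> 0) (at x)" by simp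
  qed (use x in \<open>auto intro: bounded_linear_scaleR_left\<close>)
  then show ?thesis unfolding D_def has_vector_derivative_def .
qed

lemma Dx_line_transform:
  assumes f: "line_decay \<sigma> f" and F: "\<And>x. x > 0 \<Longrightarrow> F x = line_transform \<sigma> a f x" and x: "x > 0"
  shows "Dx F x = line_transform \<sigma> (a - 1) (\<lambda>s. (of_real a - s) * f s) x"
proof -
  have "(F has_vector_derivative line_transform \<sigma> (a - 1) (\<lambda>s. (of_real a - s) * f s) x) (at x)"
    by (rule has_vector_derivative_transform_within_open[OF line_transform_has_vector_derivative[OF f x], of "{0<..}"])
       (use x F in auto)
  then show ?thesis unfolding Dx_def by (rule vector_derivative_at)
qed

lemma mult_sq_line_transform:
  assumes F: "\<And>x. x > 0 \<Longrightarrow> F x = line_transform \<sigma> a f x" and x: "x > 0"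
  shows "mult_sq F x = line_transform \<sigma> (a + 2) f x"
proof -
  have "complex_of_real x powr (of_real (a + 2) - Complex \<sigma> t) = (of_real x)\<^sup>2 * complex_of_real x powr (of_real a - Complex \<sigma> t)" for t
  proof -
    have "complex_of_real x powr (2 + (of_real a - Complex \<sigma> t)) = (of_real x)\<^sup>2 * complex_of_real x powr (of_real a - Complex \<sigma> t)"
      unfolding powr_add using x powr_nat'[of "complex_of_real x" 2] by simp
    moreover have "2 + (of_real a - Complex \<sigma> t) = of_real (a + 2) - Complex \<sigma> t" by simp
    ultimately show ?thesis by (simp only:)
  qed
  then have "line_transform \<sigma> (a + 2) f x = (\<integral>t. (of_real x)\<^sup>2 * (f (Complex \<sigma> t) * complex_of_real x powr (of_real a - Complex \<sigma> t)) \<partial>lborel)"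
    unfolding line_transform_def by (simp add: mult_ac)
  also have "\<dots> = mult_sq F x"
    unfolding mult_sq_def F[OF x] line_transform_def integral_mult_right_zero by (simp add: scaleR_conv_of_real)
  finally show ?thesis ..
qed

text \<open>The initial derivative contributes -s, each of the k - 1 blocks (1 - s) (-s), and the
  last derivative 1 - s: in all (s (s - 1))^k. The offset is -1 before each block and runs through
  1, 0, -1 within it; the final multiplication and derivative return it to 0.\<close>

lemma D_op_line_transform:
  assumes f: "line_decay \<sigma> f" and F: "\<And>x. x > 0 \<Longrightarrow> F x = line_transform \<sigma> 0 f x"
    and k: "k \<ge> 1" and x: "x > 0"
  shows "D_op k F x = line_transform \<sigma> 0 (\<lambda>s. (s * (s - 1)) ^ k * f s) x"
proof -
  define f1 where "f1 = (\<lambda>s. (of_real 0 - s) * f s)"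
  define step where "step = (\<lambda>g :: complex \<Rightarrow> complex. \<lambda>s. (of_real 0 - s) * ((of_real 1 - s) * g s))"
  have f1: "line_decay \<sigma> f1" unfolding f1_def by (rule line_decay_mult_linear[OF f])
  have F1: "Dx F x = line_transform \<sigma> (0 - 1) f1 x" if "x > 0" for x
    unfolding f1_def by (rule Dx_line_transform[OF f F that])
  have it: "line_decay \<sigma> ((step ^^ m) f1) \<and>
    (\<forall>x>0. ((\<lambda>g. Dx (Dx (mult_sq g))) ^^ m) (Dx F) x = line_transform \<sigma> (0 - 1) ((step ^^ m) f1) x)" for m
  proof (induction m)
    case 0
    then show ?case using f1 F1 by simp
  next
    case (Suc m)
    define g where "g = (step ^^ m) f1"
    define G where "G = ((\<lambda>g. Dx (Dx (mult_sq g))) ^^ m) (Dx F)"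
    have g: "line_decay \<sigma> g" and G: "\<And>x. x > 0 \<Longrightarrow> G x = line_transform \<sigma> (0 - 1) g x"
      using Suc.IH by (auto simp: g_def G_def)
    have G1: "mult_sq G x = line_transform \<sigma> 1 g x" if "x > 0" for x
      using mult_sq_line_transform[OF G that] by simp
    have g2: "line_decay \<sigma> (\<lambda>s. (of_real 1 - s) * g s)" by (rule line_decay_mult_linear[OF g])
    have G2: "Dx (mult_sq G) x = line_transform \<sigma> 0 (\<lambda>s. (of_real 1 - s) * g s) x" if "x > 0" for x
      using Dx_line_transform[OF g G1 that] by simp
    have G3: "Dx (Dx (mult_sq G)) x = line_transform \<sigma> (0 - 1) (step g) x" if "x > 0" for x
      unfolding step_def by (rule Dx_line_transform[OF g2 G2 that])
    have "line_decay \<sigma> (step g)" unfolding step_def by (rule line_decay_mult_linear[OF g2])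
    then show ?case using G3 by (simp add: g_def G_def)
  qed
  have step_pow: "(step ^^ m) f1 s = (s * (s - 1)) ^ m * (- s * f s)" for m and s :: complex
  proof (induction m)
    case 0
    then show ?case by (simp add: f1_def)
  next
    case (Suc m)
    have "(step ^^ Suc m) f1 s = (of_real 0 - s) * ((of_real 1 - s) * ((step ^^ m) f1 s))"
      by (simp add: step_def)
    also have "\<dots> = (s * (s - 1)) * ((s * (s - 1)) ^ m * (- s * f s))"
      unfolding Suc.IH by (simp only: mult.assoc[symmetric]) (simp add: algebra_simps)
    finally show ?case by (simp add: mult.assoc)
  qed
  define g where "g = (step ^^ (k - 1)) f1"
  define G where "G = ((\<lambda>g. Dx (Dx (mult_sq g))) ^^ (k - 1)) (Dx F)"
  have g: "line_decay \<sigma> g" and G: "\<And>x. x > 0 \<Longrightarrow> G x = line_transform \<sigma> (0 - 1) g x"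
    using it[of "k - 1"] by (auto simp: g_def G_def)
  have G1: "mult_sq G x = line_transform \<sigma> 1 g x" if "x > 0" for x
    using mult_sq_line_transform[OF G that] by simp
  have "D_op k F x = Dx (mult_sq G) x" by (simp add: D_op_def G_def)
  also have "\<dots> = line_transform \<sigma> 0 (\<lambda>s. (of_real 1 - s) * g s) x"
    using Dx_line_transform[OF g G1 x] by simp
  also have "(\<lambda>s. (of_real 1 - s) * g s) = (\<lambda>s. (s * (s - 1)) ^ k * f s)"
  proof
    fix s :: complex
    obtain m where m: "k = Suc m" using k by (cases k) auto
    define P where "P = (s * (s - 1)) ^ m"
    have "(of_real 1 - s) * g s = (of_real 1 - s) * (P * (- s * f s))"
      by (simp add: g_def step_pow m P_def)
    also have "\<dots> = (s * (s - 1)) * P * f s" by (simp add: algebra_simps)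
    finally show "(of_real 1 - s) * g s = (s * (s - 1)) ^ k * f s"
      by (simp add: m P_def)
  qed
  finally show ?thesis .
qed

text \<open>The integrand of \<open>w\<close> contains the k-th power of 2 xi(s) / (s (s - 1)), and
  \<open>D_op k\<close> multiplies by (s (s - 1))^k, which cancels the denominators.\<close>

lemma v_eq_inverse_mellin:
  assumes k: "k \<ge> 1" and c: "c > 1" and x: "x > 0"
  shows "v k c x = inverse_mellin c (\<lambda>s. two_xi s ^ k) x"
proof -
  define f where "f = (\<lambda>s. 1 / (2 * of_real pi) * (two_xi s / (s * (s - 1))) ^ k)"
  define q where "q = (\<lambda>t. Complex c t * (Complex c t - 1))"
  \<comment> \<open>Since c > 1 the denominator stays away from 0 on the line, so dividing by it
    preserves the decay.\<close>
  have q: "norm (q t) \<ge> c * (c - 1)" for t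
    unfolding q_def norm_mult using abs_Re_le_cmod[of "Complex c t"] abs_Re_le_cmod[of "Complex c t - 1"] c
    by (intro mult_mono) auto
  have cc: "c * (c - 1) > 0" using c by simp
  have q0: "q t \<noteq> 0" for t using q[of t] cc by auto
  note rk = rapid_decay_two_xi_power[OF k]
  note [measurable] = rapid_decay_measurable[OF rapid_decay_two_xi]
  have f: "line_decay c f"
    unfolding line_decay_def
  proof (intro conjI allI)
    show "(\<lambda>t. f (Complex c t)) \<in> borel_measurable borel" unfolding f_def by measurable
    fix n
    obtain C where C: "\<And>s. c \<le> Re s \<and> Re s \<le> c \<Longrightarrow> norm (two_xi s ^ k) * (1 + \<bar>Im s\<bar>) ^ n \<le> C"
      using rk unfolding rapid_decay_def by meson
    have "norm (f (Complex c t)) * (1 + \<bar>t\<bar>) ^ n \<le> 1 / (2 * pi) * (C / (c * (c - 1)) ^ k)" for t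
    proof -
      have "norm (f (Complex c t)) * (1 + \<bar>t\<bar>) ^ n
          = 1 / (2 * pi) * ((norm (two_xi (Complex c t) ^ k) * (1 + \<bar>t\<bar>) ^ n) / norm (q t) ^ k)"
        by (simp add: f_def q_def norm_mult norm_divide norm_power power_divide)
      also have "\<dots> \<le> 1 / (2 * pi) * (C / (c * (c - 1)) ^ k)"
        using C[of "Complex c t"] q cc by (intro mult_left_mono frac_le power_mono zero_less_power)
          (auto intro: order_trans[OF _ C[of "Complex c t"]])
      finally show ?thesis .
    qed
    then show "\<exists>C. \<forall>t. norm (f (Complex c t)) * (1 + \<bar>t\<bar>) ^ n \<le> C" by blast
  qed
  have compl: "Gamma (Complex c t / 2) * zeta (Complex c t) * complex_of_real pi powr (- Complex c t / 2)
      = two_xi (Complex c t) / (Complex c t * (Complex c t - 1))" for t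
  proof -
    have "Complex c t / 2 \<notin> \<int>\<^sub>\<le>\<^sub>0"
    proof
      assume "Complex c t / 2 \<in> \<int>\<^sub>\<le>\<^sub>0"
      then obtain n where n: "Complex c t / 2 = of_int n" "n \<le> 0" by (auto elim: nonpos_Ints_cases)
      then have "Re (Complex c t / 2) \<le> 0" by simp
      then show False using c by simp
    qed
    moreover have "Complex c t \<noteq> 1" using c by (auto simp: complex_eq_iff)
    ultimately show ?thesis using completed_zeta_eq[of "Complex c t"] q0[of t] by (simp add: q_def field_simps)
  qed
  \<comment> \<open>The i from ds = i dt cancels that of 1/(2 pi i); the remaining 1/(2 pi) is part
    of \<open>f\<close>.\<close>
  have wF: "w k c x = line_transform c 0 f x" for x
  proof -
    have "(\<integral>t. (two_xi (Complex c t) / (Complex c t * (Complex c t - 1))) ^ k * complex_of_real x powr (- Complex c t) * \<i> \<partial>lborel)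
      = (\<integral>t. (2 * of_real pi * \<i>) * (f (Complex c t) * complex_of_real x powr (of_real 0 - Complex c t)) \<partial>lborel)"
      by (rule Bochner_Integration.integral_cong) (auto simp: f_def)
    also have "\<dots> = (2 * of_real pi * \<i>) * line_transform c 0 f x"
      unfolding line_transform_def by (rule integral_mult_right_zero)
    finally show ?thesis
      unfolding w_def vertical_line_integral_def compl by simp
  qed
  have "v k c x = line_transform c 0 (\<lambda>s. (s * (s - 1)) ^ k * f s) x"
    unfolding v_def by (rule D_op_line_transform[OF f wF k x])
  also have "\<dots> = (\<integral>t. 1 / (2 * of_real pi) * (two_xi (Complex c t) ^ k * complex_of_real x powr (- Complex c t)) \<partial>lborel)"
    unfolding line_transform_def
  proof (rule Bochner_Integration.integral_cong)
    fix t
    have "(Complex c t * (Complex c t - 1)) ^ k * (two_xi (Complex c t) / (Complex c t * (Complex c t - 1))) ^ k = two_xi (Complex c t) ^ k"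
      using q0[of t] by (simp add: q_def power_divide)
    then show "(Complex c t * (Complex c t - 1)) ^ k * f (Complex c t) * complex_of_real x powr (of_real 0 - Complex c t)
      = 1 / (2 * of_real pi) * (two_xi (Complex c t) ^ k * complex_of_real x powr (- Complex c t))"
      unfolding f_def by (simp add: mult_ac)
  qed simp
  also have "\<dots> = inverse_mellin c (\<lambda>s. two_xi s ^ k) x"
    unfolding inverse_mellin_def by (rule integral_mult_right_zero)
  finally show ?thesis .
qed

section \<open>The random variable\<close>

lemma integral_reflect:
  fixes f :: "real \<Rightarrow> complex"
  shows "(\<integral>t. f (- t) \<partial>lborel) = (\<integral>t. f t \<partial>lborel)"
  using lborel_integral_real_affine[of "-1" f 0] by simp

text \<open>Conjugation turns the integrand at t into the integrand at -t, so the integral is its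
  own conjugate.\<close>

lemma inverse_mellin_real:
  assumes f: "\<And>s. cnj (f s) = f (cnj s)" and x: "x > 0"
  shows "inverse_mellin c f x \<in> \<real>"
proof -
  define h where "h = (\<lambda>t. f (Complex c t) * complex_of_real x powr (- Complex c t))"
  have cnj_h: "cnj (h t) = h (- t)" for t
  proof -
    have "cnj (complex_of_real x powr (- Complex c t)) = complex_of_real x powr (- Complex c (- t))"
      using x by (subst cnj_powr) (auto simp: complex_cnj)
    then show ?thesis by (simp add: h_def f complex_cnj)
  qed
  have "cnj (\<integral>t. h t \<partial>lborel) = (\<integral>t. h (- t) \<partial>lborel)"
    unfolding cnj_h[symmetric] by (rule Bochner_Integration.integral_cnj[symmetric])
  also have "\<dots> = (\<integral>t. h t \<partial>lborel)" by (rule integral_reflect)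
  finally have "(\<integral>t. h t \<partial>lborel) \<in> \<real>" by (simp only: Reals_cnj_iff)
  moreover have "1 / (2 * of_real pi) = complex_of_real (1 / (2 * pi))" by simp
  ultimately show ?thesis unfolding inverse_mellin_def h_def by (metis Reals_mult Reals_of_real)
qed

text \<open>The integral is moved to the line Re s = 1 - c, where s = 1 - (c - i t). There f(s) =
  f(c - i t) and x^(-s) = (1/x) x^(c - i t), and t -> -t gives the integral at 1/x.\<close>

lemma inverse_mellin_reflection:
  assumes rf: "rapid_decay f" and f: "\<And>s. f (1 - s) = f s" and x: "x > 0"
  shows "inverse_mellin c f x = 1 / of_real x * inverse_mellin c f (1 / x)"
proof -
  define h where "h = (\<lambda>t. f (Complex c t) * complex_of_real (1 / x) powr (- Complex c t))"
  have eq: "f (Complex (1 - c) t) * complex_of_real x powr (- Complex (1 - c) t) = 1 / of_real x * h (- t)" for t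
  proof -
    have "Complex (1 - c) t = 1 - Complex c (- t)" by (simp add: complex_eq_iff)
    then have "f (Complex (1 - c) t) = f (Complex c (- t))" by (simp add: f)
    moreover have "complex_of_real (1 / x) powr (- Complex c (- t)) = complex_of_real x powr (Complex c (- t))"
      using x by (subst (1 2) of_real_powr_eq_exp) (auto simp: ln_div)
    moreover have "- Complex (1 - c) t = Complex c (- t) - 1" by (simp add: complex_eq_iff)
    moreover have "complex_of_real x powr (Complex c (- t) - 1) = complex_of_real x powr Complex c (- t) / of_real x"
      using x by (simp add: powr_diff)
    ultimately show ?thesis by (simp add: h_def)
  qed
  have "inverse_mellin c f x = inverse_mellin (1 - c) f x"
    by (rule inverse_mellin_shift[OF rf x])
  also have "\<dots> = 1 / (2 * of_real pi) * (\<integral>t. 1 / of_real x * h (- t) \<partial>lborel)"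
    unfolding inverse_mellin_def eq ..
  also have "(\<integral>t. 1 / of_real x * h (- t) \<partial>lborel) = 1 / of_real x * (\<integral>t. h t \<partial>lborel)"
    unfolding integral_mult_right_zero integral_reflect ..
  finally show ?thesis by (simp add: inverse_mellin_def h_def)
qed

lemma v_real:
  assumes "k \<ge> 1" "c > 1" "x > 0"
  shows "v k c x \<in> \<real>"
  unfolding v_eq_inverse_mellin[OF assms]
  by (rule inverse_mellin_real) (use assms in \<open>auto simp: cnj_two_xi\<close>)

lemma v_reflection:
  assumes "k \<ge> 1" "c > 1" "x > 0"
  shows "v k c x = 1 / of_real x * v k c (1 / x)"
proof -
  have "v k c (1 / x) = inverse_mellin c (\<lambda>s. two_xi s ^ k) (1 / x)"
    by (rule v_eq_inverse_mellin) (use assms in auto)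
  then show ?thesis unfolding v_eq_inverse_mellin[OF assms] using assms
    by (simp only:) (rule inverse_mellin_reflection, auto intro: rapid_decay_two_xi_power simp: two_xi_reflection)
qed

text \<open>Dividing v by x turns x^s into the Mellin kernel x^(s-1). The real part in
  \<open>density_X\<close> loses nothing, as v is real on the half line.\<close>

lemma density_X_moment:
  assumes k: "k \<ge> 1" and c: "c > 1"
  shows "has_bochner_integral lborel (\<lambda>x. of_real (density_X k c x) * complex_of_real x powr s) (two_xi s ^ k)"
proof -
  note rk = rapid_decay_two_xi_power[OF k]
  have eq: "of_real (density_X k c x) * complex_of_real x powr s
    = indicat_real {0<..} x *\<^sub>R (inverse_mellin c (\<lambda>s. two_xi s ^ k) x * complex_of_real x powr (s - 1))" for x
  proof (cases "x > 0")
    case True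
    have "complex_of_real (Re (v k c x)) = v k c x" using v_real[OF k c True] by (simp add: of_real_Re)
    moreover have "complex_of_real x powr s = complex_of_real x powr (s - 1) * of_real x"
      using True by (simp add: powr_diff)
    ultimately show ?thesis using True v_eq_inverse_mellin[OF k c True]
      by (simp add: density_X_def field_simps)
  qed (simp add: density_X_def)
  show ?thesis
    using mellin_inverse_mellin[OF rk, of c s]
    unfolding eq has_bochner_integral_iff set_integrable_def set_lebesgue_integral_def by simp
qed

lemma density_X_integral:
  assumes k: "k \<ge> 1" and c: "c > 1"
  shows "has_bochner_integral lborel (density_X k c) 1"
proof -
  \<comment> \<open>The convention \<open>0 powr 0 = 0\<close> does no harm because the density
    vanishes at 0.\<close>
  have "of_real (density_X k c x) * complex_of_real x powr 0 = of_real (density_X k c x)" for x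
    by (simp add: density_X_def)
  then have "has_bochner_integral lborel (\<lambda>x. complex_of_real (density_X k c x)) 1"
    using density_X_moment[OF k c, of 0] by (simp only: two_xi_0 power_one)
  from has_bochner_integral_bounded_linear[OF bounded_linear_Re this] show ?thesis by simp
qed

text \<open>
  Coercion to \<open>ennreal\<close> truncates, so the distribution of \<open>X\<close> has density \<open>max 0 g\<close>; as both this
  function and \<open>g\<close> have integral \<open>1\<close>, they agree almost everywhere.
\<close>

lemma AE_nonneg_if_density_integral_1:
  fixes g :: "real \<Rightarrow> real"
  assumes "prob_space M" and X: "distributed M lborel X (\<lambda>x. ennreal (g x))"
    and g: "has_bochner_integral lborel g 1"
  shows "AE x in lborel. g x \<ge> 0"
proof -
  interpret prob_space M by fact
  have int: "integrable lborel g" using g by (simp add: has_bochner_integral_iff)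
  then have [measurable]: "g \<in> borel_measurable borel" by simp
  have "(\<integral>\<^sup>+x. ennreal (g x) \<partial>lborel) = (\<integral>\<^sup>+x. 1 \<partial>M)"
    using distributed_nn_integral[OF X, of "\<lambda>_. 1"] by simp
  then have 1: "(\<integral>\<^sup>+x. ennreal (g x) \<partial>lborel) = 1" by (simp add: emeasure_space_1)
  have fin: "(\<integral>\<^sup>+x. ennreal (- g x) \<partial>lborel) \<noteq> \<infinity>"
    using int unfolding real_integrable_def by auto
  have "1 = enn2real 1 - enn2real (\<integral>\<^sup>+x. ennreal (- g x) \<partial>lborel)"
    using g real_lebesgue_integral_def[OF int] unfolding 1 has_bochner_integral_iff by simp
  then have "(\<integral>\<^sup>+x. ennreal (- g x) \<partial>lborel) = 0"
    using fin by (simp add: enn2real_eq_0_iff top_unique)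
  then have "AE x in lborel. ennreal (- g x) = 0"
    by (subst (asm) nn_integral_0_iff_AE) auto
  then show ?thesis by eventually_elim (simp add: ennreal_eq_0_iff)
qed

section \<open>Expectations as integrals against the density\<close>

lemma distributed_expectation:
  fixes \<phi> :: "real \<Rightarrow> 'b :: {banach, second_countable_topology}"
  assumes X: "distributed M lborel X (\<lambda>x. ennreal (g x))" and pos: "AE x in lborel. g x \<ge> 0"
    and [measurable]: "g \<in> borel_measurable borel" "\<phi> \<in> borel_measurable borel"
  shows "integrable M (\<lambda>\<omega>. \<phi> (X \<omega>)) \<longleftrightarrow> integrable lborel (\<lambda>x. g x *\<^sub>R \<phi> x)"
    and "(\<integral>\<omega>. \<phi> (X \<omega>) \<partial>M) = (\<integral>x. g x *\<^sub>R \<phi> x \<partial>lborel)"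
proof -
  have [measurable]: "X \<in> borel_measurable M" using distributed_measurable[OF X] by simp
  have eq: "distr M lborel X = density lborel (\<lambda>x. ennreal (g x))"
    using X by (simp add: distributed_def)
  have "integrable M (\<lambda>\<omega>. \<phi> (X \<omega>)) \<longleftrightarrow> integrable (distr M lborel X) \<phi>"
    by (subst integrable_distr_eq) auto
  then show "integrable M (\<lambda>\<omega>. \<phi> (X \<omega>)) \<longleftrightarrow> integrable lborel (\<lambda>x. g x *\<^sub>R \<phi> x)"
    unfolding eq using pos by (subst (asm) integrable_density) auto
  have "(\<integral>\<omega>. \<phi> (X \<omega>) \<partial>M) = integral\<^sup>L (distr M lborel X) \<phi>"
    by (subst integral_distr) auto
  then show "(\<integral>\<omega>. \<phi> (X \<omega>) \<partial>M) = (\<integral>x. g x *\<^sub>R \<phi> x \<partial>lborel)"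
    unfolding eq using pos by (subst (asm) integral_density) auto
qed

text \<open>One factor x comes from v(1/x) = x v(x), one from dividing by 1/x, and one from writing
  v(x) as x times the density.\<close>

lemma density_X_reflection:
  assumes "k \<ge> 1" "c > 1" "x > 0"
  shows "density_X k c (1 / x) = x ^ 3 * density_X k c x"
proof -
  have "v k c x = 1 / of_real x * v k c (1 / x)" by (rule v_reflection[OF assms])
  then have "v k c (1 / x) = of_real x * v k c x" using assms by simp
  then have "Re (v k c (1 / x)) = x * Re (v k c x)" by simp
  then show ?thesis using assms by (simp add: density_X_def power3_eq_cube)
qed

text \<open>Change of variables under the involution x -> 1/x of the half line, whose Jacobian has
  modulus 1/x^2.\<close>

lemma integral_inverse_substitution:
  fixes h :: "real \<Rightarrow> real"
  assumes [measurable]: "h \<in> borel_measurable borel"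
    and h: "set_integrable lborel {0<..} h"
    and h': "set_integrable lborel {0<..} (\<lambda>x. h (1 / x) / x\<^sup>2)"
  shows "(LINT x:{0<..}|lborel. h (1 / x) / x\<^sup>2) = (LINT x:{0<..}|lborel. h x)"
proof -
  \<comment> \<open>The change of variables theorem is about the completed measure, to which Borel
    integrability transfers.\<close>
  have leb: "set_integrable lborel {0<..} f \<Longrightarrow> f absolutely_integrable_on {0<..}" for f :: "real \<Rightarrow> real"
    unfolding set_integrable_def by (rule integrable_completion[THEN iffD2]) auto
  have img: "(\<lambda>x::real. 1 / x) ` {0<..} = {0<..}"
    by (auto simp: image_iff intro!: bexI[of _ "1 / _"])
  have "(\<lambda>x. \<bar>- 1 / x\<^sup>2\<bar> * h (1 / x)) absolutely_integrable_on {0<..} \<and>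
      integral {0<..} (\<lambda>x. \<bar>- 1 / x\<^sup>2\<bar> * h (1 / x)) = integral {0<..} h
    \<longleftrightarrow> h absolutely_integrable_on ((\<lambda>x. 1 / x) ` {0<..}) \<and> integral ((\<lambda>x. 1 / x) ` {0<..}) h = integral {0<..} h"
  proof (rule has_absolute_integral_change_of_variables_1'[where g = "\<lambda>x. 1 / x" and g' = "\<lambda>x. - 1 / x\<^sup>2"])
    show "inj_on (\<lambda>x::real. 1 / x) {0<..}" by (auto simp: inj_on_def)
    fix x :: real assume "x \<in> {0<..}"
    then show "((\<lambda>x. 1 / x) has_field_derivative - 1 / x\<^sup>2) (at x within {0<..})"
      by (auto intro!: derivative_eq_intros simp: power2_eq_square)
  qed simp
  then have "integral {0<..} (\<lambda>x. \<bar>- 1 / x\<^sup>2\<bar> * h (1 / x)) = integral {0<..} h"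
    unfolding img using leb[OF h] by blast
  then have "integral {0<..} (\<lambda>x. h (1 / x) / x\<^sup>2) = integral {0<..} h" by simp
  then show ?thesis
    using set_borel_integral_eq_integral(2)[OF h] set_borel_integral_eq_integral(2)[OF h'] by simp
qed

text \<open>P(1/X in A) is the integral of the indicator of A at 1/x against the density g. With h
  the indicator of A times x g, the reflection of g makes this integrand h(1/x)/x^2, so the
  substitution returns the integral of x g over A.\<close>

lemma distributed_inverse:
  assumes k: "k \<ge> 1" and c: "c > 1" and "prob_space M" and Xpos: "\<And>\<omega>. \<omega> \<in> space M \<Longrightarrow> X \<omega> > 0"
    and X: "distributed M lborel X (\<lambda>x. ennreal (density_X k c x))"
  shows "distributed M lborel (\<lambda>\<omega>. 1 / X \<omega>) (\<lambda>x. ennreal (x * density_X k c x))"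
proof -
  interpret prob_space M by fact
  define g where "g = density_X k c"
  note X = X[folded g_def]
  have g: "has_bochner_integral lborel g 1" unfolding g_def by (rule density_X_integral[OF k c])
  then have gi: "integrable lborel g" by (simp add: has_bochner_integral_iff)
  then have [measurable]: "g \<in> borel_measurable borel" by simp
  have [measurable]: "X \<in> borel_measurable M" using distributed_measurable[OF X] by simp
  have pos: "AE x in lborel. g x \<ge> 0" by (rule AE_nonneg_if_density_integral_1[OF \<open>prob_space M\<close> X g])
  have g0: "g x = 0" if "x \<le> 0" for x using that by (simp add: g_def density_X_def)
  have xg: "integrable lborel (\<lambda>x. x * g x)"
  proof -
    have "integrable lborel (\<lambda>x. of_real (g x) * complex_of_real x powr 1)"
      using density_X_moment[OF k c, of 1] unfolding g_def has_bochner_integral_iff by blast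
    then have "integrable lborel (\<lambda>x. Re (of_real (g x) * complex_of_real x powr 1))" by (rule integrable_Re)
    moreover have "Re (of_real (g x) * complex_of_real x powr 1) = x * g x" for x
      by (cases "x = 0") (auto simp: mult.commute)
    ultimately show ?thesis by (simp only:)
  qed
  \<comment> \<open>On the negative half line g is 0, so the sign of x is harmless there.\<close>
  have pos': "AE x in lborel. x * g x \<ge> 0"
    using pos by eventually_elim (metis g0 linorder_le_cases mult_nonneg_nonneg mult_zero_right)
  have "distr M lborel (\<lambda>\<omega>. 1 / X \<omega>) = density lborel (\<lambda>x. ennreal (x * g x))"
  proof (rule measure_eqI)
    fix A assume "A \<in> sets (distr M lborel (\<lambda>\<omega>. 1 / X \<omega>))"
    then have [measurable]: "A \<in> sets borel" by simp
    define h where "h = (\<lambda>x. indicat_real A x * (x * g x))"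
    have h_int: "integrable lborel h" unfolding h_def
      using integrable_mult_indicator[of A lborel, OF _ xg] by simp
    have hg: "h (1 / x) / x\<^sup>2 = indicat_real A (1 / x) * g x" if "x > 0" for x
      using density_X_reflection[OF k c that] that
      by (simp add: h_def g_def power3_eq_cube power2_eq_square)
    have ptw: "indicat_real {0<..} x *\<^sub>R (h (1 / x) / x\<^sup>2) = indicat_real A (1 / x) * g x" for x
    proof (cases "x > 0")
      case True
      then have "indicat_real {0<..} x = 1" by simp
      then show ?thesis using hg[OF True] by (simp only: scaleR_one)
    qed (simp add: g0)
    have AI: "integrable lborel (\<lambda>x. indicat_real A (1 / x) * g x)"
      by (rule Bochner_Integration.integrable_bound[OF gi]) (auto simp: indicator_def)
    have "set_integrable lborel {0<..} (\<lambda>x. h (1 / x) / x\<^sup>2)"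
      unfolding set_integrable_def ptw by (rule AI)
    moreover have "set_integrable lborel {0<..} h"
      unfolding set_integrable_def by (rule integrable_mult_indicator[OF _ h_int]) simp
    moreover have "h \<in> borel_measurable borel" unfolding h_def by measurable
    ultimately have sub: "(LINT x:{0<..}|lborel. h (1 / x) / x\<^sup>2) = (LINT x:{0<..}|lborel. h x)"
      by (intro integral_inverse_substitution)
    have "emeasure (distr M lborel (\<lambda>\<omega>. 1 / X \<omega>)) A = emeasure M {\<omega> \<in> space M. 1 / X \<omega> \<in> A}"
      by (subst emeasure_distr) (auto intro!: arg_cong2[where f = emeasure])
    also have "\<dots> = ennreal (\<integral>\<omega>. indicat_real A (1 / X \<omega>) \<partial>M)"
    proof -
      have "(\<integral>\<omega>. indicat_real A (1 / X \<omega>) \<partial>M) = (\<integral>\<omega>. indicat_real {\<omega> \<in> space M. 1 / X \<omega> \<in> A} \<omega> \<partial>M)"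
        by (rule Bochner_Integration.integral_cong) (auto simp: indicator_def)
      also have "\<dots> = prob {\<omega> \<in> space M. 1 / X \<omega> \<in> A}" by simp
      finally show ?thesis by (simp add: emeasure_eq_measure)
    qed
    also have "(\<integral>\<omega>. indicat_real A (1 / X \<omega>) \<partial>M) = (\<integral>x. g x *\<^sub>R indicat_real A (1 / x) \<partial>lborel)"
      by (rule distributed_expectation(2)[OF X pos]) measurable
    also have "\<dots> = (LINT x:{0<..}|lborel. h (1 / x) / x\<^sup>2)"
      unfolding set_lebesgue_integral_def ptw by (simp add: mult.commute)
    also have "\<dots> = (LINT x:{0<..}|lborel. h x)" by (rule sub)
    also have "\<dots> = (\<integral>x. h x \<partial>lborel)"
      unfolding set_lebesgue_integral_def
      by (rule Bochner_Integration.integral_cong) (auto simp: indicator_def h_def g0)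
    also have "ennreal \<dots> = (\<integral>\<^sup>+x. ennreal (h x) \<partial>lborel)"
      using pos' by (intro nn_integral_eq_integral[symmetric] h_int) (auto simp: h_def indicator_def elim!: eventually_mono)
    also have "\<dots> = (\<integral>\<^sup>+x. ennreal (x * g x) * indicator A x \<partial>lborel)"
      by (intro nn_integral_cong) (auto simp: h_def indicator_def)
    also have "\<dots> = emeasure (density lborel (\<lambda>x. ennreal (x * g x))) A"
      by (subst emeasure_density) auto
    finally show "emeasure (distr M lborel (\<lambda>\<omega>. 1 / X \<omega>)) A = emeasure (density lborel (\<lambda>x. ennreal (x * g x))) A" .
  qed simp
  then show ?thesis unfolding distributed_def g_def[symmetric] by simp
qed

lemma random_variable_moments:
  assumes k: "k \<ge> 1" and c: "c > 1" and M: "prob_space M" and Xpos: "\<And>\<omega>. \<omega> \<in> space M \<Longrightarrow> X \<omega> > 0"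
    and X: "distributed M lborel X (\<lambda>x. ennreal (density_X k c x))"
  shows "integrable M (\<lambda>\<omega>. complex_of_real (X \<omega>) powr s)"
    and "(\<integral>\<omega>. complex_of_real (X \<omega>) powr s \<partial>M) = two_xi s ^ k"
proof -
  define g where "g = density_X k c"
  \<comment> \<open>A Borel function on the whole line that equals x^s for x > 0, and X takes only
    such values.\<close>
  define \<phi> where "\<phi> = (\<lambda>x. indicat_real {0<..} x *\<^sub>R exp (s * complex_of_real (ln x)))"
  note X = X[folded g_def]
  have g: "has_bochner_integral lborel g 1" unfolding g_def by (rule density_X_integral[OF k c])
  then have "integrable lborel g" by (simp add: has_bochner_integral_iff)
  then have [measurable]: "g \<in> borel_measurable borel" by simp
  have pos: "AE x in lborel. g x \<ge> 0" by (rule AE_nonneg_if_density_integral_1[OF M X g])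
  have [measurable]: "\<phi> \<in> borel_measurable borel" unfolding \<phi>_def by measurable
  have eq: "g x *\<^sub>R \<phi> x = of_real (g x) * complex_of_real x powr s" for x
    by (cases "x > 0") (auto simp: \<phi>_def g_def density_X_def of_real_powr_eq_exp scaleR_conv_of_real)
  have eqM: "\<phi> (X \<omega>) = complex_of_real (X \<omega>) powr s" if "\<omega> \<in> space M" for \<omega>
    using Xpos[OF that] by (simp add: \<phi>_def of_real_powr_eq_exp)
  note m = density_X_moment[OF k c, of s, folded g_def, unfolded has_bochner_integral_iff]
  have "integrable M (\<lambda>\<omega>. \<phi> (X \<omega>))"
    using m by (subst distributed_expectation(1)[OF X pos]) (auto simp: eq)
  then show "integrable M (\<lambda>\<omega>. complex_of_real (X \<omega>) powr s)"
    by (subst Bochner_Integration.integrable_cong[OF refl eqM[symmetric]])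
  have "(\<integral>\<omega>. complex_of_real (X \<omega>) powr s \<partial>M) = (\<integral>\<omega>. \<phi> (X \<omega>) \<partial>M)"
    by (rule Bochner_Integration.integral_cong) (auto simp: eqM)
  also have "\<dots> = two_xi s ^ k"
    using m by (subst distributed_expectation(2)[OF X pos]) (auto simp: eq)
  finally show "(\<integral>\<omega>. complex_of_real (X \<omega>) powr s \<partial>M) = two_xi s ^ k" .
qed

text \<open>Both expectations equal the integral of x g(x) f(x) over the half line: the first
  through the law of X, with x moved to the density, the second through the law of 1/X, whose
  density is x g.\<close>

lemma expectation_size_bias:
  fixes f :: "real \<Rightarrow> complex"
  assumes k: "k \<ge> 1" and c: "c > 1" and M: "prob_space M" and Xpos: "\<And>\<omega>. \<omega> \<in> space M \<Longrightarrow> X \<omega> > 0"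
    and X: "distributed M lborel X (\<lambda>x. ennreal (density_X k c x))"
    and f: "f \<in> borel_measurable (restrict_space borel {0<..})"
  shows "(\<integral>\<omega>. complex_of_real (X \<omega>) * f (X \<omega>) \<partial>M) = (\<integral>\<omega>. f (1 / X \<omega>) \<partial>M)"
proof -
  define g where "g = density_X k c"
  \<comment> \<open>f is measurable only on the half line; its extension by 0 is Borel and agrees
    with f at all values of X and 1/X.\<close>
  define \<phi> where "\<phi> = (\<lambda>x. indicat_real {0<..} x *\<^sub>R f x)"
  have [measurable]: "\<phi> \<in> borel_measurable borel"
    using f unfolding \<phi>_def by (subst (asm) borel_measurable_restrict_space_iff) auto
  have g: "has_bochner_integral lborel g 1" unfolding g_def by (rule density_X_integral[OF k c])
  then have "integrable lborel g" by (simp add: has_bochner_integral_iff)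
  then have [measurable]: "g \<in> borel_measurable borel" by simp
  note Y = distributed_inverse[OF k c M Xpos X, folded g_def]
  note X = X[folded g_def]
  have pos: "AE x in lborel. g x \<ge> 0" by (rule AE_nonneg_if_density_integral_1[OF M X g])
  have g0: "g x = 0" if "x \<le> 0" for x using that by (simp add: g_def density_X_def)
  have pos': "AE x in lborel. x * g x \<ge> 0"
    using pos by eventually_elim (metis g0 linorder_le_cases mult_nonneg_nonneg mult_zero_right)
  have "(\<integral>\<omega>. complex_of_real (X \<omega>) * f (X \<omega>) \<partial>M) = (\<integral>\<omega>. complex_of_real (X \<omega>) * \<phi> (X \<omega>) \<partial>M)"
    using Xpos by (intro Bochner_Integration.integral_cong) (auto simp: \<phi>_def)
  also have "\<dots> = (\<integral>x. g x *\<^sub>R (complex_of_real x * \<phi> x) \<partial>lborel)"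
    by (rule distributed_expectation(2)[OF X pos]) measurable
  also have "\<dots> = (\<integral>x. (x * g x) *\<^sub>R \<phi> x \<partial>lborel)"
    by (simp add: scaleR_conv_of_real mult_ac)
  also have "\<dots> = (\<integral>\<omega>. \<phi> (1 / X \<omega>) \<partial>M)"
    by (rule distributed_expectation(2)[OF Y pos', symmetric]) measurable
  also have "\<dots> = (\<integral>\<omega>. f (1 / X \<omega>) \<partial>M)"
    using Xpos by (intro Bochner_Integration.integral_cong) (auto simp: \<phi>_def)
  finally show ?thesis .
qed

theorem theorem1p1:
  fixes k :: nat and c :: real
  assumes "k \<ge> 1" and "c > 1"
  shows "(\<forall>x>0. v k c x \<in> \<real> \<and> v k c x = 1 / complex_of_real x * v k c (1 / x)) \<and>
    (\<forall>(M :: 'a measure) (X :: 'a \<Rightarrow> real).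
       prob_space M \<longrightarrow>
       (\<forall>\<omega>\<in>space M. X \<omega> > 0) \<longrightarrow>
       distributed M lborel X (\<lambda>x. ennreal (density_X k c x)) \<longrightarrow>
         integrable M X \<and>
         distributed M lborel (\<lambda>\<omega>. 1 / X \<omega>)
           (\<lambda>x. ennreal (size_biased_density M X (density_X k c) x)) \<and>
         (\<forall>f :: real \<Rightarrow> complex.
            f \<in> borel_measurable (restrict_space borel {0<..}) \<longrightarrow>
            integrable M (\<lambda>\<omega>. complex_of_real (X \<omega>) * f (X \<omega>)) \<longrightarrow>
            integrable M (\<lambda>\<omega>. f (1 / X \<omega>)) \<longrightarrow>
            prob_space.expectation M (\<lambda>\<omega>. complex_of_real (X \<omega>) * f (X \<omega>)) =
            prob_space.expectation M (\<lambda>\<omega>. f (1 / X \<omega>))) \<and>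
         (\<forall>s :: complex.
            integrable M (\<lambda>\<omega>. complex_of_real (X \<omega>) powr s) \<and>
            prob_space.expectation M (\<lambda>\<omega>. complex_of_real (X \<omega>) powr s) = (2 * xi s) ^ k) \<and>
         prob_space.expectation M X = 1 \<and>
         integrable M (\<lambda>\<omega>. (X \<omega>)\<^sup>2) \<and>
         complex_of_real (prob_space.variance M X) = (2 * xi 2) ^ k - 1)"
proof (intro conjI allI impI)
  fix x :: real assume "x > 0"
  show "v k c x \<in> \<real>" by (rule v_real[OF assms \<open>x > 0\<close>])
  show "v k c x = 1 / complex_of_real x * v k c (1 / x)" by (rule v_reflection[OF assms \<open>x > 0\<close>])
next
  fix M :: "'a measure" and X :: "'a \<Rightarrow> real"
  assume M: "prob_space M" and "\<forall>\<omega>\<in>space M. X \<omega> > 0"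
    and X: "distributed M lborel X (\<lambda>x. ennreal (density_X k c x))"
  then have Xpos: "\<And>\<omega>. \<omega> \<in> space M \<Longrightarrow> X \<omega> > 0" by blast
  interpret prob_space M by (rule M)
  note mom = random_variable_moments[OF assms M Xpos X]
  \<comment> \<open>Positivity of X makes the complex powers with exponents 1 and 2 the ordinary
    ones, so the moments at s = 1 and s = 2 give the real mean and second moment.\<close>
  have p1: "complex_of_real (X \<omega>) powr 1 = of_real (X \<omega>)"
    and p2: "complex_of_real (X \<omega>) powr 2 = of_real ((X \<omega>)\<^sup>2)" if "\<omega> \<in> space M" for \<omega>
    using Xpos[OF that] powr_nat'[of "complex_of_real (X \<omega>)" 2] by auto
  have "integrable M (\<lambda>\<omega>. complex_of_real (X \<omega>))"
    using mom(1)[of 1] by (subst Bochner_Integration.integrable_cong[OF refl p1[symmetric]])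
  then show iX: "integrable M X" unfolding complex_of_real_integrable_eq .
  have "complex_of_real (expectation X) = (\<integral>\<omega>. complex_of_real (X \<omega>) powr 1 \<partial>M)"
    unfolding integral_complex_of_real[symmetric] by (rule Bochner_Integration.integral_cong) (auto simp: p1)
  also have "\<dots> = of_real 1" using mom(2)[of 1] by (simp only: two_xi_1 power_one of_real_1)
  finally show EX: "expectation X = 1" by (simp only: of_real_eq_iff)
  have "integrable M (\<lambda>\<omega>. complex_of_real ((X \<omega>)\<^sup>2))"
    using mom(1)[of 2] by (subst Bochner_Integration.integrable_cong[OF refl p2[symmetric]])
  then show iX2: "integrable M (\<lambda>\<omega>. (X \<omega>)\<^sup>2)" unfolding complex_of_real_integrable_eq .
  have "complex_of_real (expectation (\<lambda>\<omega>. (X \<omega>)\<^sup>2)) = (\<integral>\<omega>. complex_of_real (X \<omega>) powr 2 \<partial>M)"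
    unfolding integral_complex_of_real[symmetric] by (rule Bochner_Integration.integral_cong) (auto simp: p2)
  also have "\<dots> = (2 * xi 2) ^ k" using mom(2)[of 2] by (simp add: xi_eq)
  finally have EX2: "complex_of_real (expectation (\<lambda>\<omega>. (X \<omega>)\<^sup>2)) = (2 * xi 2) ^ k" .
  have "variance X = expectation (\<lambda>\<omega>. (X \<omega>)\<^sup>2) - 1"
    using variance_eq[OF iX iX2] EX by simp
  then show "complex_of_real (variance X) = (2 * xi 2) ^ k - 1"
    by (simp add: EX2)
  have "size_biased_density M X (density_X k c) = (\<lambda>x. x * density_X k c x)"
    by (simp add: size_biased_density_def EX fun_eq_iff)
  then show "distributed M lborel (\<lambda>\<omega>. 1 / X \<omega>) (\<lambda>x. ennreal (size_biased_density M X (density_X k c) x))"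
    using distributed_inverse[OF assms M Xpos X] by simp
  show "expectation (\<lambda>\<omega>. complex_of_real (X \<omega>) * f (X \<omega>)) = expectation (\<lambda>\<omega>. f (1 / X \<omega>))"
    if "f \<in> borel_measurable (restrict_space borel {0<..})" for f :: "real \<Rightarrow> complex"
    by (rule expectation_size_bias[OF assms M Xpos X that])
  show "integrable M (\<lambda>\<omega>. complex_of_real (X \<omega>) powr s)" for s by (rule mom(1))
  show "expectation (\<lambda>\<omega>. complex_of_real (X \<omega>) powr s) = (2 * xi s) ^ k" for s
    using mom(2)[of s] by (simp add: xi_eq)
qed

end
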